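(* Let $A$ and $B$ be dg algebras with enough idempotents. The following three notions are synonymous (through the identifications given in the context): (1) dg $A-B-$bimodule; (2) right dg $B\otimes A^{op}$-module; (3) left dg $A\otimes B^{op}$-module. In particular, there are equivalences of dg categories $$Dg-(B\otimes A^{op})\cong A-Dg-B\cong (A\otimes B^{op})-Dg.$$
   Context: $K$ is a fixed commutative ring with unit, $\otimes=\otimes_K$, $|x|$ denotes degree. A dg category is a $K$-linear category whose Hom's are dg $K$-modules with composition of degree zero satisfying $d(g\circ f)=d(g)\circ f+(-1)^{|g|}g\circ d(f)$; a dg functor preserves degrees of morphisms and commutes with differentials; an equivalence of dg categories is a full, faithful and dense dg functor. A dg algebra with enough idempotents is a graded associative $K$-algebra $A$ (not necessarily unital) having a family $(e_i)_{i\in I}$ of nonzero orthogonal homogeneous idempotents of degree $0$ with $A=\bigoplus_i e_iA=\bigoplus_i Ae_i$, together with a degree $+1$ $K$-linear map $d:A\to A$ with $d\circ d=0$, $d(e_i)=0$ and $d(ab)=d(a)b+(-1)^{|a|}ad(b)$. $A^{op}$ has the same graded $K$-module and differential, with multiplication $a^o\cdot b^o=(-1)^{|a||b|}(ba)^o$. $A\otimes B$ has multiplication $(a\otimes b)(a'\otimes b')=(-1)^{|b||a'|}aa'\otimes bb'$ and differential $d(a\otimes b)=d(a)\otimes b+(-1)^{|a|}a\otimes d(b)$. All modules are unitary. A right (resp. left) dg $A$-module is a graded right (resp. left) $A$-module $M$ with a degree $+1$ square-zero $K$-linear map $d_M$ such that $d_M(xa)=d_M(x)a+(-1)^{|x|}xd(a)$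 (resp. $d_M(ax)=d(a)x+(-1)^{|a|}ad_M(x)$). A dg $A-B-$bimodule is a graded $K$-module $M$ which is a graded left $A$-module and a graded right $B$-module with $(ax)b=a(xb)$, together with a degree $+1$ square-zero $K$-linear map $d_M$ such that $d_M(axb)=d_A(a)xb+(-1)^{|a|}ad_M(x)b+(-1)^{|a|+|x|}axd_B(b)$. $Dg-A$, $A-Dg$, $A-Dg-B$ denote the dg categories of right dg $A$-modules, left dg $A$-modules, dg $A-B-$bimodules, where the morphisms of degree $n$ are the $K$-linear maps $f$ homogeneous of degree $n$ with, respectively, $f(xa)=f(x)a$; $f(ax)=(-1)^{n|a|}af(x)$; $f(axb)=(-1)^{n|a|}af(x)b$; and the differential on Hom's is $d(f)=d_N\circ f-(-1)^{|f|}f\circ d_M$. The identifications meant: on a given dg $K$-module $(M,d_M)$, a dg $A-B-$bimodule structure corresponds to a right dg $B\otimes A^{op}$-module structure via $x(b\otimes a^o)=(-1)^{(|x|+|b|)|a|}axb$, and to a left dg $A\otimes B^{op}$-module structure via $(a\otimes b^o)x=(-1)^{|b||x|}axb$, for homogeneous $a\in A$, $b\in B$, $x\in M$. *)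

theory Defs
  imports "HOL-Algebra.Module" "HOL-Algebra.Free_Abelian_Groups"
begin

section \<open>Graded modules and dg modules over a commutative ring\<close>

text \<open>
  One record type serves for dg \<open>K\<close>-modules and for dg algebras: \<open>gr M n\<close> is the homogeneous
  component of degree \<open>n\<close> and \<open>dif M\<close> the differential. The inherited field \<open>mult\<close> is the
  multiplication of an algebra and has no meaning for a module; the inherited field \<open>one\<close> is never
  used, because algebras need not be unital.
\<close>

record ('k, 'm) dg = "('k, 'm) module" +
  gr :: "int \<Rightarrow> 'm set"
  dif :: "'m \<Rightarrow> 'm"

text \<open>\<open>sg M n x\<close> is $(-1)^n x$.\<close>

definition sg :: "('k, 'm) dg \<Rightarrow> int \<Rightarrow> 'm \<Rightarrow> 'm" where
  "sg M n x = (if even n then x else \<ominus>\<^bsub>M\<^esub> x)"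

definition internal_direct_sum :: "('k, 'm) dg \<Rightarrow> 'i set \<Rightarrow> ('i \<Rightarrow> 'm set) \<Rightarrow> bool" where
  "internal_direct_sum M I S \<longleftrightarrow>
     (\<forall>i\<in>I. S i \<subseteq> carrier M) \<and>
     (\<forall>x\<in>carrier M. \<exists>!c. c \<in> (\<Pi>\<^sub>E i\<in>I. S i) \<and> finite {i\<in>I. c i \<noteq> \<zero>\<^bsub>M\<^esub>} \<and>
        x = finsum M c {i\<in>I. c i \<noteq> \<zero>\<^bsub>M\<^esub>})"

definition linear_map :: "'k ring \<Rightarrow> ('k, 'm) dg \<Rightarrow> ('k, 'n) dg \<Rightarrow> ('m \<Rightarrow> 'n) \<Rightarrow> bool" where
  "linear_map K M N f \<longleftrightarrow> f \<in> hom (add_monoid M) (add_monoid N) \<and>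
     (\<forall>k\<in>carrier K. \<forall>x\<in>carrier M. f (k \<odot>\<^bsub>M\<^esub> x) = k \<odot>\<^bsub>N\<^esub> f x)"

definition bilinear_map ::
  "'k ring \<Rightarrow> ('k, 'm) dg \<Rightarrow> ('k, 'n) dg \<Rightarrow> ('k, 'p) dg \<Rightarrow> ('m \<Rightarrow> 'n \<Rightarrow> 'p) \<Rightarrow> bool" where
  "bilinear_map K M N P f \<longleftrightarrow>
     (\<forall>x\<in>carrier M. linear_map K N P (\<lambda>y. f x y)) \<and>
     (\<forall>y\<in>carrier N. linear_map K M P (\<lambda>x. f x y))"

text \<open>
  \<open>ext2\<close> fixes the irrelevant values of a binary operation outside the carriers, so that two
  operations that agree on the carriers are equal.
\<close>

definition ext2 :: "('k, 'm) dg \<Rightarrow> ('k, 'n) dg \<Rightarrow> ('m \<Rightarrow> 'n \<Rightarrow> 'p) \<Rightarrow> bool" where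
  "ext2 M N f \<longleftrightarrow> (\<forall>x y. \<not> (x \<in> carrier M \<and> y \<in> carrier N) \<longrightarrow> f x y = undefined)"

locale graded_module = module K M
  for K :: "'k ring" and M :: "('k, 'm) dg" +
  assumes gr_submodule: "submodule (gr M n) K M"
    and gr_direct_sum: "internal_direct_sum M UNIV (gr M)"

locale dg_module = graded_module K M
  for K :: "'k ring" and M :: "('k, 'm) dg" +
  assumes dif_linear: "linear_map K M M (dif M)"
    and dif_degree: "x \<in> gr M n \<Longrightarrow> dif M x \<in> gr M (n + 1)"
    and dif_dif: "x \<in> carrier M \<Longrightarrow> dif M (dif M x) = \<zero>\<^bsub>M\<^esub>"


section \<open>dg algebras with enough idempotents\<close>

locale dg_algebra = dg_module K A
  for K :: "'k ring" and A :: "('k, 'a) dg" +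
  assumes mult_bilinear: "bilinear_map K A A A (\<lambda>a b. a \<otimes>\<^bsub>A\<^esub> b)"
    and mult_assoc: "\<lbrakk>a \<in> carrier A; b \<in> carrier A; c \<in> carrier A\<rbrakk> \<Longrightarrow>
      (a \<otimes>\<^bsub>A\<^esub> b) \<otimes>\<^bsub>A\<^esub> c = a \<otimes>\<^bsub>A\<^esub> (b \<otimes>\<^bsub>A\<^esub> c)"
    and mult_degree: "\<lbrakk>a \<in> gr A p; b \<in> gr A q\<rbrakk> \<Longrightarrow> a \<otimes>\<^bsub>A\<^esub> b \<in> gr A (p + q)"
    and mult_leibniz: "\<lbrakk>a \<in> gr A p; b \<in> carrier A\<rbrakk> \<Longrightarrow>
      dif A (a \<otimes>\<^bsub>A\<^esub> b) = dif A a \<otimes>\<^bsub>A\<^esub> b \<oplus>\<^bsub>A\<^esub> sg A p (a \<otimes>\<^bsub>A\<^esub> dif A b)"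

text \<open>
  Nonzero orthogonal idempotents with different indices are different, so a family of them is the
  same thing as a set \<open>E\<close>, indexed by itself.
\<close>

locale dg_algebra_ei = dg_algebra K A
  for K :: "'k ring" and A :: "('k, 'a) dg" +
  assumes enough_idempotents: "\<exists>E. E \<subseteq> gr A 0 \<and>
      (\<forall>e\<in>E. e \<noteq> \<zero>\<^bsub>A\<^esub> \<and> e \<otimes>\<^bsub>A\<^esub> e = e \<and> dif A e = \<zero>\<^bsub>A\<^esub>) \<and>
      (\<forall>e\<in>E. \<forall>f\<in>E. e \<noteq> f \<longrightarrow> e \<otimes>\<^bsub>A\<^esub> f = \<zero>\<^bsub>A\<^esub>) \<and>
      internal_direct_sum A E (\<lambda>e. {e \<otimes>\<^bsub>A\<^esub> a |a. a \<in> carrier A}) \<and>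
      internal_direct_sum A E (\<lambda>e. {a \<otimes>\<^bsub>A\<^esub> e |a. a \<in> carrier A})"

text \<open>
  The opposite algebra lives on the same set, \<open>a\<close> standing for $a^o$. As in the definitions below, an
  operation prescribed on homogeneous elements is selected as the unique (bi)linear map with these
  values.
\<close>

definition op_dg :: "'k ring \<Rightarrow> ('k, 'a) dg \<Rightarrow> ('k, 'a) dg" where
  "op_dg K A = A\<lparr>monoid.mult :=
     (THE m. ext2 A A m \<and> bilinear_map K A A A m \<and>
        (\<forall>p q. \<forall>a\<in>gr A p. \<forall>b\<in>gr A q. m a b = sg A (p * q) (b \<otimes>\<^bsub>A\<^esub> a)))\<rparr>"


section \<open>Tensor products\<close>

text \<open>
  \<open>M \<otimes>\<^sub>K N\<close> is the free abelian group on \<open>carrier M \<times> carrier N\<close> modulo the relations of biadditivity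
  and \<open>K\<close>-balancedness.
\<close>

definition tensor_relators ::
  "'k ring \<Rightarrow> ('k, 'm) dg \<Rightarrow> ('k, 'n) dg \<Rightarrow> ('m \<times> 'n \<Rightarrow>\<^sub>0 int) set" where
  "tensor_relators K M N =
     {frag_of (x \<oplus>\<^bsub>M\<^esub> x', y) - frag_of (x, y) - frag_of (x', y) |x x' y.
        x \<in> carrier M \<and> x' \<in> carrier M \<and> y \<in> carrier N} \<union>
     {frag_of (x, y \<oplus>\<^bsub>N\<^esub> y') - frag_of (x, y) - frag_of (x, y') |x y y'.
        x \<in> carrier M \<and> y \<in> carrier N \<and> y' \<in> carrier N} \<union>
     {frag_of (k \<odot>\<^bsub>M\<^esub> x, y) - frag_of (x, k \<odot>\<^bsub>N\<^esub> y) |k x y.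
        k \<in> carrier K \<and> x \<in> carrier M \<and> y \<in> carrier N}"

definition tensor_null ::
  "'k ring \<Rightarrow> ('k, 'm) dg \<Rightarrow> ('k, 'n) dg \<Rightarrow> ('m \<times> 'n \<Rightarrow>\<^sub>0 int) set" where
  "tensor_null K M N =
     generate (free_Abelian_group (carrier M \<times> carrier N)) (tensor_relators K M N)"

definition tensor_group ::
  "'k ring \<Rightarrow> ('k, 'm) dg \<Rightarrow> ('k, 'n) dg \<Rightarrow> ('m \<times> 'n \<Rightarrow>\<^sub>0 int) set monoid" where
  "tensor_group K M N = free_Abelian_group (carrier M \<times> carrier N) Mod tensor_null K M N"

text \<open>\<open>pure K M N x y\<close> is $x \otimes y$.\<close>

definition pure ::
  "'k ring \<Rightarrow> ('k, 'm) dg \<Rightarrow> ('k, 'n) dg \<Rightarrow> 'm \<Rightarrow> 'n \<Rightarrow> ('m \<times> 'n \<Rightarrow>\<^sub>0 int) set" where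
  "pure K M N x y =
     tensor_null K M N #>\<^bsub>free_Abelian_group (carrier M \<times> carrier N)\<^esub> frag_of (x, y)"

definition tensor_module ::
  "'k ring \<Rightarrow> ('k, 'm) dg \<Rightarrow> ('k, 'n) dg \<Rightarrow> ('k, ('m \<times> 'n \<Rightarrow>\<^sub>0 int) set) dg" where
  "tensor_module K M N =
     \<lparr>carrier = carrier (tensor_group K M N),
      monoid.mult = undefined,
      one = undefined,
      ring.zero = \<one>\<^bsub>tensor_group K M N\<^esub>,
      add = monoid.mult (tensor_group K M N),
      smult = (\<lambda>k. THE h. h \<in> extensional (carrier (tensor_group K M N)) \<and>
         h \<in> hom (tensor_group K M N) (tensor_group K M N) \<and>
         (\<forall>x\<in>carrier M. \<forall>y\<in>carrier N. h (pure K M N x y) = pure K M N (k \<odot>\<^bsub>M\<^esub> x) y)),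
      gr = (\<lambda>n. generate (tensor_group K M N)
         {pure K M N x y |x y p q. x \<in> gr M p \<and> y \<in> gr N q \<and> p + q = n}),
      dif = undefined\<rparr>"

definition tensor_dif ::
  "'k ring \<Rightarrow> ('k, 'm) dg \<Rightarrow> ('k, 'n) dg \<Rightarrow> ('m \<times> 'n \<Rightarrow>\<^sub>0 int) set \<Rightarrow> ('m \<times> 'n \<Rightarrow>\<^sub>0 int) set" where
  "tensor_dif K M N = (let T = tensor_module K M N in
     THE D. D \<in> extensional (carrier T) \<and> linear_map K T T D \<and>
       (\<forall>p. \<forall>x\<in>gr M p. \<forall>y\<in>carrier N. D (pure K M N x y) =
          pure K M N (dif M x) y \<oplus>\<^bsub>T\<^esub> sg T p (pure K M N x (dif N y))))"

definition tensor_mult ::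
  "'k ring \<Rightarrow> ('k, 'a) dg \<Rightarrow> ('k, 'b) dg \<Rightarrow>
   ('a \<times> 'b \<Rightarrow>\<^sub>0 int) set \<Rightarrow> ('a \<times> 'b \<Rightarrow>\<^sub>0 int) set \<Rightarrow> ('a \<times> 'b \<Rightarrow>\<^sub>0 int) set" where
  "tensor_mult K A B = (let T = tensor_module K A B in
     THE m. ext2 T T m \<and> bilinear_map K T T T m \<and>
       (\<forall>p q. \<forall>a\<in>carrier A. \<forall>b\<in>gr B p. \<forall>a'\<in>gr A q. \<forall>b'\<in>carrier B.
          m (pure K A B a b) (pure K A B a' b') =
            sg T (p * q) (pure K A B (a \<otimes>\<^bsub>A\<^esub> a') (b \<otimes>\<^bsub>B\<^esub> b'))))"

definition tensor_dg ::
  "'k ring \<Rightarrow> ('k, 'a) dg \<Rightarrow> ('k, 'b) dg \<Rightarrow> ('k, ('a \<times> 'b \<Rightarrow>\<^sub>0 int) set) dg" where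
  "tensor_dg K A B = (tensor_module K A B)
     \<lparr>monoid.mult := tensor_mult K A B, dif := tensor_dif K A B\<rparr>"


section \<open>dg modules and dg bimodules\<close>

text \<open>
  Actions are passed separately from the underlying dg \<open>K\<close>-module \<open>M\<close>. An algebra without unit acts
  unitarily if the products generate \<open>M\<close>, i.e. \<open>AM = M\<close> and \<open>MA = M\<close>, respectively.
\<close>

locale graded_left_module = dg_algebra_ei K A + M: graded_module K M
  for K :: "'k ring" and A :: "('k, 'a) dg" and M :: "('k, 'm) dg" and l :: "'a \<Rightarrow> 'm \<Rightarrow> 'm" +
  assumes left_ext: "ext2 A M l"
    and left_bilinear: "bilinear_map K A M M l"
    and left_assoc: "\<lbrakk>a \<in> carrier A; b \<in> carrier A; x \<in> carrier M\<rbrakk> \<Longrightarrow>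
      l (a \<otimes>\<^bsub>A\<^esub> b) x = l a (l b x)"
    and left_degree: "\<lbrakk>a \<in> gr A p; x \<in> gr M q\<rbrakk> \<Longrightarrow> l a x \<in> gr M (p + q)"
    and left_unitary: "generate (add_monoid M) {l a x |a x. a \<in> carrier A \<and> x \<in> carrier M} = carrier M"

locale graded_right_module = dg_algebra_ei K A + M: graded_module K M
  for K :: "'k ring" and A :: "('k, 'a) dg" and M :: "('k, 'm) dg" and r :: "'m \<Rightarrow> 'a \<Rightarrow> 'm" +
  assumes right_ext: "ext2 M A r"
    and right_bilinear: "bilinear_map K M A M r"
    and right_assoc: "\<lbrakk>a \<in> carrier A; b \<in> carrier A; x \<in> carrier M\<rbrakk> \<Longrightarrow>
      r x (a \<otimes>\<^bsub>A\<^esub> b) = r (r x a) b"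
    and right_degree: "\<lbrakk>x \<in> gr M p; a \<in> gr A q\<rbrakk> \<Longrightarrow> r x a \<in> gr M (p + q)"
    and right_unitary: "generate (add_monoid M) {r x a |x a. x \<in> carrier M \<and> a \<in> carrier A} = carrier M"

locale left_dg_module = graded_left_module K A M l + M: dg_module K M
  for K :: "'k ring" and A :: "('k, 'a) dg" and M :: "('k, 'm) dg" and l :: "'a \<Rightarrow> 'm \<Rightarrow> 'm" +
  assumes left_leibniz: "\<lbrakk>a \<in> gr A p; x \<in> carrier M\<rbrakk> \<Longrightarrow>
      dif M (l a x) = l (dif A a) x \<oplus>\<^bsub>M\<^esub> sg M p (l a (dif M x))"

locale right_dg_module = graded_right_module K A M r + M: dg_module K M
  for K :: "'k ring" and A :: "('k, 'a) dg" and M :: "('k, 'm) dg" and r :: "'m \<Rightarrow> 'a \<Rightarrow> 'm" +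
  assumes right_leibniz: "\<lbrakk>x \<in> gr M p; a \<in> carrier A\<rbrakk> \<Longrightarrow>
      dif M (r x a) = r (dif M x) a \<oplus>\<^bsub>M\<^esub> sg M p (r x (dif A a))"

locale dg_bimodule =
    left: graded_left_module K A M l + right: graded_right_module K B M r + M: dg_module K M
  for K :: "'k ring" and A :: "('k, 'a) dg" and B :: "('k, 'b) dg" and M :: "('k, 'm) dg"
    and l :: "'a \<Rightarrow> 'm \<Rightarrow> 'm" and r :: "'m \<Rightarrow> 'b \<Rightarrow> 'm" +
  assumes actions_commute: "\<lbrakk>a \<in> carrier A; x \<in> carrier M; b \<in> carrier B\<rbrakk> \<Longrightarrow>
      r (l a x) b = l a (r x b)"
    and bimodule_leibniz: "\<lbrakk>a \<in> gr A p; x \<in> gr M q; b \<in> carrier B\<rbrakk> \<Longrightarrow>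
      dif M (r (l a x) b) =
        r (l (dif A a) x) b \<oplus>\<^bsub>M\<^esub> sg M p (r (l a (dif M x)) b)
          \<oplus>\<^bsub>M\<^esub> sg M (p + q) (r (l a x) (dif B b))"


section \<open>dg categories\<close>

record ('k, 'o, 'f) dg_cat =
  Obj :: "'o set"
  Hom :: "'o \<Rightarrow> 'o \<Rightarrow> ('k, 'f) dg"
  Comp :: "'o \<Rightarrow> 'o \<Rightarrow> 'o \<Rightarrow> 'f \<Rightarrow> 'f \<Rightarrow> 'f"
  Ident :: "'o \<Rightarrow> 'f"

text \<open>\<open>Comp C X Y Z g f\<close> is $g \circ f$ for $f : X \to Y$ and $g : Y \to Z$.\<close>

locale dg_category = cring K
  for K :: "'k ring" and C :: "('k, 'o, 'f) dg_cat" +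
  assumes Hom_dg: "\<lbrakk>X \<in> Obj C; Y \<in> Obj C\<rbrakk> \<Longrightarrow> dg_module K (Hom C X Y)"
    and Comp_bilinear: "\<lbrakk>X \<in> Obj C; Y \<in> Obj C; Z \<in> Obj C\<rbrakk> \<Longrightarrow>
      bilinear_map K (Hom C Y Z) (Hom C X Y) (Hom C X Z) (Comp C X Y Z)"
    and Comp_degree: "\<lbrakk>X \<in> Obj C; Y \<in> Obj C; Z \<in> Obj C; g \<in> gr (Hom C Y Z) p; f \<in> gr (Hom C X Y) q\<rbrakk> \<Longrightarrow>
      Comp C X Y Z g f \<in> gr (Hom C X Z) (p + q)"
    and Comp_assoc: "\<lbrakk>W \<in> Obj C; X \<in> Obj C; Y \<in> Obj C; Z \<in> Obj C;
        h \<in> carrier (Hom C Y Z); g \<in> carrier (Hom C X Y); f \<in> carrier (Hom C W X)\<rbrakk> \<Longrightarrow>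
      Comp C W X Z (Comp C X Y Z h g) f = Comp C W Y Z h (Comp C W X Y g f)"
    and Ident_carrier: "X \<in> Obj C \<Longrightarrow> Ident C X \<in> carrier (Hom C X X)"
    and Ident_left: "\<lbrakk>X \<in> Obj C; Y \<in> Obj C; f \<in> carrier (Hom C X Y)\<rbrakk> \<Longrightarrow>
      Comp C X Y Y (Ident C Y) f = f"
    and Ident_right: "\<lbrakk>X \<in> Obj C; Y \<in> Obj C; f \<in> carrier (Hom C X Y)\<rbrakk> \<Longrightarrow>
      Comp C X X Y f (Ident C X) = f"
    and Comp_leibniz: "\<lbrakk>X \<in> Obj C; Y \<in> Obj C; Z \<in> Obj C;
        g \<in> gr (Hom C Y Z) p; f \<in> carrier (Hom C X Y)\<rbrakk> \<Longrightarrow>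
      dif (Hom C X Z) (Comp C X Y Z g f) =
        Comp C X Y Z (dif (Hom C Y Z) g) f
          \<oplus>\<^bsub>Hom C X Z\<^esub> sg (Hom C X Z) p (Comp C X Y Z g (dif (Hom C X Y) f))"

locale dg_functor = source: dg_category K C + target: dg_category K D
  for K :: "'k ring" and C :: "('k, 'o, 'f) dg_cat" and D :: "('k, 'p, 'g) dg_cat"
    and F0 :: "'o \<Rightarrow> 'p" and F1 :: "'o \<Rightarrow> 'o \<Rightarrow> 'f \<Rightarrow> 'g" +
  assumes F0_Obj: "X \<in> Obj C \<Longrightarrow> F0 X \<in> Obj D"
    and F1_linear: "\<lbrakk>X \<in> Obj C; Y \<in> Obj C\<rbrakk> \<Longrightarrow>
      linear_map K (Hom C X Y) (Hom D (F0 X) (F0 Y)) (F1 X Y)"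
    and F1_degree: "\<lbrakk>X \<in> Obj C; Y \<in> Obj C; f \<in> gr (Hom C X Y) n\<rbrakk> \<Longrightarrow>
      F1 X Y f \<in> gr (Hom D (F0 X) (F0 Y)) n"
    and F1_dif: "\<lbrakk>X \<in> Obj C; Y \<in> Obj C; f \<in> carrier (Hom C X Y)\<rbrakk> \<Longrightarrow>
      F1 X Y (dif (Hom C X Y) f) = dif (Hom D (F0 X) (F0 Y)) (F1 X Y f)"
    and F1_Comp: "\<lbrakk>X \<in> Obj C; Y \<in> Obj C; Z \<in> Obj C;
        g \<in> carrier (Hom C Y Z); f \<in> carrier (Hom C X Y)\<rbrakk> \<Longrightarrow>
      F1 X Z (Comp C X Y Z g f) = Comp D (F0 X) (F0 Y) (F0 Z) (F1 Y Z g) (F1 X Y f)"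
    and F1_Ident: "X \<in> Obj C \<Longrightarrow> F1 X X (Ident C X) = Ident D (F0 X)"

text \<open>
  Isomorphic objects are understood in the strict sense: the isomorphism and its inverse are
  homogeneous of degree 0 and closed.
\<close>

definition dg_isomorphic :: "('k, 'o, 'f) dg_cat \<Rightarrow> 'o \<Rightarrow> 'o \<Rightarrow> bool" where
  "dg_isomorphic C X Y \<longleftrightarrow>
     (\<exists>f\<in>gr (Hom C X Y) 0. \<exists>g\<in>gr (Hom C Y X) 0.
        dif (Hom C X Y) f = \<zero>\<^bsub>Hom C X Y\<^esub> \<and> dif (Hom C Y X) g = \<zero>\<^bsub>Hom C Y X\<^esub> \<and>
        Comp C X Y X g f = Ident C X \<and> Comp C Y X Y f g = Ident C Y)"

locale dg_equivalence = dg_functor K C D F0 F1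
  for K :: "'k ring" and C :: "('k, 'o, 'f) dg_cat" and D :: "('k, 'p, 'g) dg_cat"
    and F0 :: "'o \<Rightarrow> 'p" and F1 :: "'o \<Rightarrow> 'o \<Rightarrow> 'f \<Rightarrow> 'g" +
  assumes full: "\<lbrakk>X \<in> Obj C; Y \<in> Obj C\<rbrakk> \<Longrightarrow>
      carrier (Hom D (F0 X) (F0 Y)) \<subseteq> F1 X Y ` carrier (Hom C X Y)"
    and faithful: "\<lbrakk>X \<in> Obj C; Y \<in> Obj C\<rbrakk> \<Longrightarrow> inj_on (F1 X Y) (carrier (Hom C X Y))"
    and dense: "Z \<in> Obj D \<Longrightarrow> \<exists>X\<in>Obj C. dg_isomorphic D (F0 X) Z"


section \<open>The dg categories of dg modules and dg bimodules\<close>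

definition fun_module :: "('k, 'm) dg \<Rightarrow> ('k, 'n) dg \<Rightarrow> ('k, 'm \<Rightarrow> 'n) dg" where
  "fun_module M N =
     \<lparr>carrier = carrier M \<rightarrow>\<^sub>E carrier N,
      monoid.mult = undefined,
      one = undefined,
      ring.zero = (\<lambda>x\<in>carrier M. \<zero>\<^bsub>N\<^esub>),
      add = (\<lambda>f g. \<lambda>x\<in>carrier M. f x \<oplus>\<^bsub>N\<^esub> g x),
      smult = (\<lambda>k f. \<lambda>x\<in>carrier M. k \<odot>\<^bsub>N\<^esub> f x),
      gr = (\<lambda>n. {}),
      dif = undefined\<rparr>"

text \<open>
  Given the sets \<open>H n\<close> of morphisms of degree \<open>n\<close>, the Hom module is their sum inside the maps
  \<open>M \<rightarrow> N\<close>, with $d(f) = d_N \circ f - (-1)^n f \circ d_M$ on \<open>H n\<close>.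
\<close>

definition hom_graded ::
  "('k, 'm) dg \<Rightarrow> ('k, 'n) dg \<Rightarrow> (int \<Rightarrow> ('m \<Rightarrow> 'n) set) \<Rightarrow> ('k, 'm \<Rightarrow> 'n) dg" where
  "hom_graded M N H = (fun_module M N)
     \<lparr>carrier := generate (add_monoid (fun_module M N)) (\<Union>n. H n), gr := H\<rparr>"

definition hom_dg ::
  "'k ring \<Rightarrow> ('k, 'm) dg \<Rightarrow> ('k, 'n) dg \<Rightarrow> (int \<Rightarrow> ('m \<Rightarrow> 'n) set) \<Rightarrow> ('k, 'm \<Rightarrow> 'n) dg" where
  "hom_dg K M N H = (let G = hom_graded M N H in G\<lparr>dif :=
     (THE D. D \<in> extensional (carrier G) \<and> linear_map K G G D \<and>
        (\<forall>n. \<forall>f\<in>H n. D f =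
           (\<lambda>x\<in>carrier M. dif N (f x) \<ominus>\<^bsub>N\<^esub> sg N n (f (dif M x)))))\<rparr>)"

definition graded_maps ::
  "'k ring \<Rightarrow> ('k, 'm) dg \<Rightarrow> ('k, 'n) dg \<Rightarrow> int \<Rightarrow> ('m \<Rightarrow> 'n) set" where
  "graded_maps K M N n = {f. f \<in> extensional (carrier M) \<and> linear_map K M N f \<and>
     (\<forall>p. \<forall>x\<in>gr M p. f x \<in> gr N (p + n))}"

text \<open>
  The objects of the three categories are pairs of a dg \<open>K\<close>-module, whose underlying set is a subset
  of the type \<open>'m\<close>, and an action or a pair of actions.
\<close>

definition concrete_dg_cat ::
  "'k ring \<Rightarrow> (('k, 'm) dg \<times> 's) set \<Rightarrow>
   (('k, 'm) dg \<times> 's \<Rightarrow> ('k, 'm) dg \<times> 's \<Rightarrow> int \<Rightarrow> ('m \<Rightarrow> 'm) set) \<Rightarrow>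
   ('k, ('k, 'm) dg \<times> 's, 'm \<Rightarrow> 'm) dg_cat" where
  "concrete_dg_cat K Obs H =
     \<lparr>Obj = Obs,
      Hom = (\<lambda>X Y. hom_dg K (fst X) (fst Y) (H X Y)),
      Comp = (\<lambda>X Y Z g f. compose (carrier (fst X)) g f),
      Ident = (\<lambda>X. \<lambda>x\<in>carrier (fst X). x)\<rparr>"

definition right_Dg ::
  "'k ring \<Rightarrow> ('k, 'a) dg \<Rightarrow>
   ('k, ('k, 'm) dg \<times> ('m \<Rightarrow> 'a \<Rightarrow> 'm), 'm \<Rightarrow> 'm) dg_cat" where
  "right_Dg K A = concrete_dg_cat K {(M, r). right_dg_module K A M r}
     (\<lambda>(M, r) (N, r') n. {f \<in> graded_maps K M N n.
        \<forall>x\<in>carrier M. \<forall>a\<in>carrier A. f (r x a) = r' (f x) a})"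

definition left_Dg ::
  "'k ring \<Rightarrow> ('k, 'a) dg \<Rightarrow>
   ('k, ('k, 'm) dg \<times> ('a \<Rightarrow> 'm \<Rightarrow> 'm), 'm \<Rightarrow> 'm) dg_cat" where
  "left_Dg K A = concrete_dg_cat K {(M, l). left_dg_module K A M l}
     (\<lambda>(M, l) (N, l') n. {f \<in> graded_maps K M N n.
        \<forall>p. \<forall>a\<in>gr A p. \<forall>x\<in>carrier M. f (l a x) = sg N (n * p) (l' a (f x))})"

definition bi_Dg ::
  "'k ring \<Rightarrow> ('k, 'a) dg \<Rightarrow> ('k, 'b) dg \<Rightarrow>
   ('k, ('k, 'm) dg \<times> ('a \<Rightarrow> 'm \<Rightarrow> 'm) \<times> ('m \<Rightarrow> 'b \<Rightarrow> 'm), 'm \<Rightarrow> 'm) dg_cat" where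
  "bi_Dg K A B = concrete_dg_cat K {(M, l, r). dg_bimodule K A B M l r}
     (\<lambda>(M, l, r) (N, l', r') n. {f \<in> graded_maps K M N n.
        \<forall>p. \<forall>a\<in>gr A p. \<forall>x\<in>carrier M. \<forall>b\<in>carrier B.
          f (r (l a x) b) = sg N (n * p) (r' (l' a (f x)) b)})"


section \<open>The identifications\<close>

text \<open>$x (b \otimes a^o) = (-1)^{(|x| + |b|) |a|} a x b$ for a right action \<open>\<rho>\<close> of $B \otimes A^{op}$.\<close>

definition right_identified ::
  "'k ring \<Rightarrow> ('k, 'a) dg \<Rightarrow> ('k, 'b) dg \<Rightarrow> ('k, 'm) dg \<Rightarrow>
   ('a \<Rightarrow> 'm \<Rightarrow> 'm) \<Rightarrow> ('m \<Rightarrow> 'b \<Rightarrow> 'm) \<Rightarrow> ('m \<Rightarrow> ('b \<times> 'a \<Rightarrow>\<^sub>0 int) set \<Rightarrow> 'm) \<Rightarrow> bool" where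
  "right_identified K A B M l r \<rho> \<longleftrightarrow>
     (\<forall>p q s. \<forall>a\<in>gr A p. \<forall>b\<in>gr B q. \<forall>x\<in>gr M s.
        \<rho> x (pure K B (op_dg K A) b a) = sg M ((s + q) * p) (r (l a x) b))"

text \<open>$(a \otimes b^o) x = (-1)^{|b| |x|} a x b$ for a left action \<open>\<mu>\<close> of $A \otimes B^{op}$.\<close>

definition left_identified ::
  "'k ring \<Rightarrow> ('k, 'a) dg \<Rightarrow> ('k, 'b) dg \<Rightarrow> ('k, 'm) dg \<Rightarrow>
   ('a \<Rightarrow> 'm \<Rightarrow> 'm) \<Rightarrow> ('m \<Rightarrow> 'b \<Rightarrow> 'm) \<Rightarrow> (('a \<times> 'b \<Rightarrow>\<^sub>0 int) set \<Rightarrow> 'm \<Rightarrow> 'm) \<Rightarrow> bool" where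
  "left_identified K A B M l r \<mu> \<longleftrightarrow>
     (\<forall>p q s. \<forall>a\<in>gr A p. \<forall>b\<in>gr B q. \<forall>x\<in>gr M s.
        \<mu> (pure K A (op_dg K B) a b) x = sg M (q * s) (r (l a x) b))"

definition one_to_one :: "('s \<Rightarrow> bool) \<Rightarrow> ('t \<Rightarrow> bool) \<Rightarrow> ('s \<Rightarrow> 't \<Rightarrow> bool) \<Rightarrow> bool" where
  "one_to_one P Q R \<longleftrightarrow> (\<forall>s. P s \<longrightarrow> (\<exists>!t. Q t \<and> R s t)) \<and> (\<forall>t. Q t \<longrightarrow> (\<exists>!s. P s \<and> R s t))"

end

theory Submission
  imports Defs
begin

text \<open>
  A dg \<open>A\<close>-\<open>B\<close>-bimodule \<open>M\<close> becomes a right module over $B \otimes A^{op}$ by the rule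
  $x(b \otimes a^o) = (-1)^{(|x|+|b|)|a|} axb$. The right-hand side is linear in each of \<open>a\<close>, \<open>x\<close> and
  \<open>b\<close>, so the universal property of the tensor product provides the action, and associativity and
  the Leibniz rule are comparisons of signs on homogeneous elements (\<open>right_module_of_bimodule\<close>).

  In the other direction \<open>x(b \<otimes> a)\<close> has to be taken apart. There is no unit to put in place of \<open>a\<close>
  or \<open>b\<close>, but finite sums of the idempotents are closed local units of degree 0, and the value of
  $x(b \otimes u)$ is the same for all sufficiently large local units \<open>u\<close> of \<open>A\<close>, because every
  element of a unitary module is a sum of products. This value is \<open>xb\<close>; likewise $x(v \otimes a^o)$
  becomes stationary in \<open>v\<close> and gives \<open>ax\<close> up to sign (locale \<open>multiplier\<close>,
  \<open>bimodule_of_right_module\<close>). Local units also show that both actions are determined by the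
  products \<open>axb\<close> (\<open>bimodule_actions_eqI\<close>), hence by the identification.

  Left modules over $A \otimes B^{op}$ reduce to right modules over $B \otimes A^{op}$: the exchange
  of the factors with its sign is an antihomomorphism between these algebras
  (\<open>exchange_antihom\<close>), and antihomomorphisms turn left modules into right modules and vice versa
  (locale \<open>dg_antihom\<close>).

  The identifications leave the underlying complexes unchanged, and a map is a homomorphism for one
  of the identified structures if and only if it is one for the others (\<open>right_maps_eq\<close>,
  \<open>left_maps_eq\<close>). The three categories thus have the same Hom complexes. The axioms of a dg
  category are verified for bimodules (\<open>bi_Dg_category\<close>) and inherited by the other two, and the
  functors are the identifications on objects and the identity on morphisms.

  Opposite algebras, tensor products and Hom complexes are specified by their values on homogeneous
  elements or pure tensors only. The first half of the development shows that linear maps with these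
  values exist (\<open>graded_ext\<close>, \<open>koszul\<close>, \<open>lift\<close>), that the resulting operations are those of a dg
  algebra, and that tensor products and opposites again have enough idempotents.
\<close>

section \<open>Signs, linear and bilinear maps\<close>

lemma (in abelian_group) eq_of_minus_zero:
  "x \<ominus> y = \<zero> \<Longrightarrow> x \<in> carrier G \<Longrightarrow> y \<in> carrier G \<Longrightarrow> x = y"
  using minus_equality[of x "\<ominus> y"] by (simp add: a_minus_def)

text \<open>
  The locale of modules is specialised to the record type for dg modules, on which the signs live.
\<close>

locale k_module = module K M for K :: "'k ring" and M :: "('k, 'm) dg"
begin

lemma sg_closed [simp]: "x \<in> carrier M \<Longrightarrow> sg M n x \<in> carrier M"
  by (simp add: sg_def)

lemma sg_sg [simp]: "x \<in> carrier M \<Longrightarrow> sg M m (sg M n x) = sg M (m + n) x"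
  by (auto simp: sg_def)

lemma sg_add: "x \<in> carrier M \<Longrightarrow> y \<in> carrier M \<Longrightarrow>
    sg M n (x \<oplus>\<^bsub>M\<^esub> y) = sg M n x \<oplus>\<^bsub>M\<^esub> sg M n y"
  by (auto simp: sg_def minus_add)

lemma sg_smult: "k \<in> carrier K \<Longrightarrow> x \<in> carrier M \<Longrightarrow> sg M n (k \<odot>\<^bsub>M\<^esub> x) = k \<odot>\<^bsub>M\<^esub> sg M n x"
  by (auto simp: sg_def smult_r_minus)

lemma sg_zero_elem [simp]: "sg M n \<zero>\<^bsub>M\<^esub> = \<zero>\<^bsub>M\<^esub>"
  by (simp add: sg_def)

lemma sg_inject: "sg M n x = sg M n y \<Longrightarrow> x \<in> carrier M \<Longrightarrow> y \<in> carrier M \<Longrightarrow> x = y"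
  by (cases "even n") (simp_all add: sg_def, metis M.minus_minus)

lemma generate_closed: "S \<subseteq> carrier M \<Longrightarrow> x \<in> generate (add_monoid M) S \<Longrightarrow> x \<in> carrier M"
  using add.generate_in_carrier by simp

lemma generator_induct [consumes 1, case_names subset zero gen minus add]:
  assumes "x \<in> generate (add_monoid M) S" and S: "S \<subseteq> carrier M"
    and "P \<zero>\<^bsub>M\<^esub>" and "\<And>s. s \<in> S \<Longrightarrow> P s" and "\<And>s. s \<in> S \<Longrightarrow> P (\<ominus>\<^bsub>M\<^esub> s)"
    and "\<And>x y. x \<in> carrier M \<Longrightarrow> y \<in> carrier M \<Longrightarrow> x \<in> generate (add_monoid M) S \<Longrightarrow>
      y \<in> generate (add_monoid M) S \<Longrightarrow> P x \<Longrightarrow> P y \<Longrightarrow> P (x \<oplus>\<^bsub>M\<^esub> y)"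
  shows "P x"
  using assms(1)
  by (induction rule: generate.induct)
    (use assms generate_closed[OF S] in \<open>auto simp flip: a_inv_def\<close>)

text \<open>A set of generators that is closed under negation needs no separate case for the inverses.\<close>

lemma generator_induct_neg [consumes 1, case_names subset neg zero gen add]:
  assumes "x \<in> generate (add_monoid M) S" and "S \<subseteq> carrier M"
    and "\<And>s. s \<in> S \<Longrightarrow> \<ominus>\<^bsub>M\<^esub> s \<in> S"
    and "P \<zero>\<^bsub>M\<^esub>" and "\<And>s. s \<in> S \<Longrightarrow> P s"
    and "\<And>x y. x \<in> carrier M \<Longrightarrow> y \<in> carrier M \<Longrightarrow> x \<in> generate (add_monoid M) S \<Longrightarrow>
      y \<in> generate (add_monoid M) S \<Longrightarrow> P x \<Longrightarrow> P y \<Longrightarrow> P (x \<oplus>\<^bsub>M\<^esub> y)"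
  shows "P x"
  using assms(1) by (induction rule: generator_induct) (use assms in auto)

lemma generate_zero: "\<zero>\<^bsub>M\<^esub> \<in> generate (add_monoid M) S"
  using generate.one[of "add_monoid M" S] by simp

lemma generate_add: "x \<in> generate (add_monoid M) S \<Longrightarrow> y \<in> generate (add_monoid M) S \<Longrightarrow>
    x \<oplus>\<^bsub>M\<^esub> y \<in> generate (add_monoid M) S"
  using generate.eng[of x "add_monoid M" S y] by simp

lemma generate_minus: "S \<subseteq> carrier M \<Longrightarrow> x \<in> generate (add_monoid M) S \<Longrightarrow>
    \<ominus>\<^bsub>M\<^esub> x \<in> generate (add_monoid M) S"
  using add.generate_m_inv_closed[of S x] by (simp add: a_inv_def)

lemma generate_incl: "x \<in> S \<Longrightarrow> x \<in> generate (add_monoid M) S"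
  by (rule generate.incl)

end

sublocale graded_module \<subseteq> k_module ..

locale lin_map = M: k_module K M + N: k_module K N
  for K :: "'k ring" and M :: "('k, 'm) dg" and N :: "('k, 'n) dg" and f +
  assumes lin: "linear_map K M N f"
begin

lemma closed [simp]: "x \<in> carrier M \<Longrightarrow> f x \<in> carrier N"
  using lin by (auto simp: linear_map_def hom_def)

lemma add: "x \<in> carrier M \<Longrightarrow> y \<in> carrier M \<Longrightarrow> f (x \<oplus>\<^bsub>M\<^esub> y) = f x \<oplus>\<^bsub>N\<^esub> f y"
  using lin by (auto simp: linear_map_def hom_def)

lemma smult: "k \<in> carrier K \<Longrightarrow> x \<in> carrier M \<Longrightarrow> f (k \<odot>\<^bsub>M\<^esub> x) = k \<odot>\<^bsub>N\<^esub> f x"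
  using lin by (auto simp: linear_map_def)

lemma zero [simp]: "f \<zero>\<^bsub>M\<^esub> = \<zero>\<^bsub>N\<^esub>"
  using add[of "\<zero>\<^bsub>M\<^esub>" "\<zero>\<^bsub>M\<^esub>"] N.add.l_cancel_one'[of "f \<zero>\<^bsub>M\<^esub>" "f \<zero>\<^bsub>M\<^esub>"] by simp

lemma minus: "x \<in> carrier M \<Longrightarrow> f (\<ominus>\<^bsub>M\<^esub> x) = \<ominus>\<^bsub>N\<^esub> f x"
  using add[of "\<ominus>\<^bsub>M\<^esub> x" x] by (intro N.minus_equality[symmetric]) (simp_all add: M.l_neg)

lemma sg: "x \<in> carrier M \<Longrightarrow> f (sg M n x) = sg N n (f x)"
  by (simp add: sg_def minus)

lemma finsum: "finite I \<Longrightarrow> c \<in> I \<rightarrow> carrier M \<Longrightarrow> f (finsum M c I) = finsum N (\<lambda>i. f (c i)) I"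
  by (induction I rule: finite_induct) (simp_all add: add Pi_def)

end

lemma linear_mapI:
  assumes "\<And>x. x \<in> carrier M \<Longrightarrow> f x \<in> carrier N"
    and "\<And>x y. x \<in> carrier M \<Longrightarrow> y \<in> carrier M \<Longrightarrow> f (x \<oplus>\<^bsub>M\<^esub> y) = f x \<oplus>\<^bsub>N\<^esub> f y"
    and "\<And>k x. k \<in> carrier K \<Longrightarrow> x \<in> carrier M \<Longrightarrow> f (k \<odot>\<^bsub>M\<^esub> x) = k \<odot>\<^bsub>N\<^esub> f x"
  shows "linear_map K M N f"
  using assms by (auto simp: linear_map_def hom_def)

locale bilin_map = M: k_module K M + N: k_module K N + P: k_module K P
  for K :: "'k ring" and M :: "('k, 'm) dg" and N :: "('k, 'n) dg" and P :: "('k, 'p) dg" and f +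
  assumes bilin: "bilinear_map K M N P f"
begin

lemma lin_right: "x \<in> carrier M \<Longrightarrow> lin_map K N P (\<lambda>y. f x y)"
  using bilin by unfold_locales (auto simp: bilinear_map_def)

lemma lin_left: "y \<in> carrier N \<Longrightarrow> lin_map K M P (\<lambda>x. f x y)"
  using bilin by unfold_locales (auto simp: bilinear_map_def)

lemma closed [simp]: "x \<in> carrier M \<Longrightarrow> y \<in> carrier N \<Longrightarrow> f x y \<in> carrier P"
  using lin_map.closed[OF lin_right] by blast

lemma add_left: "x \<in> carrier M \<Longrightarrow> x' \<in> carrier M \<Longrightarrow> y \<in> carrier N \<Longrightarrow>
    f (x \<oplus>\<^bsub>M\<^esub> x') y = f x y \<oplus>\<^bsub>P\<^esub> f x' y"
  using lin_map.add[OF lin_left] by blast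

lemma add_right: "x \<in> carrier M \<Longrightarrow> y \<in> carrier N \<Longrightarrow> y' \<in> carrier N \<Longrightarrow>
    f x (y \<oplus>\<^bsub>N\<^esub> y') = f x y \<oplus>\<^bsub>P\<^esub> f x y'"
  using lin_map.add[OF lin_right] by blast

lemma smult_left: "k \<in> carrier K \<Longrightarrow> x \<in> carrier M \<Longrightarrow> y \<in> carrier N \<Longrightarrow>
    f (k \<odot>\<^bsub>M\<^esub> x) y = k \<odot>\<^bsub>P\<^esub> f x y"
  using lin_map.smult[OF lin_left] by blast

lemma smult_right: "k \<in> carrier K \<Longrightarrow> x \<in> carrier M \<Longrightarrow> y \<in> carrier N \<Longrightarrow>
    f x (k \<odot>\<^bsub>N\<^esub> y) = k \<odot>\<^bsub>P\<^esub> f x y"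
  using lin_map.smult[OF lin_right] by blast

lemma zero_left [simp]: "y \<in> carrier N \<Longrightarrow> f \<zero>\<^bsub>M\<^esub> y = \<zero>\<^bsub>P\<^esub>"
  using lin_map.zero[OF lin_left] by blast

lemma zero_right [simp]: "x \<in> carrier M \<Longrightarrow> f x \<zero>\<^bsub>N\<^esub> = \<zero>\<^bsub>P\<^esub>"
  using lin_map.zero[OF lin_right] by blast

lemma minus_left: "x \<in> carrier M \<Longrightarrow> y \<in> carrier N \<Longrightarrow> f (\<ominus>\<^bsub>M\<^esub> x) y = \<ominus>\<^bsub>P\<^esub> f x y"
  using lin_map.minus[OF lin_left] by blast

lemma minus_right: "x \<in> carrier M \<Longrightarrow> y \<in> carrier N \<Longrightarrow> f x (\<ominus>\<^bsub>N\<^esub> y) = \<ominus>\<^bsub>P\<^esub> f x y"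
  using lin_map.minus[OF lin_right] by blast

lemma sg_left: "x \<in> carrier M \<Longrightarrow> y \<in> carrier N \<Longrightarrow> f (sg M n x) y = sg P n (f x y)"
  using lin_map.sg[OF lin_left] by blast

lemma sg_right: "x \<in> carrier M \<Longrightarrow> y \<in> carrier N \<Longrightarrow> f x (sg N n y) = sg P n (f x y)"
  using lin_map.sg[OF lin_right] by blast

end

lemma bilinear_mapI:
  assumes "\<And>x y. x \<in> carrier M \<Longrightarrow> y \<in> carrier N \<Longrightarrow> f x y \<in> carrier P"
    and "\<And>x x' y. x \<in> carrier M \<Longrightarrow> x' \<in> carrier M \<Longrightarrow> y \<in> carrier N \<Longrightarrow>
      f (x \<oplus>\<^bsub>M\<^esub> x') y = f x y \<oplus>\<^bsub>P\<^esub> f x' y"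
    and "\<And>x y y'. x \<in> carrier M \<Longrightarrow> y \<in> carrier N \<Longrightarrow> y' \<in> carrier N \<Longrightarrow>
      f x (y \<oplus>\<^bsub>N\<^esub> y') = f x y \<oplus>\<^bsub>P\<^esub> f x y'"
    and "\<And>k x y. k \<in> carrier K \<Longrightarrow> x \<in> carrier M \<Longrightarrow> y \<in> carrier N \<Longrightarrow>
      f (k \<odot>\<^bsub>M\<^esub> x) y = k \<odot>\<^bsub>P\<^esub> f x y"
    and "\<And>k x y. k \<in> carrier K \<Longrightarrow> x \<in> carrier M \<Longrightarrow> y \<in> carrier N \<Longrightarrow>
      f x (k \<odot>\<^bsub>N\<^esub> y) = k \<odot>\<^bsub>P\<^esub> f x y"
  shows "bilinear_map K M N P f"
  using assms by (auto simp: bilinear_map_def intro!: linear_mapI)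

lemma linear_map_bilinear:
  assumes "linear_map K P Q g" and "bilinear_map K M N P f"
  shows "bilinear_map K M N Q (\<lambda>x y. g (f x y))"
  using assms by (fastforce simp: bilinear_map_def linear_map_def hom_def Pi_iff)

lemma sg_even [simp]: "even n \<Longrightarrow> sg M n x = x"
  by (simp add: sg_def)


section \<open>Internal direct sums\<close>

text \<open>
  A sum is direct as soon as every nonzero element of a summand is detected by an additive map that
  kills all other summands.
\<close>

lemma internal_direct_sumI:
  fixes M :: "('k, 'm) dg" and P :: "('k, 'p) dg"
  assumes "k_module K M" and "k_module K P"
    and sub: "\<And>i. i \<in> I \<Longrightarrow> submodule (S i) K M"
    and gen: "\<And>x. x \<in> carrier M \<Longrightarrow> x \<in> generate (add_monoid M) (\<Union>i\<in>I. S i)"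
    and detect: "\<And>i s. i \<in> I \<Longrightarrow> s \<in> S i \<Longrightarrow> s \<noteq> \<zero>\<^bsub>M\<^esub> \<Longrightarrow>
      \<exists>h. linear_map K M P h \<and> (\<forall>j\<in>I. j \<noteq> i \<longrightarrow> (\<forall>t\<in>S j. h t = \<zero>\<^bsub>P\<^esub>)) \<and> h s \<noteq> \<zero>\<^bsub>P\<^esub>"
  shows "internal_direct_sum M I S"
proof -
  interpret M: k_module K M by fact
  interpret P: k_module K P by fact
  note subE = M.submoduleE[OF sub]
  have S: "S i \<subseteq> carrier M" and Sz: "\<zero>\<^bsub>M\<^esub> \<in> S i" if "i \<in> I" for i
    using subE(1)[OF that] subgroup.one_closed[OF submodule.axioms(1)[OF sub[OF that]]] by auto
  let ?d = "\<lambda>x c. c \<in> (\<Pi>\<^sub>E i\<in>I. S i) \<and> finite {i\<in>I. c i \<noteq> \<zero>\<^bsub>M\<^esub>} \<and>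
    x = finsum M c {i\<in>I. c i \<noteq> \<zero>\<^bsub>M\<^esub>}"
  have bigger: "finsum M c F = finsum M c {i\<in>I. c i \<noteq> \<zero>\<^bsub>M\<^esub>}"
    if "c \<in> (\<Pi>\<^sub>E i\<in>I. S i)" "finite F" "{i\<in>I. c i \<noteq> \<zero>\<^bsub>M\<^esub>} \<subseteq> F" "F \<subseteq> I" for c F
  proof (rule M.add.finprod_mono_neutral_cong_right)
    show "c \<in> F \<rightarrow> carrier M" using that(1,4) S by (blast dest: PiE_mem)
  qed (use that in auto)
  have ex: "\<exists>c. ?d x c" if "x \<in> carrier M" for x
  proof -
    have "\<exists>F c. finite F \<and> F \<subseteq> I \<and> c \<in> (\<Pi>\<^sub>E i\<in>I. S i) \<and> {i\<in>I. c i \<noteq> \<zero>\<^bsub>M\<^esub>} \<subseteq> F \<and> x = finsum M c F"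
      using gen[OF that]
    proof (induction rule: M.generator_induct_neg)
      case zero
      show ?case by (rule exI[of _ "{}"], rule exI[of _ "\<lambda>i\<in>I. \<zero>\<^bsub>M\<^esub>"]) (use Sz in auto)
    next
      case (gen s)
      then obtain i where i: "i \<in> I" "s \<in> S i" by auto
      define c where "c = (\<lambda>j\<in>I. if j = i then s else \<zero>\<^bsub>M\<^esub>)"
      have "c i = s" "s \<in> carrier M" "{j\<in>I. c j \<noteq> \<zero>\<^bsub>M\<^esub>} \<subseteq> {i}" "c \<in> (\<Pi>\<^sub>E i\<in>I. S i)"
        using i S Sz by (auto simp: c_def)
      then show ?case using i by (intro exI[of _ "{i}"] exI[of _ c]) simp
    next
      case (add x y)
      from add.IH(1) obtain F c where 1: "finite F" "F \<subseteq> I" "c \<in> (\<Pi>\<^sub>E i\<in>I. S i)"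
          "{i\<in>I. c i \<noteq> \<zero>\<^bsub>M\<^esub>} \<subseteq> F" "x = finsum M c F" by (elim exE conjE)
      from add.IH(2) obtain G d where 2: "finite G" "G \<subseteq> I" "d \<in> (\<Pi>\<^sub>E i\<in>I. S i)" "{i\<in>I. d i \<noteq> \<zero>\<^bsub>M\<^esub>} \<subseteq> G"
          "y = finsum M d G" by (elim exE conjE)
      let ?H = "F \<union> G"
      have "{i\<in>I. c i \<noteq> \<zero>\<^bsub>M\<^esub>} \<subseteq> ?H" "{i\<in>I. d i \<noteq> \<zero>\<^bsub>M\<^esub>} \<subseteq> ?H"
        using 1(4) 2(4) by blast+
      then have xy: "x = finsum M c ?H" "y = finsum M d ?H"
        using bigger[of c ?H] bigger[of c F] bigger[of d ?H] bigger[of d G] 1 2 by simp_all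
      have cd: "c \<in> ?H \<rightarrow> carrier M" "d \<in> ?H \<rightarrow> carrier M" using 1 2 S by fastforce+
      let ?e = "\<lambda>i\<in>I. c i \<oplus>\<^bsub>M\<^esub> d i"
      have "finsum M ?e ?H = finsum M (\<lambda>i. c i \<oplus>\<^bsub>M\<^esub> d i) ?H"
        by (rule M.finsum_cong') (use cd 1 2 in auto)
      then have "x \<oplus>\<^bsub>M\<^esub> y = finsum M ?e ?H"
        unfolding xy using M.finsum_addf[OF cd] by simp
      moreover have "?e \<in> (\<Pi>\<^sub>E i\<in>I. S i)" using 1 2 subE(5) by (auto simp: PiE_iff)
      moreover have "?e i = \<zero>\<^bsub>M\<^esub>" if "i \<in> I" "i \<notin> ?H" for i
      proof -
        have "c i = \<zero>\<^bsub>M\<^esub>" "d i = \<zero>\<^bsub>M\<^esub>" using 1(4) 2(4) that by blast+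
        then show ?thesis using that by simp
      qed
      then have "{i\<in>I. ?e i \<noteq> \<zero>\<^bsub>M\<^esub>} \<subseteq> ?H" by blast
      ultimately show ?case using 1(1,2) 2(1,2) by (intro exI[of _ ?H] exI[of _ ?e]) blast
    qed (use S subE(3) in blast)+
    then obtain F c where F: "finite F" "F \<subseteq> I" "c \<in> (\<Pi>\<^sub>E i\<in>I. S i)"
      "{i\<in>I. c i \<noteq> \<zero>\<^bsub>M\<^esub>} \<subseteq> F" "x = finsum M c F" by (elim exE conjE)
    have "?d x c"
      unfolding F(5) using F(3) finite_subset[OF F(4,1)] bigger[OF F(3,1,4,2)] by blast
    then show ?thesis by blast
  qed
  \<comment> \<open>A map that kills all summands but one reads off the component in that summand.\<close>
  have detected: "h x = h (c i)" if h: "linear_map K M P h" "\<forall>j\<in>I. j \<noteq> i \<longrightarrow> (\<forall>t\<in>S j. h t = \<zero>\<^bsub>P\<^esub>)"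
      and "i \<in> I" and x: "?d x c" for h i x c
  proof -
    interpret h: lin_map K M P h by unfold_locales fact
    let ?F = "insert i {i\<in>I. c i \<noteq> \<zero>\<^bsub>M\<^esub>}"
    have cF: "c \<in> ?F \<rightarrow> carrier M" using x \<open>i \<in> I\<close> S by fastforce
    have "finsum M c ?F = finsum M c {i\<in>I. c i \<noteq> \<zero>\<^bsub>M\<^esub>}"
      by (rule bigger) (use x \<open>i \<in> I\<close> in blast)+
    then have F: "x = finsum M c ?F" using x by simp
    have "h x = finsum P (\<lambda>j. h (c j)) ?F"
      unfolding F by (rule h.finsum) (use x cF in auto)
    also have "\<dots> = finsum P (\<lambda>j. h (c j)) {i}"
      by (rule P.add.finprod_mono_neutral_cong_right)
        (use x h(2) cF \<open>i \<in> I\<close> in \<open>auto simp: Pi_iff PiE_iff\<close>)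
    also have "\<dots> = h (c i)" using cF by auto
    finally show ?thesis .
  qed
  have uniq: "c = d" if c: "?d x c" and d: "?d x d" for x c d
  proof (rule ccontr)
    assume "c \<noteq> d"
    then obtain i where i: "i \<in> I" "c i \<noteq> d i" using c d PiE_ext[of c I S d] by blast
    have ci: "c i \<in> S i" "d i \<in> S i" using c d i(1) by (blast dest: PiE_mem)+
    then have cic: "c i \<in> carrier M" "d i \<in> carrier M" using S[OF i(1)] by blast+
    let ?s = "c i \<ominus>\<^bsub>M\<^esub> d i"
    have "?s \<in> S i" using ci subE(3,5)[OF \<open>i \<in> I\<close>] by (simp add: a_minus_def)
    moreover have "?s \<noteq> \<zero>\<^bsub>M\<^esub>"  using i cic M.eq_of_minus_zero by blast
    ultimately obtain h where h: "linear_map K M P h"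
        "\<forall>j\<in>I. j \<noteq> i \<longrightarrow> (\<forall>t\<in>S j. h t = \<zero>\<^bsub>P\<^esub>)" "h ?s \<noteq> \<zero>\<^bsub>P\<^esub>" using detect i by blast
    interpret h: lin_map K M P h by unfold_locales fact
    have "h (c i) = h (d i)" using detected[OF h(1,2) i(1) c] detected[OF h(1,2) i(1) d] by simp
    then have "h ?s = \<zero>\<^bsub>P\<^esub>" using cic by (simp add: a_minus_def h.add h.minus P.r_neg)
    with h(3) show False ..
  qed
  show ?thesis
    unfolding internal_direct_sum_def
  proof (intro conjI ballI S)
    fix x assume "x \<in> carrier M"
    then obtain c where c: "?d x c" using ex by blast
    show "\<exists>!c. ?d x c" by (rule ex1I[of "?d x" c, OF c]) (rule uniq[OF _ c])
  qed
qed


section \<open>Graded modules\<close>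

context graded_module
begin

lemmas gr_submoduleE = submoduleE[OF gr_submodule]

lemma gr_closed [simp]: "x \<in> gr M n \<Longrightarrow> x \<in> carrier M"
  using gr_submoduleE(1) by blast

lemma gr_add: "x \<in> gr M n \<Longrightarrow> y \<in> gr M n \<Longrightarrow> x \<oplus>\<^bsub>M\<^esub> y \<in> gr M n"
  by (rule gr_submoduleE(5))

lemma gr_zero [simp]: "\<zero>\<^bsub>M\<^esub> \<in> gr M n"
  using subgroup.one_closed[OF submodule.axioms(1)[OF gr_submodule]] by simp

lemma gr_minus: "x \<in> gr M n \<Longrightarrow> \<ominus>\<^bsub>M\<^esub> x \<in> gr M n"
  by (rule gr_submoduleE(3))

lemma gr_sg [simp]: "x \<in> gr M n \<Longrightarrow> sg M k x \<in> gr M n"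
  by (simp add: sg_def gr_minus)

lemma gr_smult: "k \<in> carrier K \<Longrightarrow> x \<in> gr M n \<Longrightarrow> k \<odot>\<^bsub>M\<^esub> x \<in> gr M n"
  by (rule gr_submoduleE(4))


end

definition component :: "('k, 'm) dg \<Rightarrow> 'm \<Rightarrow> int \<Rightarrow> 'm" where
  "component M x = (THE c. c \<in> (\<Pi>\<^sub>E i\<in>UNIV. gr M i) \<and> finite {i\<in>UNIV. c i \<noteq> \<zero>\<^bsub>M\<^esub>} \<and>
     x = finsum M c {i\<in>UNIV. c i \<noteq> \<zero>\<^bsub>M\<^esub>})"

text \<open>
  The value at \<open>x\<close> of the additive map that is \<open>\<phi> n\<close> in degree \<open>n\<close>. All constructions that involve
  signs are prescribed on homogeneous elements only, and reach the other elements in this way.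
\<close>

definition graded_ext :: "('k, 'm) dg \<Rightarrow> ('k, 'n) dg \<Rightarrow> (int \<Rightarrow> 'm \<Rightarrow> 'n) \<Rightarrow> 'm \<Rightarrow> 'n" where
  "graded_ext M N \<phi> x = finsum N (\<lambda>n. \<phi> n (component M x n)) {n. component M x n \<noteq> \<zero>\<^bsub>M\<^esub>}"

context graded_module
begin

lemma component_unique_ex: "x \<in> carrier M \<Longrightarrow> \<exists>!c. c \<in> (\<Pi>\<^sub>E i\<in>UNIV. gr M i) \<and>
    finite {i\<in>UNIV. c i \<noteq> \<zero>\<^bsub>M\<^esub>} \<and> x = finsum M c {i\<in>UNIV. c i \<noteq> \<zero>\<^bsub>M\<^esub>}"
  using gr_direct_sum by (auto simp: internal_direct_sum_def)

lemma
  assumes "x \<in> carrier M"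
  shows component_gr [simp]: "component M x n \<in> gr M n"
    and component_finite [simp]: "finite {n. component M x n \<noteq> \<zero>\<^bsub>M\<^esub>}"
    and component_sum: "x = finsum M (component M x) {n. component M x n \<noteq> \<zero>\<^bsub>M\<^esub>}"
  using theI'[OF component_unique_ex[OF assms]] unfolding component_def[symmetric] by auto

lemma component_closed [simp]: "x \<in> carrier M \<Longrightarrow> component M x n \<in> carrier M"
  using component_gr by (rule gr_closed)

lemma component_sum_superset:
  assumes "x \<in> carrier M" "finite F" "{n. component M x n \<noteq> \<zero>\<^bsub>M\<^esub>} \<subseteq> F"
  shows "x = finsum M (component M x) F"
proof -
  have "finsum M (component M x) F = finsum M (component M x) {n. component M x n \<noteq> \<zero>\<^bsub>M\<^esub>}"
    by (rule M.add.finprod_mono_neutral_cong_right) (use assms in auto)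
  then show ?thesis using component_sum[OF assms(1)] by simp
qed

lemma component_eqI:
  assumes c: "\<And>n. c n \<in> gr M n" and F: "finite F" "\<And>n. n \<notin> F \<Longrightarrow> c n = \<zero>\<^bsub>M\<^esub>"
    and x: "x = finsum M c F"
  shows "component M x = c"
proof -
  have cM: "c n \<in> carrier M" for n using c gr_closed by blast
  have sub: "{i\<in>UNIV. c i \<noteq> \<zero>\<^bsub>M\<^esub>} \<subseteq> F" using F by auto
  have "finsum M c F = finsum M c {i\<in>UNIV. c i \<noteq> \<zero>\<^bsub>M\<^esub>}"
    by (rule M.add.finprod_mono_neutral_cong_right) (use F cM in auto)
  moreover have "x \<in> carrier M" unfolding x using cM by simp
  ultimately show ?thesis
    unfolding component_def using c x F(1) sub
    by (intro the1_equality[OF component_unique_ex]) (auto intro: finite_subset)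
qed

lemma component_homogeneous:
  assumes "x \<in> gr M n"
  shows "component M x = (\<lambda>i. if i = n then x else \<zero>\<^bsub>M\<^esub>)"
  by (rule component_eqI[of _ "{n}"]) (use assms in auto)

lemma component_add:
  assumes "x \<in> carrier M" "y \<in> carrier M"
  shows "component M (x \<oplus>\<^bsub>M\<^esub> y) = (\<lambda>n. component M x n \<oplus>\<^bsub>M\<^esub> component M y n)"
proof -
  let ?F = "{n. component M x n \<noteq> \<zero>\<^bsub>M\<^esub>} \<union> {n. component M y n \<noteq> \<zero>\<^bsub>M\<^esub>}"
  have "x \<oplus>\<^bsub>M\<^esub> y = finsum M (component M x) ?F \<oplus>\<^bsub>M\<^esub> finsum M (component M y) ?F"
    using component_sum_superset[of x ?F] component_sum_superset[of y ?F] assms by auto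
  also have "\<dots> = finsum M (\<lambda>n. component M x n \<oplus>\<^bsub>M\<^esub> component M y n) ?F"
    using assms by (simp add: M.finsum_addf)
  finally show ?thesis
    by (intro component_eqI[of _ ?F]) (use assms in \<open>auto intro: gr_add\<close>)
qed

lemma component_smult:
  assumes "k \<in> carrier K" "x \<in> carrier M"
  shows "component M (k \<odot>\<^bsub>M\<^esub> x) = (\<lambda>n. k \<odot>\<^bsub>M\<^esub> component M x n)"
proof -
  let ?F = "{n. component M x n \<noteq> \<zero>\<^bsub>M\<^esub>}"
  have "k \<odot>\<^bsub>M\<^esub> x = k \<odot>\<^bsub>M\<^esub> finsum M (component M x) ?F" using component_sum[OF assms(2)] by simp
  also have "\<dots> = finsum M (\<lambda>n. k \<odot>\<^bsub>M\<^esub> component M x n) ?F"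
    using assms by (intro finsum_smult_ldistr) auto
  finally show ?thesis
    by (intro component_eqI[of _ ?F]) (use assms in \<open>auto intro: gr_smult\<close>)
qed

lemma gr_induct [consumes 1, case_names hom add]:
  assumes x: "x \<in> carrier M" and hom: "\<And>n x. x \<in> gr M n \<Longrightarrow> P x"
    and add: "\<And>x y. x \<in> carrier M \<Longrightarrow> y \<in> carrier M \<Longrightarrow> P x \<Longrightarrow> P y \<Longrightarrow> P (x \<oplus>\<^bsub>M\<^esub> y)"
  shows "P x"
proof -
  have "P (finsum M (component M x) F)" if "finite F" for F
    using that
  proof (induction F rule: finite_induct)
    case (insert n F)
    have "component M x \<in> F \<rightarrow> carrier M" using x by auto
    moreover have "P (component M x n)" using hom[OF component_gr[OF x]] .
    ultimately show ?case using insert x by (simp add: add)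
  qed (simp add: hom[OF gr_zero])
  then show ?thesis using component_sum[OF x] component_finite[OF x] by metis
qed

lemma gr_eqI:
  assumes "x \<in> carrier M" "lin_map K M N f" "lin_map K M N g"
    and "\<And>n x. x \<in> gr M n \<Longrightarrow> f x = g x"
  shows "f x = g x"
  using assms(1)
  by (induction rule: gr_induct)
    (simp_all add: assms(4) lin_map.add[OF assms(2)] lin_map.add[OF assms(3)])

end

definition linear_on :: "'k ring \<Rightarrow> ('k, 'm) dg \<Rightarrow> 'm set \<Rightarrow> ('k, 'n) dg \<Rightarrow> ('m \<Rightarrow> 'n) \<Rightarrow> bool" where
  "linear_on K M S N f \<longleftrightarrow> (\<forall>x\<in>S. f x \<in> carrier N) \<and>
     (\<forall>x\<in>S. \<forall>y\<in>S. f (x \<oplus>\<^bsub>M\<^esub> y) = f x \<oplus>\<^bsub>N\<^esub> f y) \<and>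
     (\<forall>k\<in>carrier K. \<forall>x\<in>S. f (k \<odot>\<^bsub>M\<^esub> x) = k \<odot>\<^bsub>N\<^esub> f x)"

locale graded_family = M: graded_module K M + N: k_module K N
  for K :: "'k ring" and M :: "('k, 'm) dg" and N :: "('k, 'n) dg" and \<phi> :: "int \<Rightarrow> 'm \<Rightarrow> 'n" +
  assumes fam: "linear_on K M (gr M n) N (\<phi> n)"
begin

lemma fam_closed [simp]: "x \<in> gr M n \<Longrightarrow> \<phi> n x \<in> carrier N"
  using fam by (auto simp: linear_on_def)

lemma fam_add: "x \<in> gr M n \<Longrightarrow> y \<in> gr M n \<Longrightarrow> \<phi> n (x \<oplus>\<^bsub>M\<^esub> y) = \<phi> n x \<oplus>\<^bsub>N\<^esub> \<phi> n y"
  using fam by (auto simp: linear_on_def)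

lemma fam_smult: "k \<in> carrier K \<Longrightarrow> x \<in> gr M n \<Longrightarrow> \<phi> n (k \<odot>\<^bsub>M\<^esub> x) = k \<odot>\<^bsub>N\<^esub> \<phi> n x"
  using fam by (auto simp: linear_on_def)

lemma fam_zero [simp]: "\<phi> n \<zero>\<^bsub>M\<^esub> = \<zero>\<^bsub>N\<^esub>"
  using fam_add[of "\<zero>\<^bsub>M\<^esub>" n "\<zero>\<^bsub>M\<^esub>"] N.add.l_cancel_one'[of "\<phi> n \<zero>\<^bsub>M\<^esub>" "\<phi> n \<zero>\<^bsub>M\<^esub>"] by simp

lemma ext_superset:
  assumes "x \<in> carrier M" "finite F" "{n. component M x n \<noteq> \<zero>\<^bsub>M\<^esub>} \<subseteq> F"
  shows "graded_ext M N \<phi> x = finsum N (\<lambda>n. \<phi> n (component M x n)) F"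
  unfolding graded_ext_def
  by (rule N.add.finprod_mono_neutral_cong_left) (use assms in auto)

lemma ext_homogeneous:
  assumes "x \<in> gr M n"
  shows "graded_ext M N \<phi> x = \<phi> n x"
proof -
  have "{i. component M x i \<noteq> \<zero>\<^bsub>M\<^esub>} \<subseteq> {n}" using M.component_homogeneous[OF assms] by auto
  then show ?thesis using ext_superset[of x "{n}"] assms by (simp add: M.component_homogeneous)
qed

lemma ext_linear: "linear_map K M N (graded_ext M N \<phi>)"
proof (rule linear_mapI)
  fix x y assume x: "x \<in> carrier M" and y: "y \<in> carrier M"
  let ?F = "{n. component M x n \<noteq> \<zero>\<^bsub>M\<^esub>} \<union> {n. component M y n \<noteq> \<zero>\<^bsub>M\<^esub>}"
  have "graded_ext M N \<phi> (x \<oplus>\<^bsub>M\<^esub> y) = finsum N (\<lambda>n. \<phi> n (component M (x \<oplus>\<^bsub>M\<^esub> y) n)) ?F"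
    by (rule ext_superset) (use x y in \<open>auto simp: M.component_add\<close>)
  also have "\<dots> = finsum N (\<lambda>n. \<phi> n (component M x n) \<oplus>\<^bsub>N\<^esub> \<phi> n (component M y n)) ?F"
    by (rule N.finsum_cong') (use x y in \<open>auto simp: M.component_add fam_add\<close>)
  also have "\<dots> = finsum N (\<lambda>n. \<phi> n (component M x n)) ?F \<oplus>\<^bsub>N\<^esub>
      finsum N (\<lambda>n. \<phi> n (component M y n)) ?F"
    by (rule N.finsum_addf) (use x y in auto)
  also have "\<dots> = graded_ext M N \<phi> x \<oplus>\<^bsub>N\<^esub> graded_ext M N \<phi> y"
    using ext_superset[of x ?F] ext_superset[of y ?F] x y by auto
  finally show "graded_ext M N \<phi> (x \<oplus>\<^bsub>M\<^esub> y) = graded_ext M N \<phi> x \<oplus>\<^bsub>N\<^esub> graded_ext M N \<phi> y" .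
next
  fix k x assume k: "k \<in> carrier K" and x: "x \<in> carrier M"
  let ?F = "{n. component M x n \<noteq> \<zero>\<^bsub>M\<^esub>}"
  have "graded_ext M N \<phi> (k \<odot>\<^bsub>M\<^esub> x) = finsum N (\<lambda>n. \<phi> n (component M (k \<odot>\<^bsub>M\<^esub> x) n)) ?F"
    by (rule ext_superset) (use k x in \<open>auto simp: M.component_smult\<close>)
  also have "\<dots> = finsum N (\<lambda>n. k \<odot>\<^bsub>N\<^esub> \<phi> n (component M x n)) ?F"
    by (rule N.finsum_cong') (use k x in \<open>auto simp: M.component_smult fam_smult\<close>)
  also have "\<dots> = k \<odot>\<^bsub>N\<^esub> graded_ext M N \<phi> x"
    unfolding graded_ext_def by (rule N.finsum_smult_ldistr[symmetric]) (use k x in auto)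
  finally show "graded_ext M N \<phi> (k \<odot>\<^bsub>M\<^esub> x) = k \<odot>\<^bsub>N\<^esub> graded_ext M N \<phi> x" .
qed (auto simp: graded_ext_def)

end

text \<open>
  The same for maps of two arguments. The inner extension is taken for a homogeneous first argument;
  its dependence on that argument is again linear, so that it can be extended in turn.
\<close>

definition bigraded_ext :: "('k, 'm) dg \<Rightarrow> ('k, 'n) dg \<Rightarrow> ('k, 'p) dg \<Rightarrow>
    (int \<Rightarrow> int \<Rightarrow> 'm \<Rightarrow> 'n \<Rightarrow> 'p) \<Rightarrow> 'm \<Rightarrow> 'n \<Rightarrow> 'p" where
  "bigraded_ext M N P \<phi> x y =
     graded_ext M P (\<lambda>p x. graded_ext N P (\<lambda>q y. \<phi> p q x y) y) x"

locale bigraded_family = M: graded_module K M + N: graded_module K N + P: k_module K P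
  for K :: "'k ring" and M :: "('k, 'm) dg" and N :: "('k, 'n) dg" and P :: "('k, 'p) dg"
    and \<phi> :: "int \<Rightarrow> int \<Rightarrow> 'm \<Rightarrow> 'n \<Rightarrow> 'p" +
  assumes fam_right: "x \<in> gr M p \<Longrightarrow> linear_on K N (gr N q) P (\<lambda>y. \<phi> p q x y)"
    and fam_left: "y \<in> gr N q \<Longrightarrow> linear_on K M (gr M p) P (\<lambda>x. \<phi> p q x y)"
begin

lemma right_family: "x \<in> gr M p \<Longrightarrow> graded_family K N P (\<lambda>q y. \<phi> p q x y)"
  by unfold_locales (rule fam_right)

lemma right_linear: "x \<in> gr M p \<Longrightarrow> lin_map K N P (graded_ext N P (\<lambda>q y. \<phi> p q x y))"
  by unfold_locales (rule graded_family.ext_linear[OF right_family])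

lemma right_homogeneous:
  "x \<in> gr M p \<Longrightarrow> y \<in> gr N q \<Longrightarrow> graded_ext N P (\<lambda>q y. \<phi> p q x y) y = \<phi> p q x y"
  by (rule graded_family.ext_homogeneous[OF right_family])

lemma left_family:
  assumes y: "y \<in> carrier N"
  shows "graded_family K M P (\<lambda>p x. graded_ext N P (\<lambda>q y. \<phi> p q x y) y)"
proof
  fix p
  show "linear_on K M (gr M p) P (\<lambda>x. graded_ext N P (\<lambda>q y. \<phi> p q x y) y)"
    unfolding linear_on_def
  proof (intro conjI ballI)
    fix x x' assume x: "x \<in> gr M p" "x' \<in> gr M p"
    show "graded_ext N P (\<lambda>q y. \<phi> p q (x \<oplus>\<^bsub>M\<^esub> x') y) y =
        graded_ext N P (\<lambda>q y. \<phi> p q x y) y \<oplus>\<^bsub>P\<^esub> graded_ext N P (\<lambda>q y. \<phi> p q x' y) y"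
      using y
    proof (induction rule: N.gr_induct)
      case (hom q y)
      then show ?case
        using fam_left[of y q p] x by (simp add: right_homogeneous M.gr_add linear_on_def)
    next
      case (add y y')
      then show ?case using x
        by (simp add: lin_map.add[OF right_linear] M.gr_add lin_map.closed[OF right_linear] P.a_ac)
    qed
  next
    fix k x assume x: "k \<in> carrier K" "x \<in> gr M p"
    show "graded_ext N P (\<lambda>q y. \<phi> p q (k \<odot>\<^bsub>M\<^esub> x) y) y =
        k \<odot>\<^bsub>P\<^esub> graded_ext N P (\<lambda>q y. \<phi> p q x y) y"
      using y
    proof (induction rule: N.gr_induct)
      case (hom q y)
      then show ?case
        using fam_left[of y q p] x by (simp add: right_homogeneous M.gr_smult linear_on_def)
    next
      case (add y y')
      then show ?case using x
        by (simp add: lin_map.add[OF right_linear] M.gr_smult lin_map.closed[OF right_linear]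
            P.smult_r_distr)
    qed
  qed (use y lin_map.closed[OF right_linear] in auto)
qed

lemma bilinear: "bilinear_map K M N P (bigraded_ext M N P \<phi>)"
  unfolding bilinear_map_def
proof (intro conjI ballI)
  fix y assume y: "y \<in> carrier N"
  show "linear_map K M P (\<lambda>x. bigraded_ext M N P \<phi> x y)"
    unfolding bigraded_ext_def by (rule graded_family.ext_linear[OF left_family[OF y]])
next
  fix x assume x: "x \<in> carrier M"
  note l = graded_family.ext_linear[OF left_family]
  have L: "lin_map K M P (\<lambda>x. bigraded_ext M N P \<phi> x y)" if "y \<in> carrier N" for y
    unfolding bigraded_ext_def by unfold_locales (rule l[OF that])
  note ext_hom = graded_family.ext_homogeneous[OF left_family]
  show "linear_map K N P (bigraded_ext M N P \<phi> x)"
  proof (rule linear_mapI)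
    fix y y' assume y: "y \<in> carrier N" "y' \<in> carrier N"
    show "bigraded_ext M N P \<phi> x (y \<oplus>\<^bsub>N\<^esub> y') = bigraded_ext M N P \<phi> x y \<oplus>\<^bsub>P\<^esub> bigraded_ext M N P \<phi> x y'"
      using x
    proof (induction rule: M.gr_induct)
      case (hom p x)
      then show ?case unfolding bigraded_ext_def
        using y lin_map.add[OF right_linear[OF hom], of y y'] by (simp add: ext_hom[of _ x p])
    next
      case (add x x')
      then show ?case
        using y by (simp add: lin_map.add[OF L] lin_map.closed[OF L] P.a_ac)
    qed
  next
    fix k y assume y: "k \<in> carrier K" "y \<in> carrier N"
    show "bigraded_ext M N P \<phi> x (k \<odot>\<^bsub>N\<^esub> y) = k \<odot>\<^bsub>P\<^esub> bigraded_ext M N P \<phi> x y"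
      using x
    proof (induction rule: M.gr_induct)
      case (hom p x)
      then show ?case unfolding bigraded_ext_def
        using y lin_map.smult[OF right_linear[OF hom]] by (simp add: ext_hom[of _ x p])
    next
      case (add x x')
      then show ?case
        using y by (simp add: lin_map.add[OF L] lin_map.closed[OF L] P.smult_r_distr)
    qed
  qed (use x lin_map.closed[OF L] in blast)
qed

lemma homogeneous:
  assumes "x \<in> gr M p" "y \<in> gr N q"
  shows "bigraded_ext M N P \<phi> x y = \<phi> p q x y"
  unfolding bigraded_ext_def
  using graded_family.ext_homogeneous[OF left_family, of y x p] right_homogeneous[OF assms] assms
  by simp

end

text \<open>
  The bilinear map $(x, y) \mapsto (-1)^{|x||y|} f(x, y)$. The signs in opposite algebras, in
  products of tensors and in the actions to be identified arise in this way.
\<close>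

definition koszul :: "('k, 'm) dg \<Rightarrow> ('k, 'n) dg \<Rightarrow> ('k, 'p) dg \<Rightarrow>
    ('m \<Rightarrow> 'n \<Rightarrow> 'p) \<Rightarrow> 'm \<Rightarrow> 'n \<Rightarrow> 'p" where
  "koszul M N P f = bigraded_ext M N P (\<lambda>p q x y. sg P (p * q) (f x y))"

lemma koszul_bilinear_homogeneous:
  fixes M :: "('k, 'm) dg" and N :: "('k, 'n) dg" and P :: "('k, 'p) dg"
  assumes "graded_module K M" "graded_module K N" "k_module K P" and f: "bilinear_map K M N P f"
  shows koszul_bilinear: "bilinear_map K M N P (koszul M N P f)"
    and koszul_homogeneous: "x \<in> gr M p \<Longrightarrow> y \<in> gr N q \<Longrightarrow> koszul M N P f x y = sg P (p * q) (f x y)"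
proof -
  interpret M: graded_module K M by fact
  interpret N: graded_module K N by fact
  interpret P: k_module K P by fact
  interpret f: bilin_map K M N P f by unfold_locales fact
  interpret bigraded_family K M N P "\<lambda>p q x y. sg P (p * q) (f x y)"
    by unfold_locales
      (simp_all add: linear_on_def f.add_left f.add_right f.smult_left f.smult_right P.sg_add P.sg_smult)
  show "bilinear_map K M N P (koszul M N P f)"
    unfolding koszul_def by (rule bilinear)
  show "koszul M N P f x y = sg P (p * q) (f x y)" if "x \<in> gr M p" "y \<in> gr N q"
    unfolding koszul_def by (rule homogeneous[OF that])
qed

lemma bilinear_gr_eqI:
  fixes P :: "('k, 'p) dg"
  assumes "graded_module K M" "graded_module K N"
    and "bilin_map K M N P f" "bilin_map K M N P g"
    and eq: "\<And>p q x y. x \<in> gr M p \<Longrightarrow> y \<in> gr N q \<Longrightarrow> f x y = g x y"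
    and x: "x \<in> carrier M" and y: "y \<in> carrier N"
  shows "f x y = g x y"
  using graded_module.gr_eqI[OF assms(1) x bilin_map.lin_left[OF assms(3) y] bilin_map.lin_left[OF assms(4) y]]
    graded_module.gr_eqI[OF assms(2) y bilin_map.lin_right[OF assms(3)] bilin_map.lin_right[OF assms(4)]]
    eq graded_module.gr_closed[OF assms(1)] by blast

section \<open>Tensor products\<close>

lemma comm_group_cong:
  assumes "comm_group G" "carrier H = carrier G" "monoid.mult H = monoid.mult G" "one H = one G"
  shows "comm_group H"
proof -
  interpret G: comm_group G by fact
  show ?thesis
    by (rule comm_groupI) (simp_all add: assms(2-) G.m_ac G.l_inv_ex)
qed

lemma generate_cong:
  assumes "carrier H = carrier G" "monoid.mult H = monoid.mult G" "one H = one G"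
  shows "generate H S = generate G S"
proof -
  have inv: "inv\<^bsub>H\<^esub> x = inv\<^bsub>G\<^esub> x" for x using assms by (simp add: m_inv_def)
  have "x \<in> generate G S" if "x \<in> generate H S" for x
    using that by (induction rule: generate.induct) (auto simp: inv assms intro: generate.intros)
  moreover have "x \<in> generate H S" if "x \<in> generate G S" for x
    using that
    by (induction rule: generate.induct)
      (metis assms generate.one, metis generate.incl, metis inv generate.inv, metis assms generate.eng)
  ultimately show ?thesis by blast
qed

locale tensor = M: k_module K M + N: k_module K N
  for K :: "'k ring" and M :: "('k, 'm) dg" and N :: "('k, 'n) dg"
begin

abbreviation "F \<equiv> free_Abelian_group (carrier M \<times> carrier N)"
abbreviation "T \<equiv> tensor_module K M N"
abbreviation quot where "quot \<equiv> \<lambda>c. tensor_null K M N #>\<^bsub>F\<^esub> c"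

lemma relators_carrier: "tensor_relators K M N \<subseteq> carrier F"
proof -
  have diff: "c - d \<in> carrier F" if "c \<in> carrier F" "d \<in> carrier F" for c d
    using that keys_diff[of c d] by (simp add: subset_trans[OF keys_diff])
  have two: "frag_of a - frag_of b \<in> carrier F"
    if "a \<in> carrier M \<times> carrier N" "b \<in> carrier M \<times> carrier N" for a b
    by (rule diff) (use that in simp_all)
  have three: "frag_of a - frag_of b - frag_of c \<in> carrier F"
    if "a \<in> carrier M \<times> carrier N" "b \<in> carrier M \<times> carrier N" "c \<in> carrier M \<times> carrier N" for a b c
    by (intro diff) (use that in simp_all)
  show ?thesis
    unfolding tensor_relators_def by (intro Un_least subsetI; clarify; (rule three | rule two); simp)
qed

lemma null_normal: "tensor_null K M N \<lhd> F"
proof -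
  interpret F: comm_group F by (rule abelian_free_Abelian_group)
  show ?thesis
    unfolding tensor_null_def
    using F.generate_is_subgroup[OF relators_carrier] F.normal_iff_subgroup by blast
qed

lemma T_fields:
  "carrier T = carrier (tensor_group K M N)" "add T = monoid.mult (tensor_group K M N)"
  "\<zero>\<^bsub>T\<^esub> = \<one>\<^bsub>tensor_group K M N\<^esub>"
  by (simp_all add: tensor_module_def)

lemma T_comm_group: "comm_group (add_monoid T)"
proof (rule comm_group_cong)
  show "comm_group (tensor_group K M N)"
    unfolding tensor_group_def
    using comm_group.abelian_FactGroup[OF abelian_free_Abelian_group]
      normal_imp_subgroup[OF null_normal] by blast
qed (simp_all add: T_fields)

lemma T_hom: "hom (add_monoid T) G = hom (tensor_group K M N) G"
  "hom G (add_monoid T) = hom G (tensor_group K M N)"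
  by (simp_all add: hom_def T_fields)

lemma T_abelian_group: "abelian_group T"
proof -
  interpret comm_group "add_monoid T" by (rule T_comm_group)
  show ?thesis
    unfolding abelian_group_def abelian_monoid_def abelian_group_axioms_def
    using comm_group_axioms comm_monoid_axioms by blast
qed

sublocale T: abelian_group T by (rule T_abelian_group)

lemma quot_hom: "quot \<in> hom F (add_monoid T)"
  unfolding T_hom tensor_group_def using normal.r_coset_hom_Mod[OF null_normal] .

lemma quot_surj: "quot ` carrier F = carrier T"
  using carrier_FactGroup[of F "tensor_null K M N"]
  by (simp add: tensor_module_def tensor_group_def)

lemma quot_group_hom: "group_hom F (add_monoid T) quot"
  using quot_hom T.a_group by (simp add: group_hom_def group_hom_axioms_def)

lemma quot_closed: "c \<in> carrier F \<Longrightarrow> quot c \<in> carrier T"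
  using quot_surj by blast

lemma quot_add: "c \<in> carrier F \<Longrightarrow> c' \<in> carrier F \<Longrightarrow> quot (c + c') = quot c \<oplus>\<^bsub>T\<^esub> quot c'"
  using hom_mult[OF quot_hom, of c c'] by simp

lemma quot_minus: "c \<in> carrier F \<Longrightarrow> quot (- c) = \<ominus>\<^bsub>T\<^esub> quot c"
  using group_hom.hom_inv[OF quot_group_hom, of c] by (simp add: a_inv_def)

lemma quot_diff: "c \<in> carrier F \<Longrightarrow> c' \<in> carrier F \<Longrightarrow> quot (c - c') = quot c \<ominus>\<^bsub>T\<^esub> quot c'"
  using quot_add[of c "- c'"] quot_minus[of c'] by (simp add: a_minus_def)

lemma quot_relator:
  assumes "c \<in> tensor_relators K M N"
  shows "quot c = \<zero>\<^bsub>T\<^esub>"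
proof -
  interpret F: comm_group F by (rule abelian_free_Abelian_group)
  have "c \<in> tensor_null K M N" unfolding tensor_null_def using assms by (rule generate.incl)
  then have "quot c = tensor_null K M N"
    using F.coset_join2[OF _ normal_imp_subgroup[OF null_normal]] assms relators_carrier by blast
  then show ?thesis by (simp add: tensor_module_def tensor_group_def)
qed

lemma pure_closed [simp]: "x \<in> carrier M \<Longrightarrow> y \<in> carrier N \<Longrightarrow> pure K M N x y \<in> carrier T"
  unfolding pure_def by (rule quot_closed) simp

lemma quot_relator3:
  assumes "c - d - e \<in> tensor_relators K M N" and F: "c \<in> carrier F" "d \<in> carrier F" "e \<in> carrier F"
  shows "quot c = quot d \<oplus>\<^bsub>T\<^esub> quot e"
proof -
  have de: "d + e \<in> carrier F"
    using monoid.m_closed[OF group.is_monoid[OF group_free_Abelian_group] F(2,3)] by simp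
  have "quot (c - (d + e)) = \<zero>\<^bsub>T\<^esub>"
    using quot_relator[OF assms(1)] by (simp only: diff_diff_eq)
  then have "quot c \<ominus>\<^bsub>T\<^esub> (quot d \<oplus>\<^bsub>T\<^esub> quot e) = \<zero>\<^bsub>T\<^esub>"
    by (simp only: quot_diff[OF F(1) de] quot_add[OF F(2,3)])
  then show ?thesis
    by (rule T.eq_of_minus_zero[OF _ quot_closed[OF F(1)] T.a_closed[OF quot_closed[OF F(2)] quot_closed[OF F(3)]]])
qed

lemma pure_add_left:
  assumes "x \<in> carrier M" "x' \<in> carrier M" "y \<in> carrier N"
  shows "pure K M N (x \<oplus>\<^bsub>M\<^esub> x') y = pure K M N x y \<oplus>\<^bsub>T\<^esub> pure K M N x' y"
  unfolding pure_def
proof (rule quot_relator3)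
  show "frag_of (x \<oplus>\<^bsub>M\<^esub> x', y) - frag_of (x, y) - frag_of (x', y) \<in> tensor_relators K M N"
    using assms unfolding tensor_relators_def by blast
qed (use assms in simp_all)

lemma pure_add_right:
  assumes "x \<in> carrier M" "y \<in> carrier N" "y' \<in> carrier N"
  shows "pure K M N x (y \<oplus>\<^bsub>N\<^esub> y') = pure K M N x y \<oplus>\<^bsub>T\<^esub> pure K M N x y'"
  unfolding pure_def
proof (rule quot_relator3)
  show "frag_of (x, y \<oplus>\<^bsub>N\<^esub> y') - frag_of (x, y) - frag_of (x, y') \<in> tensor_relators K M N"
    using assms unfolding tensor_relators_def by blast
qed (use assms in simp_all)

lemma pure_balanced:
  assumes "k \<in> carrier K" "x \<in> carrier M" "y \<in> carrier N"
  shows "pure K M N (k \<odot>\<^bsub>M\<^esub> x) y = pure K M N x (k \<odot>\<^bsub>N\<^esub> y)"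
proof -
  have "frag_of (k \<odot>\<^bsub>M\<^esub> x, y) - frag_of (x, k \<odot>\<^bsub>N\<^esub> y) \<in> tensor_relators K M N"
    using assms unfolding tensor_relators_def by blast
  then have "quot (frag_of (k \<odot>\<^bsub>M\<^esub> x, y) - frag_of (x, k \<odot>\<^bsub>N\<^esub> y)) = \<zero>\<^bsub>T\<^esub>"
    by (rule quot_relator)
  then have "pure K M N (k \<odot>\<^bsub>M\<^esub> x) y \<ominus>\<^bsub>T\<^esub> pure K M N x (k \<odot>\<^bsub>N\<^esub> y) = \<zero>\<^bsub>T\<^esub>"
    unfolding pure_def by (subst quot_diff[symmetric]) (use assms in simp_all)
  then show ?thesis by (rule T.eq_of_minus_zero) (use assms in simp_all)
qed

lemma pure_minus_left: "x \<in> carrier M \<Longrightarrow> y \<in> carrier N \<Longrightarrow>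
    pure K M N (\<ominus>\<^bsub>M\<^esub> x) y = \<ominus>\<^bsub>T\<^esub> pure K M N x y"
  using pure_add_left[of "\<ominus>\<^bsub>M\<^esub> x" x y] pure_add_left[of "\<zero>\<^bsub>M\<^esub>" "\<zero>\<^bsub>M\<^esub>" y]
    T.add.l_cancel_one'[of "pure K M N \<zero>\<^bsub>M\<^esub> y" "pure K M N \<zero>\<^bsub>M\<^esub> y"]
  by (intro T.minus_equality[symmetric]) (simp_all add: M.l_neg)

lemma pure_induct [consumes 1, case_names pure add]:
  assumes t: "t \<in> carrier T"
    and pure: "\<And>x y. x \<in> carrier M \<Longrightarrow> y \<in> carrier N \<Longrightarrow> P (pure K M N x y)"
    and add: "\<And>s t. s \<in> carrier T \<Longrightarrow> t \<in> carrier T \<Longrightarrow> P s \<Longrightarrow> P t \<Longrightarrow> P (s \<oplus>\<^bsub>T\<^esub> t)"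
  shows "P t"
proof -
  obtain c where c: "c \<in> carrier F" and tc: "t = quot c" using t quot_surj by blast
  have z: "quot 0 = \<zero>\<^bsub>T\<^esub>"
    using quot_diff[of 0 0] quot_closed[of 0] by (simp add: T.r_neg a_minus_def)
  have "pure K M N \<zero>\<^bsub>M\<^esub> \<zero>\<^bsub>N\<^esub> = \<zero>\<^bsub>T\<^esub>"
    using pure_add_left[of "\<zero>\<^bsub>M\<^esub>" "\<zero>\<^bsub>M\<^esub>" "\<zero>\<^bsub>N\<^esub>"]
      T.add.l_cancel_one'[of "pure K M N \<zero>\<^bsub>M\<^esub> \<zero>\<^bsub>N\<^esub>" "pure K M N \<zero>\<^bsub>M\<^esub> \<zero>\<^bsub>N\<^esub>"] by simp
  then have Pz: "P \<zero>\<^bsub>T\<^esub>" using pure[of "\<zero>\<^bsub>M\<^esub>" "\<zero>\<^bsub>N\<^esub>"] by simp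
  have mz: "\<ominus>\<^bsub>T\<^esub> \<zero>\<^bsub>T\<^esub> = \<zero>\<^bsub>T\<^esub>" by (rule T.minus_equality) simp_all
  \<comment> \<open>Differences generate the free group, so the negative has to be carried along.\<close>
  have "P (quot c) \<and> P (\<ominus>\<^bsub>T\<^esub> quot c)"
  proof (rule free_Abelian_group_induct[of c "carrier M \<times> carrier N"])
    fix c d :: "'m \<times> 'n \<Rightarrow>\<^sub>0 int"
    assume "Poly_Mapping.keys c \<subseteq> carrier M \<times> carrier N" "Poly_Mapping.keys d \<subseteq> carrier M \<times> carrier N"
    then have cd: "c \<in> carrier F" "d \<in> carrier F" by auto
    assume "P (quot c) \<and> P (\<ominus>\<^bsub>T\<^esub> quot c)" "P (quot d) \<and> P (\<ominus>\<^bsub>T\<^esub> quot d)"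
    then show "P (quot (c - d)) \<and> P (\<ominus>\<^bsub>T\<^esub> quot (c - d))"
      using add quot_closed[OF cd(1)] quot_closed[OF cd(2)] quot_diff[OF cd]
      by (simp add: a_minus_def T.minus_add)
  next
    fix a assume "a \<in> carrier M \<times> carrier N"
    then show "P (quot (frag_of a)) \<and> P (\<ominus>\<^bsub>T\<^esub> quot (frag_of a))"
      using pure pure_minus_left by (cases a) (metis M.a_inv_closed mem_Sigma_iff pure_def)
  qed (use c in \<open>simp_all add: z mz Pz\<close>)
  then show ?thesis using tc by blast
qed

text \<open>
  The homomorphism from the free abelian group that extends \<open>f\<close> kills the relators, hence factors
  through the quotient. The statement is about groups, because the scalar multiplication of the
  tensor product is itself obtained from it.
\<close>

lemma group_lift:
  fixes P :: "('p, 'c) ring_scheme"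
  assumes "abelian_group P"
    and closed: "\<And>x y. x \<in> carrier M \<Longrightarrow> y \<in> carrier N \<Longrightarrow> f x y \<in> carrier P"
    and left: "\<And>x x' y. x \<in> carrier M \<Longrightarrow> x' \<in> carrier M \<Longrightarrow> y \<in> carrier N \<Longrightarrow>
      f (x \<oplus>\<^bsub>M\<^esub> x') y = f x y \<oplus>\<^bsub>P\<^esub> f x' y"
    and right: "\<And>x y y'. x \<in> carrier M \<Longrightarrow> y \<in> carrier N \<Longrightarrow> y' \<in> carrier N \<Longrightarrow>
      f x (y \<oplus>\<^bsub>N\<^esub> y') = f x y \<oplus>\<^bsub>P\<^esub> f x y'"
    and balanced: "\<And>k x y. k \<in> carrier K \<Longrightarrow> x \<in> carrier M \<Longrightarrow> y \<in> carrier N \<Longrightarrow>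
      f (k \<odot>\<^bsub>M\<^esub> x) y = f x (k \<odot>\<^bsub>N\<^esub> y)"
  shows "\<exists>h. h \<in> hom (add_monoid T) (add_monoid P) \<and>
    (\<forall>x\<in>carrier M. \<forall>y\<in>carrier N. h (pure K M N x y) = f x y)"
proof -
  interpret P: abelian_group P by fact
  have "(\<lambda>(x, y). f x y) ` (carrier M \<times> carrier N) \<subseteq> carrier (add_monoid P)" using closed by auto
  then obtain g where g: "g \<in> hom F (add_monoid P)"
      and gf: "\<And>a. a \<in> carrier M \<times> carrier N \<Longrightarrow> g (frag_of a) = (case a of (x, y) \<Rightarrow> f x y)"
    using comm_group.free_Abelian_group_universal[OF P.a_comm_group] by blast
  interpret g: group_hom F "add_monoid P" g
    using g P.a_group by (simp add: group_hom_def group_hom_axioms_def)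
  have g_diff: "g (c - d) = g c \<ominus>\<^bsub>P\<^esub> g d" if "c \<in> carrier F" "d \<in> carrier F" for c d
    using g.hom_mult[of c "- d"] g.hom_inv[of d] that by (simp add: a_minus_def a_inv_def)
  have fr: "frag_of a \<in> carrier F \<longleftrightarrow> a \<in> carrier M \<times> carrier N" for a by simp
  have g3: "g (frag_of a - frag_of b - frag_of c) = g (frag_of a) \<ominus>\<^bsub>P\<^esub> g (frag_of b) \<ominus>\<^bsub>P\<^esub> g (frag_of c)"
    if "a \<in> carrier M \<times> carrier N" "b \<in> carrier M \<times> carrier N" "c \<in> carrier M \<times> carrier N" for a b c
  proof -
    have "frag_of a - frag_of b \<in> carrier F"
      using that keys_diff[of "frag_of a" "frag_of b"] by fastforce
    then show ?thesis using that g_diff fr by metis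
  qed
  have zero: "u \<oplus>\<^bsub>P\<^esub> v \<ominus>\<^bsub>P\<^esub> u \<ominus>\<^bsub>P\<^esub> v = \<zero>\<^bsub>P\<^esub>" if "u \<in> carrier P" "v \<in> carrier P" for u v
    using that by (simp add: a_minus_def) (metis P.a_assoc P.a_comm P.a_closed P.a_inv_closed P.r_neg P.r_neg2)
  have self: "u \<ominus>\<^bsub>P\<^esub> u = \<zero>\<^bsub>P\<^esub>" if "u \<in> carrier P" for u
    using that by (simp add: a_minus_def P.r_neg)
  have "g c = \<zero>\<^bsub>P\<^esub>" if "c \<in> tensor_relators K M N" for c
    using that unfolding tensor_relators_def
    by (elim UnE CollectE exE conjE)
      (simp_all add: g3 g_diff gf fr left right balanced closed zero self
        del: carrier_free_Abelian_group_iff)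
  then have "tensor_relators K M N \<subseteq> kernel F (add_monoid P) g"
    using relators_carrier by (auto simp: kernel_def simp del: carrier_free_Abelian_group_iff)
  then have null: "tensor_null K M N \<subseteq> kernel F (add_monoid P) g"
    unfolding tensor_null_def
    using g.G.generate_subgroup_incl[OF _ g.subgroup_kernel] by blast
  show ?thesis
    using g.FactGroup_universal_kernel[OF null_normal null] gf fr
    unfolding T_hom tensor_group_def pure_def
    by (metis (mono_tags, lifting) case_prod_conv mem_Sigma_iff)
qed

lemma T_smult_unique:
  assumes k: "k \<in> carrier K"
  shows "\<exists>!h. h \<in> extensional (carrier (tensor_group K M N)) \<and>
    h \<in> hom (tensor_group K M N) (tensor_group K M N) \<and>
    (\<forall>x\<in>carrier M. \<forall>y\<in>carrier N. h (pure K M N x y) = pure K M N (k \<odot>\<^bsub>M\<^esub> x) y)"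
proof -
  have carT: "carrier (tensor_group K M N) = carrier T" by (simp add: tensor_module_def)
  have "\<exists>h. h \<in> hom (add_monoid T) (add_monoid T) \<and>
    (\<forall>x\<in>carrier M. \<forall>y\<in>carrier N. h (pure K M N x y) = pure K M N (k \<odot>\<^bsub>M\<^esub> x) y)"
  proof (rule group_lift[OF T_abelian_group])
    fix l x y assume "l \<in> carrier K" "x \<in> carrier M" "y \<in> carrier N"
    then show "pure K M N (k \<odot>\<^bsub>M\<^esub> (l \<odot>\<^bsub>M\<^esub> x)) y = pure K M N (k \<odot>\<^bsub>M\<^esub> x) (l \<odot>\<^bsub>N\<^esub> y)"
      using k pure_balanced[of l "k \<odot>\<^bsub>M\<^esub> x" y]
      by (metis M.smult_assoc1 M.smult_closed M.m_comm)
  qed (simp_all add: k M.smult_r_distr pure_add_left pure_add_right)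
  then obtain h where h: "h \<in> hom (add_monoid T) (add_monoid T)"
      "\<forall>x\<in>carrier M. \<forall>y\<in>carrier N. h (pure K M N x y) = pure K M N (k \<odot>\<^bsub>M\<^esub> x) y" by blast
  show ?thesis
  proof (rule ex1I[of _ "restrict h (carrier T)"], intro conjI)
    show "restrict h (carrier T) \<in> hom (tensor_group K M N) (tensor_group K M N)"
      using h(1) unfolding T_hom[symmetric] by (auto simp: hom_def)
  next
    fix g assume g: "g \<in> extensional (carrier (tensor_group K M N)) \<and>
      g \<in> hom (tensor_group K M N) (tensor_group K M N) \<and>
      (\<forall>x\<in>carrier M. \<forall>y\<in>carrier N. g (pure K M N x y) = pure K M N (k \<odot>\<^bsub>M\<^esub> x) y)"
    have "g t = h t" if "t \<in> carrier T" for t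
      using that
    proof (induction rule: pure_induct)
      case (add s t)
      then show ?case using g h(1) unfolding T_hom[symmetric] by (auto simp: hom_def)
    qed (use g h(2) in auto)
    then show "g = restrict h (carrier T)"
      using g unfolding carT by (auto simp: extensional_def fun_eq_iff)
  qed (use h in \<open>auto simp: carT\<close>)
qed

lemma
  assumes "k \<in> carrier K"
  shows T_smult_hom: "smult T k \<in> hom (add_monoid T) (add_monoid T)"
    and smult_pure: "x \<in> carrier M \<Longrightarrow> y \<in> carrier N \<Longrightarrow>
      k \<odot>\<^bsub>T\<^esub> pure K M N x y = pure K M N (k \<odot>\<^bsub>M\<^esub> x) y"
proof -
  have T_smult: "smult T k = (THE h. h \<in> extensional (carrier (tensor_group K M N)) \<and>
    h \<in> hom (tensor_group K M N) (tensor_group K M N) \<and>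
    (\<forall>x\<in>carrier M. \<forall>y\<in>carrier N. h (pure K M N x y) = pure K M N (k \<odot>\<^bsub>M\<^esub> x) y))"
    by (simp add: tensor_module_def)
  note t = theI'[OF T_smult_unique[OF assms], folded T_smult]
  show "smult T k \<in> hom (add_monoid T) (add_monoid T)" using t unfolding T_hom by blast
  show "k \<odot>\<^bsub>T\<^esub> pure K M N x y = pure K M N (k \<odot>\<^bsub>M\<^esub> x) y" if "x \<in> carrier M" "y \<in> carrier N"
    using t that by blast
qed

lemma T_module: "module K T"
proof (rule moduleI)
  have cl: "k \<odot>\<^bsub>T\<^esub> t \<in> carrier T" if "k \<in> carrier K" "t \<in> carrier T" for k t
    using T_smult_hom that by (fastforce simp: hom_def)
  have ad: "k \<odot>\<^bsub>T\<^esub> (s \<oplus>\<^bsub>T\<^esub> t) = k \<odot>\<^bsub>T\<^esub> s \<oplus>\<^bsub>T\<^esub> k \<odot>\<^bsub>T\<^esub> t"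
    if "k \<in> carrier K" "s \<in> carrier T" "t \<in> carrier T" for k s t
    using T_smult_hom that by (fastforce simp: hom_def)
  show "cring K" by (rule M.is_cring)
  show "abelian_group T" by (rule T_abelian_group)
  show "k \<odot>\<^bsub>T\<^esub> t \<in> carrier T" if "k \<in> carrier K" "t \<in> carrier T" for k t
    using cl that .
  show "k \<odot>\<^bsub>T\<^esub> (s \<oplus>\<^bsub>T\<^esub> t) = k \<odot>\<^bsub>T\<^esub> s \<oplus>\<^bsub>T\<^esub> k \<odot>\<^bsub>T\<^esub> t"
    if "k \<in> carrier K" "s \<in> carrier T" "t \<in> carrier T" for k s t using ad that .
  show "(k \<oplus>\<^bsub>K\<^esub> l) \<odot>\<^bsub>T\<^esub> t = k \<odot>\<^bsub>T\<^esub> t \<oplus>\<^bsub>T\<^esub> l \<odot>\<^bsub>T\<^esub> t"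
    if kl: "k \<in> carrier K" "l \<in> carrier K" and t: "t \<in> carrier T" for k l t
    using t
    by (induction rule: pure_induct)
      (simp_all add: kl smult_pure M.smult_l_distr pure_add_left ad cl T.a_ac)
  show "(k \<otimes>\<^bsub>K\<^esub> l) \<odot>\<^bsub>T\<^esub> t = k \<odot>\<^bsub>T\<^esub> (l \<odot>\<^bsub>T\<^esub> t)"
    if kl: "k \<in> carrier K" "l \<in> carrier K" and t: "t \<in> carrier T" for k l t
    using t by (induction rule: pure_induct) (simp_all add: kl smult_pure M.smult_assoc1 ad cl)
  show "\<one>\<^bsub>K\<^esub> \<odot>\<^bsub>T\<^esub> t = t" if "t \<in> carrier T" for t
    using that by (induction rule: pure_induct) (simp_all add: smult_pure ad)
qed

sublocale T: k_module K T
  by (rule k_module.intro) (rule T_module)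

lemma pure_bilinear: "bilinear_map K M N T (pure K M N)"
  by (rule bilinear_mapI) (simp_all add: pure_add_left pure_add_right smult_pure pure_balanced)

sublocale pure: bilin_map K M N T "pure K M N"
  by unfold_locales (rule pure_bilinear)

lemma pure_generate:
  assumes x: "x \<in> generate (add_monoid M) X" "X \<subseteq> carrier M"
    and y: "y \<in> generate (add_monoid N) Y" "Y \<subseteq> carrier N"
  shows "pure K M N x y \<in> generate (add_monoid T) {pure K M N x y |x y. x \<in> X \<and> y \<in> Y}"
    (is "_ \<in> generate _ ?P")
proof -
  have P: "?P \<subseteq> carrier T" using x(2) y(2) pure_closed by blast
  have yc: "y \<in> carrier N" using N.generate_closed[OF y(2,1)] .
  have gen: "pure K M N s y \<in> generate (add_monoid T) ?P" if s: "s \<in> X" for s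
  proof -
    have sc: "s \<in> carrier M" using s x(2) by blast
    have st: "pure K M N s t \<in> generate (add_monoid T) ?P" "t \<in> carrier N" if "t \<in> Y" for t
      using s that y(2) by (blast intro: T.generate_incl)+
    show ?thesis using y(1)
      by (induction rule: N.generator_induct)
        (use sc y(2) in \<open>simp_all add: T.generate_zero T.generate_add pure_add_right st
          pure.minus_right T.generate_minus[OF P]\<close>)
  qed
  have Xc: "s \<in> carrier M" if "s \<in> X" for s using x(2) that by blast
  show ?thesis using x(1)
    by (induction rule: M.generator_induct)
      (use yc x(2) in \<open>simp_all add: T.generate_zero T.generate_add pure_add_left gen Xc
        pure.minus_left T.generate_minus[OF P]\<close>)
qed

text \<open>
  The linear map on the tensor product that corresponds to a bilinear map. A choice, since its values
  outside the tensor product are arbitrary.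
\<close>

definition lift :: "('k, 'p) dg \<Rightarrow> ('m \<Rightarrow> 'n \<Rightarrow> 'p) \<Rightarrow> ('m \<times> 'n \<Rightarrow>\<^sub>0 int) set \<Rightarrow> 'p" where
  "lift P f = (SOME h. linear_map K T P h \<and>
     (\<forall>x\<in>carrier M. \<forall>y\<in>carrier N. h (pure K M N x y) = f x y))"

lemma
  assumes "k_module K P" and "bilinear_map K M N P f"
  shows lift_linear: "linear_map K T P (lift P f)"
    and lift_pure: "x \<in> carrier M \<Longrightarrow> y \<in> carrier N \<Longrightarrow> lift P f (pure K M N x y) = f x y"
proof -
  interpret P: k_module K P by fact
  interpret f: bilin_map K M N P f by unfold_locales fact
  have "\<exists>h. h \<in> hom (add_monoid T) (add_monoid P) \<and>
    (\<forall>x\<in>carrier M. \<forall>y\<in>carrier N. h (pure K M N x y) = f x y)"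
    by (rule group_lift)
      (simp_all add: P.abelian_group_axioms f.add_left f.add_right f.smult_left f.smult_right)
  then obtain h where h: "h \<in> hom (add_monoid T) (add_monoid P)"
      "\<And>x y. x \<in> carrier M \<Longrightarrow> y \<in> carrier N \<Longrightarrow> h (pure K M N x y) = f x y" by blast
  have cl: "h t \<in> carrier P" if "t \<in> carrier T" for t using h(1) that by (auto simp: hom_def)
  have ad: "h (s \<oplus>\<^bsub>T\<^esub> t) = h s \<oplus>\<^bsub>P\<^esub> h t" if "s \<in> carrier T" "t \<in> carrier T" for s t
    using h(1) that by (auto simp: hom_def)
  have "linear_map K T P h"
  proof (rule linear_mapI)
    fix k t assume k: "k \<in> carrier K" and t: "t \<in> carrier T"
    show "h (k \<odot>\<^bsub>T\<^esub> t) = k \<odot>\<^bsub>P\<^esub> h t"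
      using t by (induction rule: pure_induct)
        (simp_all add: k smult_pure h(2) f.smult_left T.smult_r_distr P.smult_r_distr ad cl)
  qed (simp_all add: cl ad)
  with h(2) have "\<exists>h. linear_map K T P h \<and>
     (\<forall>x\<in>carrier M. \<forall>y\<in>carrier N. h (pure K M N x y) = f x y)" by blast
  note s = someI_ex[OF this, folded lift_def]
  show "linear_map K T P (lift P f)" using s by blast
  show "lift P f (pure K M N x y) = f x y" if "x \<in> carrier M" "y \<in> carrier N" using s that by blast
qed

end

locale graded_tensor = M: graded_module K M + N: graded_module K N
  for K :: "'k ring" and M :: "('k, 'm) dg" and N :: "('k, 'n) dg"
begin

sublocale tensor K M N ..

lemma homogeneous_pure_induct [consumes 1, case_names pure add]:
  assumes t: "t \<in> carrier T"
    and pure: "\<And>p q x y. x \<in> gr M p \<Longrightarrow> y \<in> gr N q \<Longrightarrow> P (pure K M N x y)"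
    and add: "\<And>s t. s \<in> carrier T \<Longrightarrow> t \<in> carrier T \<Longrightarrow> P s \<Longrightarrow> P t \<Longrightarrow> P (s \<oplus>\<^bsub>T\<^esub> t)"
  shows "P t"
  using t
proof (induction rule: pure_induct)
  case (pure x y)
  show ?case using pure(1)
  proof (induction rule: M.gr_induct)
    case (hom p x)
    show ?case using \<open>y \<in> carrier N\<close>
      by (induction rule: N.gr_induct) (simp_all add: assms(2)[OF hom] M.gr_closed[OF hom] pure_add_right assms(3))
  qed (simp_all add: pure pure_add_left add)
qed (simp add: add)

lemma pure_degree: "x \<in> gr M p \<Longrightarrow> y \<in> gr N q \<Longrightarrow> pure K M N x y \<in> gr T (p + q)"
  by (fastforce simp: tensor_module_def intro: generate.incl)

lemma T_gr: "gr T n = generate (add_monoid T) {pure K M N x y |x y p q. x \<in> gr M p \<and> y \<in> gr N q \<and> p + q = n}"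
  using generate_cong[of "add_monoid T" "tensor_group K M N"]
  by (simp add: T_fields) (simp add: tensor_module_def)

text \<open>
  The generators of a component are closed under negation, as \<open>- (x \<otimes> y) = (- x) \<otimes> y\<close>, so sums of
  generators suffice.
\<close>

lemma T_gr_induct [consumes 1, case_names pure add]:
  assumes t: "t \<in> gr T n"
    and pure: "\<And>p q x y. x \<in> gr M p \<Longrightarrow> y \<in> gr N q \<Longrightarrow> p + q = n \<Longrightarrow> P (pure K M N x y)"
    and add: "\<And>s t. s \<in> carrier T \<Longrightarrow> t \<in> carrier T \<Longrightarrow> s \<in> gr T n \<Longrightarrow> t \<in> gr T n \<Longrightarrow>
      P s \<Longrightarrow> P t \<Longrightarrow> P (s \<oplus>\<^bsub>T\<^esub> t)"
  shows "P t"
  using t unfolding T_gr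
proof (induction rule: T.generator_induct_neg)
  case (neg s)
  then obtain x y p q where "s = pure K M N x y" "x \<in> gr M p" "y \<in> gr N q" "p + q = n" by blast
  then show ?case
    using pure.minus_left[of x y] M.gr_minus by fastforce
next
  case zero
  show ?case using pure[of "\<zero>\<^bsub>M\<^esub>" n "\<zero>\<^bsub>N\<^esub>" 0] by simp
qed (use pure add[unfolded T_gr] in auto)

lemma T_gr_submodule: "submodule (gr T n) K T"
proof (rule T.submoduleI)
  have sub: "{pure K M N x y |x y p q. x \<in> gr M p \<and> y \<in> gr N q \<and> p + q = n} \<subseteq> carrier T" by auto
  show cl: "gr T n \<subseteq> carrier T" unfolding T_gr using T.generate_closed[OF sub] by blast
  show "\<zero>\<^bsub>T\<^esub> \<in> gr T n" unfolding T_gr by (rule T.generate_zero)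
  show ad: "s \<oplus>\<^bsub>T\<^esub> t \<in> gr T n" if "s \<in> gr T n" "t \<in> gr T n" for s t
    using that unfolding T_gr by (rule T.generate_add)
  show "\<ominus>\<^bsub>T\<^esub> t \<in> gr T n" if "t \<in> gr T n" for t
    using that unfolding T_gr by (rule T.generate_minus[OF sub])
  show "k \<odot>\<^bsub>T\<^esub> t \<in> gr T n" if "k \<in> carrier K" "t \<in> gr T n" for k t
    using that(2)
  proof (induction rule: T_gr_induct)
    case (pure p q x y)
    then show ?case
      using that(1) pure_degree[OF M.gr_smult] by (auto simp: smult_pure)
  next
    case (add s t)
    then show ?case using that(1) by (simp add: T.smult_r_distr ad)
  qed
qed

text \<open>
  The projection of the tensor product onto its component of degree \<open>n\<close>: the sum over \<open>p\<close> of
  $x_p \otimes y_{n-p}$.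
\<close>

lemma T_projection:
  "\<exists>h. linear_map K T T h \<and> (\<forall>t\<in>gr T n. h t = t) \<and> (\<forall>m. m \<noteq> n \<longrightarrow> (\<forall>t\<in>gr T m. h t = \<zero>\<^bsub>T\<^esub>))"
proof -
  define \<phi> where "\<phi> = (\<lambda>p q x y. if p + q = n then pure K M N x y else \<zero>\<^bsub>T\<^esub>)"
  interpret bigraded_family K M N T \<phi>
    by unfold_locales
      (auto simp: \<phi>_def linear_on_def pure_add_left pure_add_right pure.smult_left pure.smult_right)
  define h where "h = lift T (bigraded_ext M N T \<phi>)"
  interpret h: lin_map K T T h
    unfolding h_def by unfold_locales (rule lift_linear[OF T.k_module_axioms bilinear])
  have hp: "h (pure K M N x y) = (if p + q = n then pure K M N x y else \<zero>\<^bsub>T\<^esub>)"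
    if "x \<in> gr M p" "y \<in> gr N q" for p q x y
  proof -
    have "h (pure K M N x y) = \<phi> p q x y"
      unfolding h_def homogeneous[OF that, symmetric] using that
      by (intro lift_pure[OF T.k_module_axioms bilinear]) auto
    then show ?thesis by (simp add: \<phi>_def)
  qed
  have "h t = (if m = n then t else \<zero>\<^bsub>T\<^esub>)" if "t \<in> gr T m" for m t
    using that by (induction rule: T_gr_induct) (simp_all add: hp h.add)
  then show ?thesis using h.lin by auto
qed

lemma T_graded: "graded_module K T"
proof (intro graded_module.intro graded_module_axioms.intro T.module_axioms)
  show "submodule (gr T n) K T" for n by (rule T_gr_submodule)
  show "internal_direct_sum T UNIV (gr T)"
  proof (rule internal_direct_sumI[OF T.k_module_axioms T.k_module_axioms T_gr_submodule])
    fix t assume "t \<in> carrier T"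
    then show "t \<in> generate (add_monoid T) (\<Union>n\<in>UNIV. gr T n)"
    proof (induction rule: homogeneous_pure_induct)
      case (pure p q x y)
      then show ?case using pure_degree by (intro T.generate_incl) blast
    qed (rule T.generate_add)
  next
    fix n s assume "s \<in> gr T n" "s \<noteq> \<zero>\<^bsub>T\<^esub>"
    then show "\<exists>h. linear_map K T T h \<and> (\<forall>m\<in>UNIV. m \<noteq> n \<longrightarrow> (\<forall>t\<in>gr T m. h t = \<zero>\<^bsub>T\<^esub>)) \<and> h s \<noteq> \<zero>\<^bsub>T\<^esub>"
      using T_projection[of n] by metis
  qed
qed

end

section \<open>Change of multiplication and differential\<close>

text \<open>
  Opposite algebras and tensor products of algebras arise from graded modules by prescribing a
  multiplication and a differential, neither of which affects the module structure.
\<close>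

context
  fixes N M :: "('k, 'm) dg" and m D
  assumes N: "N = M\<lparr>monoid.mult := m, dif := D\<rparr>"
begin

lemma upd_fields: "carrier N = carrier M" "add N = add M" "ring.zero N = ring.zero M" "smult N = smult M"
  "gr N = gr M" "a_inv N = a_inv M" "finsum N = finsum M" "add_monoid N = add_monoid M"
  by (simp_all add: N a_inv_def[abs_def] finsum_def[abs_def] fun_eq_iff)

lemma upd_linear: "linear_map K N P f = linear_map K M P f" "linear_map K P N g = linear_map K P M g"
  by (simp_all add: linear_map_def hom_def upd_fields)

lemma upd_sg: "sg N = sg M"
  by (simp add: sg_def[abs_def] fun_eq_iff upd_fields)

lemma upd_module: "module K N = module K M"
  by (simp add: module_def module_axioms_def abelian_group_def abelian_monoid_def
      abelian_group_axioms_def upd_fields)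

lemma upd_direct_sum: "internal_direct_sum N I S = internal_direct_sum M I S"
  by (simp add: internal_direct_sum_def upd_fields)

lemma upd_graded_module: "graded_module K N = graded_module K M"
  by (simp add: graded_module_def graded_module_axioms_def upd_module upd_direct_sum upd_fields
      submodule_def submodule_axioms_def)

end


section \<open>Algebras with enough idempotents\<close>

lemma sg_cong: "even m \<longleftrightarrow> even n \<Longrightarrow> sg M m x = sg M n x"
  by (simp add: sg_def)

context dg_module
begin

sublocale dif: lin_map K M M "dif M"
  by unfold_locales (rule dif_linear)

end

context dg_algebra
begin

sublocale mult: bilin_map K A A A "\<lambda>a b. a \<otimes>\<^bsub>A\<^esub> b"
  by unfold_locales (rule mult_bilinear)

text \<open>
  Orthogonal idempotents whose one-sided ideals generate the algebra decompose it: multiplication by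
  \<open>e\<close> detects the summand of \<open>e\<close>.
\<close>

lemma enough_idempotentsI:
  assumes E: "E \<subseteq> gr A 0" "\<And>e. e \<in> E \<Longrightarrow> e \<noteq> \<zero>\<^bsub>A\<^esub>" "\<And>e. e \<in> E \<Longrightarrow> e \<otimes>\<^bsub>A\<^esub> e = e"
      "\<And>e. e \<in> E \<Longrightarrow> dif A e = \<zero>\<^bsub>A\<^esub>"
      "\<And>e f. e \<in> E \<Longrightarrow> f \<in> E \<Longrightarrow> e \<noteq> f \<Longrightarrow> e \<otimes>\<^bsub>A\<^esub> f = \<zero>\<^bsub>A\<^esub>"
    and gen_left: "\<And>x. x \<in> carrier A \<Longrightarrow>
      x \<in> generate (add_monoid A) (\<Union>e\<in>E. {e \<otimes>\<^bsub>A\<^esub> a |a. a \<in> carrier A})"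
    and gen_right: "\<And>x. x \<in> carrier A \<Longrightarrow>
      x \<in> generate (add_monoid A) (\<Union>e\<in>E. {a \<otimes>\<^bsub>A\<^esub> e |a. a \<in> carrier A})"
  shows "dg_algebra_ei K A"
proof -
  have Ec: "e \<in> carrier A" if "e \<in> E" for e using E(1) that gr_closed by blast
  have "internal_direct_sum A E (\<lambda>e. {e \<otimes>\<^bsub>A\<^esub> a |a. a \<in> carrier A})"
  proof (rule internal_direct_sumI[OF k_module_axioms k_module_axioms _ gen_left])
    fix e assume e: "e \<in> E"
    show "submodule {e \<otimes>\<^bsub>A\<^esub> a |a. a \<in> carrier A} K A"
    proof (rule submoduleI, goal_cases)
      case 2 show ?case using Ec[OF e] by (auto intro!: exI[of _ "\<zero>\<^bsub>A\<^esub>"])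
    next
      case (3 x) then show ?case using Ec[OF e] mult.minus_right by (smt (verit) a_inv_closed mem_Collect_eq)
    next
      case (4 x y) then show ?case using Ec[OF e] mult.add_right by (smt (verit) a_closed mem_Collect_eq)
    next
      case (5 k x) then show ?case using Ec[OF e] mult.smult_right by (smt (verit) smult_closed mem_Collect_eq)
    qed (use Ec[OF e] in auto)
    fix s assume s: "s \<in> {e \<otimes>\<^bsub>A\<^esub> a |a. a \<in> carrier A}" "s \<noteq> \<zero>\<^bsub>A\<^esub>"
    show "\<exists>h. linear_map K A A h \<and> (\<forall>f\<in>E. f \<noteq> e \<longrightarrow>
        (\<forall>t\<in>{f \<otimes>\<^bsub>A\<^esub> a |a. a \<in> carrier A}. h t = \<zero>\<^bsub>A\<^esub>)) \<and> h s \<noteq> \<zero>\<^bsub>A\<^esub>"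
      using s Ec[OF e] Ec E(3)[OF e] E(5)[OF e] lin_map.lin[OF mult.lin_right]
      by (intro exI[of _ "\<lambda>t. e \<otimes>\<^bsub>A\<^esub> t"]) (auto simp flip: mult_assoc)
  qed
  moreover have "internal_direct_sum A E (\<lambda>e. {a \<otimes>\<^bsub>A\<^esub> e |a. a \<in> carrier A})"
  proof (rule internal_direct_sumI[OF k_module_axioms k_module_axioms _ gen_right])
    fix e assume e: "e \<in> E"
    show "submodule {a \<otimes>\<^bsub>A\<^esub> e |a. a \<in> carrier A} K A"
    proof (rule submoduleI, goal_cases)
      case 2 show ?case using Ec[OF e] by (auto intro!: exI[of _ "\<zero>\<^bsub>A\<^esub>"])
    next
      case (3 x) then show ?case using Ec[OF e] mult.minus_left by (smt (verit) a_inv_closed mem_Collect_eq)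
    next
      case (4 x y) then show ?case using Ec[OF e] mult.add_left by (smt (verit) a_closed mem_Collect_eq)
    next
      case (5 k x) then show ?case using Ec[OF e] mult.smult_left by (smt (verit) smult_closed mem_Collect_eq)
    qed (use Ec[OF e] in auto)
    fix s assume s: "s \<in> {a \<otimes>\<^bsub>A\<^esub> e |a. a \<in> carrier A}" "s \<noteq> \<zero>\<^bsub>A\<^esub>"
    show "\<exists>h. linear_map K A A h \<and> (\<forall>f\<in>E. f \<noteq> e \<longrightarrow>
        (\<forall>t\<in>{a \<otimes>\<^bsub>A\<^esub> f |a. a \<in> carrier A}. h t = \<zero>\<^bsub>A\<^esub>)) \<and> h s \<noteq> \<zero>\<^bsub>A\<^esub>"
      using s Ec[OF e] Ec E(3)[OF e] E(5)[OF _ e] lin_map.lin[OF mult.lin_left]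
      by (intro exI[of _ "\<lambda>t. t \<otimes>\<^bsub>A\<^esub> e"]) (auto simp: mult_assoc)
  qed
  ultimately show ?thesis
    using E by (intro dg_algebra_ei.intro dg_algebra_axioms dg_algebra_ei_axioms.intro exI[of _ E]) auto
qed

end

lemma (in k_module) generate_direct_sum:
  assumes "internal_direct_sum M I S" and "x \<in> carrier M"
  shows "x \<in> generate (add_monoid M) (\<Union>i\<in>I. S i)"
proof -
  from assms obtain c where c: "c \<in> (\<Pi>\<^sub>E i\<in>I. S i)" "finite {i\<in>I. c i \<noteq> \<zero>\<^bsub>M\<^esub>}"
      "x = finsum M c {i\<in>I. c i \<noteq> \<zero>\<^bsub>M\<^esub>}" and S: "(\<Union>i\<in>I. S i) \<subseteq> carrier M"
    unfolding internal_direct_sum_def by blast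
  have "finsum M c J \<in> generate (add_monoid M) (\<Union>i\<in>I. S i)" if "finite J" "J \<subseteq> I" for J
    using that
  proof (induction J rule: finite_induct)
    case empty
    show ?case by (simp add: generate_zero)
  next
    case (insert i J)
    have cS: "c j \<in> (\<Union>i\<in>I. S i)" if "j \<in> I" for j using c(1) that by auto
    then have "c \<in> J \<rightarrow> carrier M" "c i \<in> carrier M" using insert.prems S by blast+
    then show ?case
      using insert.hyps insert.IH insert.prems generate_add[OF generate_incl[OF cS[of i]]] by simp
  qed
  then show ?thesis using c(2) unfolding c(3) by blast
qed

context dg_algebra_ei
begin

text \<open>
  Finite sums of the idempotents are degree 0 cycles that act as a unit on any given finite set. The
  algebra is thus filtered by local units, and a statement holds for all sufficiently large local
  units if it holds for those that fix certain finitely many elements.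
\<close>

definition local_units :: "'a set \<Rightarrow> 'a set" where
  "local_units X = {u \<in> gr A 0. dif A u = \<zero>\<^bsub>A\<^esub> \<and> (\<forall>x\<in>X. u \<otimes>\<^bsub>A\<^esub> x = x \<and> x \<otimes>\<^bsub>A\<^esub> u = x)}"

lemma local_units_nonempty:
  assumes X: "finite X" "X \<subseteq> carrier A"
  shows "local_units X \<noteq> {}"
proof -
  from enough_idempotents obtain E where E: "E \<subseteq> gr A 0"
    "\<And>e. e \<in> E \<Longrightarrow> e \<otimes>\<^bsub>A\<^esub> e = e" "\<And>e. e \<in> E \<Longrightarrow> dif A e = \<zero>\<^bsub>A\<^esub>"
    "\<And>e f. e \<in> E \<Longrightarrow> f \<in> E \<Longrightarrow> e \<noteq> f \<Longrightarrow> e \<otimes>\<^bsub>A\<^esub> f = \<zero>\<^bsub>A\<^esub>"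
    "internal_direct_sum A E (\<lambda>e. {e \<otimes>\<^bsub>A\<^esub> a |a. a \<in> carrier A})"
    "internal_direct_sum A E (\<lambda>e. {a \<otimes>\<^bsub>A\<^esub> e |a. a \<in> carrier A})" by blast
  have Ec: "e \<in> carrier A" if "e \<in> E" for e using E(1) that gr_closed by blast
  define u where "u = finsum A (\<lambda>e. e)"
  have u0: "u F \<in> gr A 0" "dif A (u F) = \<zero>\<^bsub>A\<^esub>" if "finite F" "F \<subseteq> E" for F
  proof -
    have "u F \<in> gr A 0 \<and> dif A (u F) = \<zero>\<^bsub>A\<^esub>"
      using that
    proof (induction F rule: finite_induct)
      case (insert e F)
      then have "e \<in> E" "F \<subseteq> E" by auto
      moreover have "(\<lambda>e. e) \<in> F \<rightarrow> carrier A" using \<open>F \<subseteq> E\<close> Ec by auto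
      ultimately show ?case
        using insert E(1,3) Ec[OF \<open>e \<in> E\<close>] by (auto simp: u_def gr_add dif.add)
    qed (simp add: u_def)
    then show "u F \<in> gr A 0" "dif A (u F) = \<zero>\<^bsub>A\<^esub>" by auto
  qed
  have uc: "u F \<in> carrier A" if "finite F" "F \<subseteq> E" for F using u0[OF that] by simp
  have ue0: "u F \<otimes>\<^bsub>A\<^esub> e = \<zero>\<^bsub>A\<^esub> \<and> e \<otimes>\<^bsub>A\<^esub> u F = \<zero>\<^bsub>A\<^esub>" if "finite F" "F \<subseteq> E" "e \<in> E" "e \<notin> F" for F e
    using that(1,2,4)
  proof (induction F rule: finite_induct)
    case (insert f F)
    then have "(\<lambda>e. e) \<in> F \<rightarrow> carrier A" "f \<in> E" "f \<noteq> e" using Ec by auto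
    then show ?case
      using insert Ec[OF \<open>e \<in> E\<close>] Ec[OF \<open>f \<in> E\<close>] E(4) \<open>e \<in> E\<close> uc
      by (auto simp: u_def mult.add_left mult.add_right)
  qed (use Ec[OF \<open>e \<in> E\<close>] in \<open>simp add: u_def\<close>)
  have ue: "u F \<otimes>\<^bsub>A\<^esub> e = e \<and> e \<otimes>\<^bsub>A\<^esub> u F = e" if F: "finite F" "F \<subseteq> E" "e \<in> F" for F e
  proof -
    let ?G = "F - {e}"
    have e: "e \<in> E" using F by blast
    have "(\<lambda>e. e) \<in> ?G \<rightarrow> carrier A" using F Ec by auto
    then have "u (insert e ?G) = e \<oplus>\<^bsub>A\<^esub> u ?G"
      unfolding u_def using F Ec[OF e] by (intro finsum_insert) auto
    moreover have "insert e ?G = F" using F by auto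
    ultimately have "u F = e \<oplus>\<^bsub>A\<^esub> u ?G" by simp
    moreover have "u ?G \<in> carrier A" by (rule uc) (use F in auto)
    ultimately show ?thesis
      using ue0[of ?G e] F e Ec[OF e] E(2)[OF e] by (auto simp: mult.add_left mult.add_right)
  qed
  let ?P = "\<lambda>x. \<exists>G. finite G \<and> G \<subseteq> E \<and> (\<forall>F. finite F \<and> G \<subseteq> F \<and> F \<subseteq> E \<longrightarrow> u F \<otimes>\<^bsub>A\<^esub> x = x)"
  let ?Q = "\<lambda>x. \<exists>G. finite G \<and> G \<subseteq> E \<and> (\<forall>F. finite F \<and> G \<subseteq> F \<and> F \<subseteq> E \<longrightarrow> x \<otimes>\<^bsub>A\<^esub> u F = x)"
  have P: "?P x" if "x \<in> carrier A" for x
    using generate_direct_sum[OF E(5) that]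
  proof (induction rule: generator_induct_neg)
    case zero
    show ?case using uc by (intro exI[of _ "{}"]) auto
  next
    case (gen s)
    then obtain e a where "e \<in> E" "a \<in> carrier A" "s = e \<otimes>\<^bsub>A\<^esub> a" by blast
    then show ?case using ue uc Ec by (intro exI[of _ "{e}"]) (auto simp flip: mult_assoc)
  next
    case (add x y)
    then obtain G H where "finite G" "G \<subseteq> E" "\<forall>F. finite F \<and> G \<subseteq> F \<and> F \<subseteq> E \<longrightarrow> u F \<otimes>\<^bsub>A\<^esub> x = x"
      "finite H" "H \<subseteq> E" "\<forall>F. finite F \<and> H \<subseteq> F \<and> F \<subseteq> E \<longrightarrow> u F \<otimes>\<^bsub>A\<^esub> y = y" by blast
    then show ?case using uc add.hyps by (intro exI[of _ "G \<union> H"]) (auto simp: mult.add_right)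
  next
    case (neg s)
    then obtain e a where "e \<in> E" "a \<in> carrier A" "s = e \<otimes>\<^bsub>A\<^esub> a" by blast
    then show ?case using Ec mult.minus_right[of e a] by (auto intro!: bexI[of _ e] exI[of _ "\<ominus>\<^bsub>A\<^esub> a"])
  qed (use Ec in auto)
  have Q: "?Q x" if "x \<in> carrier A" for x
    using generate_direct_sum[OF E(6) that]
  proof (induction rule: generator_induct_neg)
    case zero
    show ?case using uc by (intro exI[of _ "{}"]) auto
  next
    case (gen s)
    then obtain e a where "e \<in> E" "a \<in> carrier A" "s = a \<otimes>\<^bsub>A\<^esub> e" by blast
    then show ?case using ue uc Ec by (intro exI[of _ "{e}"]) (auto simp: mult_assoc)
  next
    case (add x y)
    then obtain G H where "finite G" "G \<subseteq> E" "\<forall>F. finite F \<and> G \<subseteq> F \<and> F \<subseteq> E \<longrightarrow> x \<otimes>\<^bsub>A\<^esub> u F = x"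
      "finite H" "H \<subseteq> E" "\<forall>F. finite F \<and> H \<subseteq> F \<and> F \<subseteq> E \<longrightarrow> y \<otimes>\<^bsub>A\<^esub> u F = y" by blast
    then show ?case using uc add.hyps by (intro exI[of _ "G \<union> H"]) (auto simp: mult.add_left)
  next
    case (neg s)
    then obtain e a where "e \<in> E" "a \<in> carrier A" "s = a \<otimes>\<^bsub>A\<^esub> e" by blast
    then show ?case using Ec mult.minus_left[of a e] by (auto intro!: bexI[of _ e] exI[of _ "\<ominus>\<^bsub>A\<^esub> a"])
  qed (use Ec in auto)
  have "\<exists>G. finite G \<and> G \<subseteq> E \<and>
      (\<forall>F. finite F \<and> G \<subseteq> F \<and> F \<subseteq> E \<longrightarrow> (\<forall>x\<in>X. u F \<otimes>\<^bsub>A\<^esub> x = x \<and> x \<otimes>\<^bsub>A\<^esub> u F = x))"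
    using X
  proof (induction X rule: finite_induct)
    case (insert x X)
    then have "x \<in> carrier A" "X \<subseteq> carrier A" by auto
    from P[OF this(1)] obtain G1 where 1: "finite G1" "G1 \<subseteq> E"
      "\<forall>F. finite F \<and> G1 \<subseteq> F \<and> F \<subseteq> E \<longrightarrow> u F \<otimes>\<^bsub>A\<^esub> x = x" by blast
    from Q[OF \<open>x \<in> carrier A\<close>] obtain G2 where 2: "finite G2" "G2 \<subseteq> E"
      "\<forall>F. finite F \<and> G2 \<subseteq> F \<and> F \<subseteq> E \<longrightarrow> x \<otimes>\<^bsub>A\<^esub> u F = x" by blast
    from insert.IH[OF \<open>X \<subseteq> carrier A\<close>] obtain G3 where 3: "finite G3" "G3 \<subseteq> E"
      "\<forall>F. finite F \<and> G3 \<subseteq> F \<and> F \<subseteq> E \<longrightarrow> (\<forall>x\<in>X. u F \<otimes>\<^bsub>A\<^esub> x = x \<and> x \<otimes>\<^bsub>A\<^esub> u F = x)" by blast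
    show ?case using 1 2 3 by (intro exI[of _ "G1 \<union> G2 \<union> G3"]) simp
  qed auto
  then obtain G where "finite G" "G \<subseteq> E"
      "\<forall>F. finite F \<and> G \<subseteq> F \<and> F \<subseteq> E \<longrightarrow> (\<forall>x\<in>X. u F \<otimes>\<^bsub>A\<^esub> x = x \<and> x \<otimes>\<^bsub>A\<^esub> u F = x)" by blast
  then have "u G \<in> local_units X" unfolding local_units_def using u0 by blast
  then show ?thesis by blast
qed

text \<open>
  The filter turns arguments of the form "choose a local unit for all elements that occur" into the
  calculus of eventually true statements.
\<close>

definition unit_filter :: "'a filter" where
  "unit_filter = (INF X\<in>{X. finite X \<and> X \<subseteq> carrier A}. principal (local_units X))"

lemma eventually_unit_filter:
  "eventually P unit_filter \<longleftrightarrow> (\<exists>X. finite X \<and> X \<subseteq> carrier A \<and> (\<forall>u\<in>local_units X. P u))"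
proof -
  have "local_units (X \<union> Y) \<subseteq> local_units X \<inter> local_units Y" for X Y
    by (auto simp: local_units_def)
  then have base: "\<exists>Z\<in>{X. finite X \<and> X \<subseteq> carrier A}. principal (local_units Z) \<le>
      inf (principal (local_units X)) (principal (local_units Y))"
    if "X \<in> {X. finite X \<and> X \<subseteq> carrier A}" "Y \<in> {X. finite X \<and> X \<subseteq> carrier A}" for X Y
    using that by (intro bexI[of _ "X \<union> Y"]) (simp_all add: inf_principal)
  show ?thesis
    unfolding unit_filter_def
    by (subst eventually_INF_base[OF _ base]) (auto simp: eventually_principal)
qed

lemma unit_filter_nontrivial: "unit_filter \<noteq> bot"
  unfolding trivial_limit_def eventually_unit_filter using local_units_nonempty by blast

lemma eventually_unit: "a \<in> carrier A \<Longrightarrow>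
    \<forall>\<^sub>F u in unit_filter. u \<in> gr A 0 \<and> dif A u = \<zero>\<^bsub>A\<^esub> \<and> u \<otimes>\<^bsub>A\<^esub> a = a \<and> a \<otimes>\<^bsub>A\<^esub> u = a"
  unfolding eventually_unit_filter by (rule exI[of _ "{a}"]) (simp add: local_units_def)

end


section \<open>The opposite algebra\<close>

context dg_algebra
begin

text \<open>
  Existence is the multiplication in reverse order with its Koszul sign; homogeneous elements generate,
  which gives uniqueness.
\<close>

lemma op_mult_unique: "\<exists>!m. ext2 A A m \<and> bilinear_map K A A A m \<and>
    (\<forall>p q. \<forall>a\<in>gr A p. \<forall>b\<in>gr A q. m a b = sg A (p * q) (b \<otimes>\<^bsub>A\<^esub> a))"
proof -
  have "bilinear_map K A A A (\<lambda>a b. b \<otimes>\<^bsub>A\<^esub> a)"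
    by (rule bilinear_mapI)
      (simp_all add: mult.add_left mult.add_right mult.smult_left mult.smult_right)
  note k = koszul_bilinear[OF graded_module_axioms graded_module_axioms k_module_axioms this]
    koszul_homogeneous[OF graded_module_axioms graded_module_axioms k_module_axioms this]
  let ?k = "koszul A A A (\<lambda>a b. b \<otimes>\<^bsub>A\<^esub> a)"
  let ?m = "\<lambda>a b. if a \<in> carrier A \<and> b \<in> carrier A then ?k a b else undefined"
  interpret k: bilin_map K A A A ?k by unfold_locales (rule k(1))
  have m: "bilinear_map K A A A ?m"
    by (rule bilinear_mapI) (simp_all add: k.add_left k.add_right k.smult_left k.smult_right)
  show ?thesis
  proof (rule ex1I[of _ ?m])
    show "ext2 A A ?m \<and> bilinear_map K A A A ?m \<and>
        (\<forall>p q. \<forall>a\<in>gr A p. \<forall>b\<in>gr A q. ?m a b = sg A (p * q) (b \<otimes>\<^bsub>A\<^esub> a))"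
      using m by (auto simp: ext2_def k(2))
  next
    fix m' assume m': "ext2 A A m' \<and> bilinear_map K A A A m' \<and>
        (\<forall>p q. \<forall>a\<in>gr A p. \<forall>b\<in>gr A q. m' a b = sg A (p * q) (b \<otimes>\<^bsub>A\<^esub> a))"
    then interpret m': bilin_map K A A A m' by unfold_locales blast
    have "m' a b = ?k a b" if "a \<in> carrier A" "b \<in> carrier A" for a b
      by (rule bilinear_gr_eqI[OF graded_module_axioms graded_module_axioms m'.bilin_map_axioms
            k.bilin_map_axioms _ that]) (use m' k(2) in auto)
    then show "m' = ?m" using m' by (auto simp: ext2_def fun_eq_iff)
  qed
qed

lemma op_upd: "op_dg K A = A\<lparr>monoid.mult := monoid.mult (op_dg K A), dif := dif A\<rparr>"
  by (simp add: op_dg_def)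

lemmas op_fields [simp] = upd_fields[OF op_upd]
lemmas op_sg [simp] = upd_sg[OF op_upd]

lemma op_dif [simp]: "dif (op_dg K A) = dif A"
  by (simp add: op_dg_def)

lemma
  shows op_bilinear: "bilinear_map K A A A (monoid.mult (op_dg K A))"
    and op_mult: "a \<in> gr A p \<Longrightarrow> b \<in> gr A q \<Longrightarrow> a \<otimes>\<^bsub>op_dg K A\<^esub> b = sg A (p * q) (b \<otimes>\<^bsub>A\<^esub> a)"
proof -
  have "monoid.mult (op_dg K A) = (THE m. ext2 A A m \<and> bilinear_map K A A A m \<and>
    (\<forall>p q. \<forall>a\<in>gr A p. \<forall>b\<in>gr A q. m a b = sg A (p * q) (b \<otimes>\<^bsub>A\<^esub> a)))"
    by (simp add: op_dg_def)
  note t = theI'[OF op_mult_unique, folded this]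
  show "bilinear_map K A A A (monoid.mult (op_dg K A))" using t by blast
  show "a \<otimes>\<^bsub>op_dg K A\<^esub> b = sg A (p * q) (b \<otimes>\<^bsub>A\<^esub> a)" if "a \<in> gr A p" "b \<in> gr A q"
    using t that by blast
qed

sublocale op: bilin_map K A A A "monoid.mult (op_dg K A)"
  by unfold_locales (rule op_bilinear)

text \<open>
  An element of degree 0 causes no sign, whatever the components of the other factor.
\<close>

lemma op_unit_left: "u \<in> gr A 0 \<Longrightarrow> a \<in> carrier A \<Longrightarrow> u \<otimes>\<^bsub>op_dg K A\<^esub> a = a \<otimes>\<^bsub>A\<^esub> u"
  by (rule gr_eqI[OF _ op.lin_right mult.lin_left]) (simp_all add: op_mult)

lemma op_unit_right: "u \<in> gr A 0 \<Longrightarrow> a \<in> carrier A \<Longrightarrow> a \<otimes>\<^bsub>op_dg K A\<^esub> u = u \<otimes>\<^bsub>A\<^esub> a"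
  by (rule gr_eqI[OF _ op.lin_left mult.lin_right]) (simp_all add: op_mult)

lemma op_graded_module: "graded_module K (op_dg K A)"
  using graded_module_axioms by (simp add: upd_graded_module[OF op_upd])

lemma op_assoc:
  assumes "a \<in> carrier A" "b \<in> carrier A" "c \<in> carrier A"
  shows "(a \<otimes>\<^bsub>op_dg K A\<^esub> b) \<otimes>\<^bsub>op_dg K A\<^esub> c = a \<otimes>\<^bsub>op_dg K A\<^esub> (b \<otimes>\<^bsub>op_dg K A\<^esub> c)"
  using assms(1)
proof (induction rule: gr_induct)
  case (hom p a)
  note a = hom gr_closed[OF hom]
  show ?case using assms(2)
  proof (induction rule: gr_induct)
    case (hom q b)
    note b = hom gr_closed[OF hom]
    show ?case using assms(3)
    proof (induction rule: gr_induct)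
      case (hom r c)
      note c = hom gr_closed[OF hom]
      have "b \<otimes>\<^bsub>A\<^esub> a \<in> gr A (q + p)" "c \<otimes>\<^bsub>A\<^esub> b \<in> gr A (r + q)" using a b c mult_degree by auto
      then show ?case
        using a b c by (simp add: op_mult op.sg_left op.sg_right mult_assoc algebra_simps)
    qed (use a b in \<open>simp add: op.add_right\<close>)
  qed (use a assms in \<open>simp add: op.add_left op.add_right\<close>)
qed (use assms in \<open>simp add: op.add_left\<close>)

lemma op_leibniz:
  assumes a: "a \<in> gr A p" and "b \<in> carrier A"
  shows "dif A (a \<otimes>\<^bsub>op_dg K A\<^esub> b) =
    dif A a \<otimes>\<^bsub>op_dg K A\<^esub> b \<oplus>\<^bsub>A\<^esub> sg A p (a \<otimes>\<^bsub>op_dg K A\<^esub> dif A b)"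
  using assms(2)
proof (induction rule: gr_induct)
  case (hom q b)
  note facts = a hom gr_closed[OF a] gr_closed[OF hom]
  have "dif A (a \<otimes>\<^bsub>op_dg K A\<^esub> b) =
      sg A (p * q) (dif A b \<otimes>\<^bsub>A\<^esub> a) \<oplus>\<^bsub>A\<^esub> sg A (p * q + q) (b \<otimes>\<^bsub>A\<^esub> dif A a)"
    using facts by (simp add: op_mult dif.sg mult_leibniz[OF hom] sg_add)
  moreover have "dif A a \<otimes>\<^bsub>op_dg K A\<^esub> b = sg A (p * q + q) (b \<otimes>\<^bsub>A\<^esub> dif A a)"
    using facts dif_degree[OF a] by (simp add: op_mult algebra_simps)
  moreover have "sg A p (a \<otimes>\<^bsub>op_dg K A\<^esub> dif A b) = sg A (p * q) (dif A b \<otimes>\<^bsub>A\<^esub> a)"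
    using facts dif_degree[OF hom] by (simp add: op_mult) (rule sg_cong, auto)
  ultimately show ?case using facts by (simp add: a_comm)
next
  case (add x y)
  then show ?case using gr_closed[OF a] by (simp add: op.add_right dif.add sg_add a_ac)
qed

lemma op_dg_algebra: "dg_algebra K (op_dg K A)"
proof (intro dg_algebra.intro dg_module.intro op_graded_module dg_module_axioms.intro
    dg_algebra_axioms.intro)
  show "linear_map K (op_dg K A) (op_dg K A) (dif (op_dg K A))"
    using dif_linear by (simp add: upd_linear[OF op_upd])
  show "bilinear_map K (op_dg K A) (op_dg K A) (op_dg K A) (monoid.mult (op_dg K A))"
    using op_bilinear by (simp add: bilinear_map_def upd_linear[OF op_upd])
  fix a b p q assume "a \<in> gr (op_dg K A) p" "b \<in> gr (op_dg K A) q"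
  then show "a \<otimes>\<^bsub>op_dg K A\<^esub> b \<in> gr (op_dg K A) (p + q)"
    using mult_degree[of b q a p] by (simp add: op_mult add.commute)
qed (use dif_degree dif_dif op_assoc op_leibniz in simp_all)

end

text \<open>
  The idempotents have degree 0, so passing to the opposite algebra only interchanges their left and
  right ideals.
\<close>

lemma (in dg_algebra_ei) op_dg_algebra_ei: "dg_algebra_ei K (op_dg K A)"
proof -
  interpret op: dg_algebra K "op_dg K A" by (rule op_dg_algebra)
  from enough_idempotents obtain E where E: "E \<subseteq> gr A 0" "\<And>e. e \<in> E \<Longrightarrow> e \<noteq> \<zero>\<^bsub>A\<^esub>"
    "\<And>e. e \<in> E \<Longrightarrow> e \<otimes>\<^bsub>A\<^esub> e = e" "\<And>e. e \<in> E \<Longrightarrow> dif A e = \<zero>\<^bsub>A\<^esub>"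
    "\<And>e f. e \<in> E \<Longrightarrow> f \<in> E \<Longrightarrow> e \<noteq> f \<Longrightarrow> e \<otimes>\<^bsub>A\<^esub> f = \<zero>\<^bsub>A\<^esub>"
    and dec: "internal_direct_sum A E (\<lambda>e. {e \<otimes>\<^bsub>A\<^esub> a |a. a \<in> carrier A})"
    "internal_direct_sum A E (\<lambda>e. {a \<otimes>\<^bsub>A\<^esub> e |a. a \<in> carrier A})" by blast
  have 0: "e \<in> gr A 0" "e \<in> carrier A" if "e \<in> E" for e using E(1) that gr_closed by blast+
  have left: "(\<Union>e\<in>E. {e \<otimes>\<^bsub>op_dg K A\<^esub> a |a. a \<in> carrier A}) = (\<Union>e\<in>E. {a \<otimes>\<^bsub>A\<^esub> e |a. a \<in> carrier A})"
    using op_unit_left[OF 0(1)] by (intro SUP_cong) (force, metis)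
  have right: "(\<Union>e\<in>E. {a \<otimes>\<^bsub>op_dg K A\<^esub> e |a. a \<in> carrier A}) = (\<Union>e\<in>E. {e \<otimes>\<^bsub>A\<^esub> a |a. a \<in> carrier A})"
    using op_unit_right[OF 0(1)] by (intro SUP_cong) (force, metis)
  show ?thesis
  proof (rule op.enough_idempotentsI[of E])
    show "x \<in> generate (add_monoid (op_dg K A)) (\<Union>e\<in>E. {e \<otimes>\<^bsub>op_dg K A\<^esub> a |a. a \<in> carrier (op_dg K A)})"
      if "x \<in> carrier (op_dg K A)" for x
      using generate_direct_sum[OF dec(2), of x] that by (simp add: left)
    show "x \<in> generate (add_monoid (op_dg K A)) (\<Union>e\<in>E. {a \<otimes>\<^bsub>op_dg K A\<^esub> e |a. a \<in> carrier (op_dg K A)})"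
      if "x \<in> carrier (op_dg K A)" for x
      using generate_direct_sum[OF dec(1), of x] that by (simp add: right)
    show "e \<otimes>\<^bsub>op_dg K A\<^esub> f = \<zero>\<^bsub>op_dg K A\<^esub>" if "e \<in> E" "f \<in> E" "e \<noteq> f" for e f
      using op_unit_left[OF 0(1)[OF that(1)] 0(2)[OF that(2)]] E(5)[OF that(2,1)] that(3) by simp
  qed (use E 0 op_unit_left in auto)
qed

section \<open>Tensor products of algebras\<close>

text \<open>
  Inserting the sign is linear in the bilinear map. This carries over the linear dependence on
  further arguments.
\<close>

lemma koszul_add:
  fixes P :: "('k, 'p) dg"
  assumes MNP: "graded_module K M" "graded_module K N" "k_module K P"
    and f: "bilinear_map K M N P f" and g: "bilinear_map K M N P g" and h: "bilinear_map K M N P h"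
    and eq: "\<And>x y. x \<in> carrier M \<Longrightarrow> y \<in> carrier N \<Longrightarrow> f x y = g x y \<oplus>\<^bsub>P\<^esub> h x y"
    and x: "x \<in> carrier M" and y: "y \<in> carrier N"
  shows "koszul M N P f x y = koszul M N P g x y \<oplus>\<^bsub>P\<^esub> koszul M N P h x y"
proof -
  interpret M: graded_module K M by fact
  interpret N: graded_module K N by fact
  interpret P: k_module K P by fact
  interpret g: bilin_map K M N P g by unfold_locales fact
  interpret h: bilin_map K M N P h by unfold_locales fact
  interpret f': bilin_map K M N P "koszul M N P f" by unfold_locales (rule koszul_bilinear[OF MNP f])
  interpret g': bilin_map K M N P "koszul M N P g" by unfold_locales (rule koszul_bilinear[OF MNP g])
  interpret h': bilin_map K M N P "koszul M N P h" by unfold_locales (rule koszul_bilinear[OF MNP h])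
  have sum: "bilin_map K M N P (\<lambda>x y. koszul M N P g x y \<oplus>\<^bsub>P\<^esub> koszul M N P h x y)"
    by unfold_locales (rule bilinear_mapI, simp_all add: g'.add_left h'.add_left g'.add_right
        h'.add_right g'.smult_left h'.smult_left g'.smult_right h'.smult_right P.smult_r_distr P.a_ac)
  show ?thesis
    by (rule bilinear_gr_eqI[OF MNP(1,2) f'.bilin_map_axioms sum _ x y])
      (simp add: koszul_homogeneous[OF MNP f] koszul_homogeneous[OF MNP g]
        koszul_homogeneous[OF MNP h] eq P.sg_add)
qed

lemma koszul_smult:
  fixes P :: "('k, 'p) dg"
  assumes MNP: "graded_module K M" "graded_module K N" "k_module K P"
    and f: "bilinear_map K M N P f" and g: "bilinear_map K M N P g" and k: "k \<in> carrier K"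
    and eq: "\<And>x y. x \<in> carrier M \<Longrightarrow> y \<in> carrier N \<Longrightarrow> f x y = k \<odot>\<^bsub>P\<^esub> g x y"
    and x: "x \<in> carrier M" and y: "y \<in> carrier N"
  shows "koszul M N P f x y = k \<odot>\<^bsub>P\<^esub> koszul M N P g x y"
proof -
  interpret M: graded_module K M by fact
  interpret N: graded_module K N by fact
  interpret P: k_module K P by fact
  interpret g: bilin_map K M N P g by unfold_locales fact
  interpret f': bilin_map K M N P "koszul M N P f" by unfold_locales (rule koszul_bilinear[OF MNP f])
  interpret g': bilin_map K M N P "koszul M N P g" by unfold_locales (rule koszul_bilinear[OF MNP g])
  have sc: "bilin_map K M N P (\<lambda>x y. k \<odot>\<^bsub>P\<^esub> koszul M N P g x y)"
  proof unfold_locales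
    show "bilinear_map K M N P (\<lambda>x y. k \<odot>\<^bsub>P\<^esub> koszul M N P g x y)"
      by (rule linear_map_bilinear[OF _ koszul_bilinear[OF MNP g]], rule linear_mapI)
        (use k in \<open>simp_all add: P.smult_r_distr P.smult_assoc1[symmetric] M.m_comm\<close>)
  qed
  show ?thesis
    by (rule bilinear_gr_eqI[OF MNP(1,2) f'.bilin_map_axioms sc _ x y])
      (simp add: koszul_homogeneous[OF MNP f] koszul_homogeneous[OF MNP g] eq k P.sg_smult)
qed

context tensor
begin

lemma lift_add:
  assumes P: "k_module K P" and f: "bilinear_map K M N P f" and g: "bilinear_map K M N P g"
    and h: "bilinear_map K M N P h"
    and eq: "\<And>x y. x \<in> carrier M \<Longrightarrow> y \<in> carrier N \<Longrightarrow> f x y = g x y \<oplus>\<^bsub>P\<^esub> h x y"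
    and t: "t \<in> carrier T"
  shows "lift P f t = lift P g t \<oplus>\<^bsub>P\<^esub> lift P h t"
proof -
  interpret P: k_module K P by fact
  interpret f: lin_map K T P "lift P f" by unfold_locales (rule lift_linear[OF P f])
  interpret g: lin_map K T P "lift P g" by unfold_locales (rule lift_linear[OF P g])
  interpret h: lin_map K T P "lift P h" by unfold_locales (rule lift_linear[OF P h])
  show ?thesis
    using t by (induction rule: pure_induct)
      (simp_all add: lift_pure[OF P f] lift_pure[OF P g] lift_pure[OF P h] eq f.add g.add h.add P.a_ac)
qed

lemma lift_smult:
  assumes P: "k_module K P" and f: "bilinear_map K M N P f" and g: "bilinear_map K M N P g"
    and k: "k \<in> carrier K"
    and eq: "\<And>x y. x \<in> carrier M \<Longrightarrow> y \<in> carrier N \<Longrightarrow> f x y = k \<odot>\<^bsub>P\<^esub> g x y"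
    and t: "t \<in> carrier T"
  shows "lift P f t = k \<odot>\<^bsub>P\<^esub> lift P g t"
proof -
  interpret P: k_module K P by fact
  interpret f: lin_map K T P "lift P f" by unfold_locales (rule lift_linear[OF P f])
  interpret g: lin_map K T P "lift P g" by unfold_locales (rule lift_linear[OF P g])
  show ?thesis
    using t by (induction rule: pure_induct)
      (simp_all add: lift_pure[OF P f] lift_pure[OF P g] eq f.add g.add k P.smult_r_distr)
qed

end

locale tensor_algebra = A: dg_algebra_ei K A + B: dg_algebra_ei K B
  for K :: "'k ring" and A :: "('k, 'a) dg" and B :: "('k, 'b) dg"
begin

sublocale graded_tensor K A B ..

abbreviation tensor_pure (infixl "\<diamondop>" 75) where "a \<diamondop> b \<equiv> pure K A B a b"

text \<open>
  The product of $a \otimes b$ and $a' \otimes b'$, with its sign. The sign depends on \<open>b\<close> and \<open>a'\<close>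
  only, in which the product is made bilinear first.
\<close>

definition mult4 where
  "mult4 a b a' b' = koszul B A T (\<lambda>b a'. (a \<otimes>\<^bsub>A\<^esub> a') \<diamondop> (b \<otimes>\<^bsub>B\<^esub> b')) b a'"

context
  fixes a b' assumes ab: "a \<in> carrier A" "b' \<in> carrier B"
begin

lemma mult4_pre: "bilinear_map K B A T (\<lambda>b a'. (a \<otimes>\<^bsub>A\<^esub> a') \<diamondop> (b \<otimes>\<^bsub>B\<^esub> b'))"
  by (rule bilinear_mapI) (simp_all add: ab A.mult.add_right B.mult.add_left pure.add_left
      pure.add_right A.mult.smult_right B.mult.smult_left pure.smult_left pure.smult_right)

lemmas mult4_bilinear =
  koszul_bilinear[OF B.graded_module_axioms A.graded_module_axioms T.k_module_axioms mult4_pre]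

lemma mult4_bilin_map: "bilin_map K B A T (\<lambda>b a'. mult4 a b a' b')"
  unfolding mult4_def by unfold_locales (rule mult4_bilinear)

lemma mult4_homogeneous:
  "b \<in> gr B p \<Longrightarrow> a' \<in> gr A q \<Longrightarrow> mult4 a b a' b' = sg T (p * q) ((a \<otimes>\<^bsub>A\<^esub> a') \<diamondop> (b \<otimes>\<^bsub>B\<^esub> b'))"
  unfolding mult4_def
  by (rule koszul_homogeneous[OF B.graded_module_axioms A.graded_module_axioms T.k_module_axioms mult4_pre])

end

lemmas mult4_addI = koszul_add[OF B.graded_module_axioms A.graded_module_axioms T.k_module_axioms
    mult4_pre mult4_pre mult4_pre]
lemmas mult4_smultI = koszul_smult[OF B.graded_module_axioms A.graded_module_axioms T.k_module_axioms
    mult4_pre mult4_pre]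

text \<open>
  The arguments \<open>a\<close> and \<open>b'\<close> do not enter the sign, hence are parameters of the bilinear map into
  which the sign is inserted.
\<close>

lemma mult4_outer:
  assumes "b \<in> carrier B" "a' \<in> carrier A"
  shows "bilinear_map K A B T (\<lambda>a b'. mult4 a b a' b')"
proof (rule bilinear_mapI)
  fix a b' assume "a \<in> carrier A" "b' \<in> carrier B"
  then show "mult4 a b a' b' \<in> carrier T" using bilin_map.closed[OF mult4_bilin_map] assms by blast
next
  fix a1 a2 b' assume "a1 \<in> carrier A" "a2 \<in> carrier A" "b' \<in> carrier B"
  then show "mult4 (a1 \<oplus>\<^bsub>A\<^esub> a2) b a' b' = mult4 a1 b a' b' \<oplus>\<^bsub>T\<^esub> mult4 a2 b a' b'"
    unfolding mult4_def using assms
    by (intro mult4_addI) (simp_all add: A.mult.add_left pure.add_left)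
next
  fix a b1 b2 assume "a \<in> carrier A" "b1 \<in> carrier B" "b2 \<in> carrier B"
  then show "mult4 a b a' (b1 \<oplus>\<^bsub>B\<^esub> b2) = mult4 a b a' b1 \<oplus>\<^bsub>T\<^esub> mult4 a b a' b2"
    unfolding mult4_def using assms
    by (intro mult4_addI) (simp_all add: B.mult.add_right pure.add_right)
next
  fix k a b' assume "k \<in> carrier K" "a \<in> carrier A" "b' \<in> carrier B"
  then show "mult4 (k \<odot>\<^bsub>A\<^esub> a) b a' b' = k \<odot>\<^bsub>T\<^esub> mult4 a b a' b'"
    "mult4 a b a' (k \<odot>\<^bsub>B\<^esub> b') = k \<odot>\<^bsub>T\<^esub> mult4 a b a' b'"
    unfolding mult4_def using assms
    by (intro mult4_smultI; simp add: A.mult.smult_left pure.smult_left B.mult.smult_right pure.smult_right)+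
qed

lemma mult4_right:
  assumes "a \<in> carrier A" "b \<in> carrier B"
  shows "bilinear_map K A B T (mult4 a b)"
proof (rule bilinear_mapI)
  fix a' b' assume *: "a' \<in> carrier A" "b' \<in> carrier B"
  interpret i: bilin_map K B A T "\<lambda>b a'. mult4 a b a' b'" by (rule mult4_bilin_map) fact+
  interpret o: bilin_map K A B T "\<lambda>a b'. mult4 a b a' b'" by unfold_locales (rule mult4_outer, fact+)
  show "mult4 a b a' b' \<in> carrier T" using * assms by simp
  show "mult4 a b (a' \<oplus>\<^bsub>A\<^esub> a'') b' = mult4 a b a' b' \<oplus>\<^bsub>T\<^esub> mult4 a b a'' b'" if "a'' \<in> carrier A" for a''
    using * assms that by (rule_tac i.add_right)
  show "mult4 a b a' (b' \<oplus>\<^bsub>B\<^esub> b'') = mult4 a b a' b' \<oplus>\<^bsub>T\<^esub> mult4 a b a' b''" if "b'' \<in> carrier B" for b''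
    using * assms that by (rule_tac o.add_right)
  show "mult4 a b (k \<odot>\<^bsub>A\<^esub> a') b' = k \<odot>\<^bsub>T\<^esub> mult4 a b a' b'" if "k \<in> carrier K" for k
    using * assms that by (rule_tac i.smult_right)
  show "mult4 a b a' (k \<odot>\<^bsub>B\<^esub> b') = k \<odot>\<^bsub>T\<^esub> mult4 a b a' b'" if "k \<in> carrier K" for k
    using * assms that by (rule_tac o.smult_right)
qed

lemma mult4_left:
  assumes "a' \<in> carrier A" "b' \<in> carrier B"
  shows "bilinear_map K A B T (\<lambda>a b. mult4 a b a' b')"
proof (rule bilinear_mapI)
  fix a b assume *: "a \<in> carrier A" "b \<in> carrier B"
  interpret i: bilin_map K B A T "\<lambda>b a'. mult4 a b a' b'" by (rule mult4_bilin_map) fact+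
  interpret o: bilin_map K A B T "\<lambda>a b'. mult4 a b a' b'" by unfold_locales (rule mult4_outer, fact+)
  show "mult4 a b a' b' \<in> carrier T" using * assms by simp
  show "mult4 (a \<oplus>\<^bsub>A\<^esub> a'') b a' b' = mult4 a b a' b' \<oplus>\<^bsub>T\<^esub> mult4 a'' b a' b'" if "a'' \<in> carrier A" for a''
    using * assms that by (rule_tac o.add_left)
  show "mult4 a (b \<oplus>\<^bsub>B\<^esub> b'') a' b' = mult4 a b a' b' \<oplus>\<^bsub>T\<^esub> mult4 a b'' a' b'" if "b'' \<in> carrier B" for b''
    using * assms that by (rule_tac i.add_left)
  show "mult4 (k \<odot>\<^bsub>A\<^esub> a) b a' b' = k \<odot>\<^bsub>T\<^esub> mult4 a b a' b'" if "k \<in> carrier K" for k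
    using * assms that by (rule_tac o.smult_left)
  show "mult4 a (k \<odot>\<^bsub>B\<^esub> b) a' b' = k \<odot>\<^bsub>T\<^esub> mult4 a b a' b'" if "k \<in> carrier K" for k
    using * assms that by (rule_tac i.smult_left)
qed

text \<open>
  The universal property applied twice: first to the right factor, for each pair \<open>a\<close>, \<open>b\<close>, then to
  the left factor.
\<close>

definition mult2 where
  "mult2 s t = lift T (\<lambda>a b. lift T (mult4 a b) t) s"

lemma mult2_pre:
  assumes t: "t \<in> carrier T"
  shows "bilinear_map K A B T (\<lambda>a b. lift T (mult4 a b) t)"
proof -
  note T = T.k_module_axioms
  note l = lift_add[OF T mult4_right mult4_right mult4_right]
    lift_smult[OF T mult4_right mult4_right]
  have L: "bilin_map K A B T (\<lambda>a b. mult4 a b a' b')" if "a' \<in> carrier A" "b' \<in> carrier B" for a' b'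
    by unfold_locales (rule mult4_left, fact+)
  note L = bilin_map.add_left[OF L] bilin_map.add_right[OF L] bilin_map.smult_left[OF L]
    bilin_map.smult_right[OF L]
  show ?thesis
  proof (rule bilinear_mapI)
    fix a b assume "a \<in> carrier A" "b \<in> carrier B"
    from lift_linear[OF T mult4_right[OF this]] show "lift T (mult4 a b) t \<in> carrier T"
      using t by (auto simp: linear_map_def hom_def)
  qed (rule l; use t in \<open>simp add: L\<close>)+
qed

lemma mult2_pure:
  "a \<in> carrier A \<Longrightarrow> b \<in> carrier B \<Longrightarrow> a' \<in> carrier A \<Longrightarrow> b' \<in> carrier B \<Longrightarrow>
    mult2 (a \<diamondop> b) (a' \<diamondop> b') = mult4 a b a' b'"
  unfolding mult2_def
  by (simp add: lift_pure[OF T.k_module_axioms mult2_pre] lift_pure[OF T.k_module_axioms mult4_right])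

lemma mult2_bilinear: "bilinear_map K T T T mult2"
  unfolding bilinear_map_def
proof (intro conjI ballI)
  fix t assume t: "t \<in> carrier T"
  show "linear_map K T T (\<lambda>s. mult2 s t)"
    unfolding mult2_def by (rule lift_linear[OF T.k_module_axioms mult2_pre[OF t]])
next
  fix s assume s: "s \<in> carrier T"
  have L: "lin_map K T T (lift T (mult4 a b))" if "a \<in> carrier A" "b \<in> carrier B" for a b
    by unfold_locales (rule lift_linear[OF T.k_module_axioms mult4_right[OF that]])
  show "linear_map K T T (mult2 s)"
  proof (rule linear_mapI)
    fix t t' assume t: "t \<in> carrier T" "t' \<in> carrier T"
    show "mult2 s t \<in> carrier T"
      using lift_linear[OF T.k_module_axioms mult2_pre[OF t(1)]] s
      unfolding mult2_def by (auto simp: linear_map_def hom_def)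
    show "mult2 s (t \<oplus>\<^bsub>T\<^esub> t') = mult2 s t \<oplus>\<^bsub>T\<^esub> mult2 s t'"
      unfolding mult2_def
      by (rule lift_add[OF T.k_module_axioms mult2_pre mult2_pre mult2_pre])
        (use s t lin_map.add[OF L] in simp_all)
    show "mult2 s (k \<odot>\<^bsub>T\<^esub> t) = k \<odot>\<^bsub>T\<^esub> mult2 s t" if "k \<in> carrier K" for k
      unfolding mult2_def
      by (rule lift_smult[OF T.k_module_axioms mult2_pre mult2_pre])
        (use s t that lin_map.smult[OF L] in simp_all)
  qed
qed

lemma bilinear_pure_eqI:
  fixes P :: "('k, 'p) dg"
  assumes f: "bilin_map K T T P f" and g: "bilin_map K T T P g"
    and eq: "\<And>a b a' b' p q p' q'. a \<in> gr A p \<Longrightarrow> b \<in> gr B q \<Longrightarrow> a' \<in> gr A p' \<Longrightarrow> b' \<in> gr B q' \<Longrightarrow>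
      f (a \<diamondop> b) (a' \<diamondop> b') = g (a \<diamondop> b) (a' \<diamondop> b')"
    and s: "s \<in> carrier T" and t: "t \<in> carrier T"
  shows "f s t = g s t"
  using s
proof (induction rule: homogeneous_pure_induct)
  case (pure p q a b)
  note ab = this
  have c: "a \<diamondop> b \<in> carrier T" using ab A.gr_closed B.gr_closed by simp
  show ?case using t
    by (induction rule: homogeneous_pure_induct)
      (simp_all add: eq[OF ab] bilin_map.add_right[OF f c] bilin_map.add_right[OF g c])
qed (use t in \<open>simp add: bilin_map.add_left[OF f] bilin_map.add_left[OF g]\<close>)

lemma tensor_mult_unique: "\<exists>!m. ext2 T T m \<and> bilinear_map K T T T m \<and>
    (\<forall>p q. \<forall>a\<in>carrier A. \<forall>b\<in>gr B p. \<forall>a'\<in>gr A q. \<forall>b'\<in>carrier B.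
      m (a \<diamondop> b) (a' \<diamondop> b') = sg T (p * q) ((a \<otimes>\<^bsub>A\<^esub> a') \<diamondop> (b \<otimes>\<^bsub>B\<^esub> b')))"
proof -
  interpret m: bilin_map K T T T mult2 by unfold_locales (rule mult2_bilinear)
  let ?m = "\<lambda>s t. if s \<in> carrier T \<and> t \<in> carrier T then mult2 s t else undefined"
  have m: "bilinear_map K T T T ?m"
    by (rule bilinear_mapI) (simp_all add: m.add_left m.add_right m.smult_left m.smult_right)
  show ?thesis
  proof (rule ex1I[of _ ?m])
    show "ext2 T T ?m \<and> bilinear_map K T T T ?m \<and>
      (\<forall>p q. \<forall>a\<in>carrier A. \<forall>b\<in>gr B p. \<forall>a'\<in>gr A q. \<forall>b'\<in>carrier B.
        ?m (a \<diamondop> b) (a' \<diamondop> b') = sg T (p * q) ((a \<otimes>\<^bsub>A\<^esub> a') \<diamondop> (b \<otimes>\<^bsub>B\<^esub> b')))"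
      using m by (auto simp: ext2_def mult2_pure mult4_homogeneous)
  next
    fix m' assume m': "ext2 T T m' \<and> bilinear_map K T T T m' \<and>
      (\<forall>p q. \<forall>a\<in>carrier A. \<forall>b\<in>gr B p. \<forall>a'\<in>gr A q. \<forall>b'\<in>carrier B.
        m' (a \<diamondop> b) (a' \<diamondop> b') = sg T (p * q) ((a \<otimes>\<^bsub>A\<^esub> a') \<diamondop> (b \<otimes>\<^bsub>B\<^esub> b')))"
    then interpret m': bilin_map K T T T m' by unfold_locales blast
    have "m' s t = mult2 s t" if "s \<in> carrier T" "t \<in> carrier T" for s t
      by (rule bilinear_pure_eqI[OF m'.bilin_map_axioms m.bilin_map_axioms _ that])
        (use m' in \<open>simp add: mult2_pure mult4_homogeneous\<close>)
    then show "m' = ?m" using m' by (auto simp: ext2_def fun_eq_iff)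
  qed
qed

lemma tensor_dif_unique: "\<exists>!D. D \<in> extensional (carrier T) \<and> linear_map K T T D \<and>
    (\<forall>p. \<forall>x\<in>gr A p. \<forall>y\<in>carrier B. D (x \<diamondop> y) = dif A x \<diamondop> y \<oplus>\<^bsub>T\<^esub> sg T p (x \<diamondop> dif B y))"
proof -
  define \<phi> where "\<phi> = (\<lambda>p (q :: int) x y. dif A x \<diamondop> y \<oplus>\<^bsub>T\<^esub> sg T p (x \<diamondop> dif B y))"
  interpret bigraded_family K A B T \<phi>
    by unfold_locales
      (auto simp: \<phi>_def linear_on_def pure.add_left pure.add_right pure.smult_left pure.smult_right
        A.dif.add B.dif.add A.dif.smult B.dif.smult T.sg_add T.sg_smult T.smult_r_distr T.a_ac)
  let ?b = "bigraded_ext A B T \<phi>"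
  interpret b: bilin_map K A B T ?b by unfold_locales (rule bilinear)
  let ?D = "restrict (lift T ?b) (carrier T)"
  interpret D: lin_map K T T "lift T ?b"
    by unfold_locales (rule lift_linear[OF T.k_module_axioms bilinear])
  have lin: "linear_map K T T ?D" by (rule linear_mapI) (simp_all add: D.add D.smult)
  have b: "?b x y = dif A x \<diamondop> y \<oplus>\<^bsub>T\<^esub> sg T p (x \<diamondop> dif B y)" if x: "x \<in> gr A p" and y: "y \<in> carrier B" for p x y
    using y
  proof (induction rule: B.gr_induct)
    case (hom q y)
    show ?case using homogeneous[OF x hom] by (simp add: \<phi>_def)
  next
    case (add y y')
    then show ?case using x A.gr_closed[OF x]
      by (simp add: b.add_right pure.add_right B.dif.add T.sg_add T.a_ac)
  qed
  show ?thesis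
  proof (rule ex1I[of _ ?D])
    show "?D \<in> extensional (carrier T) \<and> linear_map K T T ?D \<and>
      (\<forall>p. \<forall>x\<in>gr A p. \<forall>y\<in>carrier B. ?D (x \<diamondop> y) = dif A x \<diamondop> y \<oplus>\<^bsub>T\<^esub> sg T p (x \<diamondop> dif B y))"
      using lin by (auto simp: lift_pure[OF T.k_module_axioms bilinear] b)
  next
    fix D' assume D': "D' \<in> extensional (carrier T) \<and> linear_map K T T D' \<and>
      (\<forall>p. \<forall>x\<in>gr A p. \<forall>y\<in>carrier B. D' (x \<diamondop> y) = dif A x \<diamondop> y \<oplus>\<^bsub>T\<^esub> sg T p (x \<diamondop> dif B y))"
    interpret D': lin_map K T T D' by unfold_locales (use D' in blast)
    have "D' t = lift T ?b t" if "t \<in> carrier T" for t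
      using that
      by (induction rule: homogeneous_pure_induct)
        (use D' in \<open>simp_all add: lift_pure[OF T.k_module_axioms bilinear] b D.add D'.add\<close>)
    then show "D' = ?D" using D' by (auto simp: extensional_def fun_eq_iff)
  qed
qed

abbreviation "S \<equiv> tensor_dg K A B"

lemma S_upd: "S = T\<lparr>monoid.mult := tensor_mult K A B, dif := tensor_dif K A B\<rparr>"
  by (simp add: tensor_dg_def)

lemmas S_fields [simp] = upd_fields[OF S_upd]
lemmas S_sg [simp] = upd_sg[OF S_upd]

lemma S_mult [simp]: "monoid.mult S = tensor_mult K A B"
  and S_dif [simp]: "dif S = tensor_dif K A B"
  by (simp_all add: tensor_dg_def)

lemmas tensor_mult = theI'[OF tensor_mult_unique, folded tensor_mult_def[unfolded Let_def]]
lemmas tensor_dif = theI'[OF tensor_dif_unique, folded tensor_dif_def[unfolded Let_def]]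

abbreviation tensor_mult_syntax (infixl "\<cdot>" 70) where "s \<cdot> t \<equiv> tensor_mult K A B s t"
abbreviation "D \<equiv> tensor_dif K A B"

sublocale tm: bilin_map K T T T "tensor_mult K A B"
  by unfold_locales (use tensor_mult in blast)

sublocale td: lin_map K T T "tensor_dif K A B"
  by unfold_locales (use tensor_dif in blast)

lemma mult_pure: "a \<in> carrier A \<Longrightarrow> b \<in> gr B p \<Longrightarrow> a' \<in> gr A q \<Longrightarrow> b' \<in> carrier B \<Longrightarrow>
    (a \<diamondop> b) \<cdot> (a' \<diamondop> b') = sg T (p * q) ((a \<otimes>\<^bsub>A\<^esub> a') \<diamondop> (b \<otimes>\<^bsub>B\<^esub> b'))"
  using tensor_mult by blast

lemma dif_pure: "x \<in> gr A p \<Longrightarrow> y \<in> carrier B \<Longrightarrow>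
    D (x \<diamondop> y) = dif A x \<diamondop> y \<oplus>\<^bsub>T\<^esub> sg T p (x \<diamondop> dif B y)"
  using tensor_dif by blast

text \<open>
  If one of the two elements that are exchanged has degree 0, the other one may be inhomogeneous.
\<close>

lemma mult_pure_unit_left:
  assumes "a \<in> carrier A" "u \<in> gr B 0" "a' \<in> carrier A" "b' \<in> carrier B"
  shows "(a \<diamondop> u) \<cdot> (a' \<diamondop> b') = (a \<otimes>\<^bsub>A\<^esub> a') \<diamondop> (u \<otimes>\<^bsub>B\<^esub> b')"
  using assms(3)
  by (induction rule: A.gr_induct)
    (use assms B.gr_closed[OF assms(2)] in \<open>simp_all add: mult_pure pure.add_left A.mult.add_right tm.add_right\<close>)

lemma mult_pure_unit_right:
  assumes "a \<in> carrier A" "b \<in> carrier B" "u \<in> gr A 0" "b' \<in> carrier B"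
  shows "(a \<diamondop> b) \<cdot> (u \<diamondop> b') = (a \<otimes>\<^bsub>A\<^esub> u) \<diamondop> (b \<otimes>\<^bsub>B\<^esub> b')"
  using assms(2)
  by (induction rule: B.gr_induct)
    (use assms A.gr_closed[OF assms(3)] in \<open>simp_all add: mult_pure pure.add_right B.mult.add_left tm.add_left\<close>)

lemma S_graded_module: "graded_module K S"
  using T_graded upd_graded_module[OF S_upd] by blast

sublocale TG: graded_module K T
  by (rule T_graded)

lemma D_degree: "t \<in> gr T n \<Longrightarrow> D t \<in> gr T (n + 1)"
proof (induction rule: T_gr_induct)
  case (pure p q x y)
  have "dif A x \<diamondop> y \<in> gr T (p + 1 + q)" "x \<diamondop> dif B y \<in> gr T (p + (q + 1))"
    using pure A.dif_degree B.dif_degree by (auto intro!: pure_degree)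
  moreover have "p + 1 + q = n + 1" "p + (q + 1) = n + 1" using pure(3) by auto
  ultimately show ?case using pure by (simp add: dif_pure TG.gr_add)
qed (simp add: td.add TG.gr_add)

lemma D_D: "t \<in> carrier T \<Longrightarrow> D (D t) = \<zero>\<^bsub>T\<^esub>"
proof (induction rule: homogeneous_pure_induct)
  case (pure p q x y)
  note d = A.dif_degree[OF pure(1)] B.dif_degree[OF pure(2)]
  note facts = pure d A.gr_closed[OF pure(1)] B.gr_closed[OF pure(2)] A.gr_closed[OF d(1)] B.gr_closed[OF d(2)]
  have "D (D (x \<diamondop> y)) = sg T (p + 1) (dif A x \<diamondop> dif B y) \<oplus>\<^bsub>T\<^esub> sg T p (dif A x \<diamondop> dif B y)"
    using facts by (simp add: dif_pure td.add td.sg A.dif_dif B.dif_dif)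
  then show ?case using facts by (simp add: sg_def T.l_neg T.r_neg)
qed (simp add: td.add)

lemma mult_degree_T:
  assumes s: "s \<in> gr T m" and t: "t \<in> gr T n"
  shows "s \<cdot> t \<in> gr T (m + n)"
  using s
proof (induction rule: T_gr_induct)
  case (pure p q a b)
  note ab = this A.gr_closed[OF this(1)] B.gr_closed[OF this(2)]
  show ?case using t
  proof (induction rule: T_gr_induct)
    case (pure p' q' a' b')
    have "(a \<otimes>\<^bsub>A\<^esub> a') \<diamondop> (b \<otimes>\<^bsub>B\<^esub> b') \<in> gr T ((p + p') + (q + q'))"
      by (rule pure_degree[OF A.mult_degree B.mult_degree]) fact+
    moreover have "(p + p') + (q + q') = m + n" using ab pure by simp
    ultimately show ?case using ab pure by (simp add: mult_pure)
  qed (use ab in \<open>simp add: tm.add_right TG.gr_add\<close>)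
qed (use TG.gr_closed[OF t] in \<open>simp add: tm.add_left TG.gr_add\<close>)

lemma mult_assoc_T:
  assumes "s \<in> carrier T" "t \<in> carrier T" "u \<in> carrier T"
  shows "(s \<cdot> t) \<cdot> u = s \<cdot> (t \<cdot> u)"
  using assms(1)
proof (induction rule: homogeneous_pure_induct)
  case (pure p q a b)
  note 1 = pure A.gr_closed[OF pure(1)] B.gr_closed[OF pure(2)]
  show ?case using assms(2)
  proof (induction rule: homogeneous_pure_induct)
    case (pure p' q' a' b')
    note 2 = pure A.gr_closed[OF pure(1)] B.gr_closed[OF pure(2)]
    show ?case using assms(3)
    proof (induction rule: homogeneous_pure_induct)
      case (pure p'' q'' a'' b'')
      note 3 = pure A.gr_closed[OF pure(1)] B.gr_closed[OF pure(2)]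
      have d: "b \<otimes>\<^bsub>B\<^esub> b' \<in> gr B (q + q')" "a' \<otimes>\<^bsub>A\<^esub> a'' \<in> gr A (p' + p'')"
        using 1 2 3 A.mult_degree B.mult_degree by auto
      show ?case
        using 1 2 3 d by (simp add: mult_pure tm.sg_left tm.sg_right A.mult_assoc B.mult_assoc algebra_simps)
    qed (use 1 2 in \<open>simp add: tm.add_right\<close>)
  qed (use 1 assms in \<open>simp add: tm.add_left tm.add_right\<close>)
qed (use assms in \<open>simp add: tm.add_left\<close>)

text \<open>
  Both sides are sums of the four terms in which the differential hits \<open>a\<close>, \<open>a'\<close>, \<open>b\<close> or \<open>b'\<close>.
\<close>

lemma leibniz_T:
  assumes s: "s \<in> gr T n" and t: "t \<in> carrier T"
  shows "D (s \<cdot> t) = D s \<cdot> t \<oplus>\<^bsub>T\<^esub> sg T n (s \<cdot> D t)"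
  using s
proof (induction rule: T_gr_induct)
  case (pure p q a b)
  note d1 = A.dif_degree[OF pure(1)] B.dif_degree[OF pure(2)]
  note 1 = pure d1 A.gr_closed[OF pure(1)] B.gr_closed[OF pure(2)] A.gr_closed[OF d1(1)] B.gr_closed[OF d1(2)]
  show ?case using t
  proof (induction rule: homogeneous_pure_induct)
    case (pure p' q' a' b')
    note d2 = A.dif_degree[OF pure(1)] B.dif_degree[OF pure(2)]
    note 2 = pure d2 A.gr_closed[OF pure(1)] B.gr_closed[OF pure(2)] A.gr_closed[OF d2(1)] B.gr_closed[OF d2(2)]
    have d: "a \<otimes>\<^bsub>A\<^esub> a' \<in> gr A (p + p')" using 1 2 A.mult_degree by auto
    let ?w = "(dif A a \<otimes>\<^bsub>A\<^esub> a') \<diamondop> (b \<otimes>\<^bsub>B\<^esub> b')" and ?x = "(a \<otimes>\<^bsub>A\<^esub> dif A a') \<diamondop> (b \<otimes>\<^bsub>B\<^esub> b')"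
    let ?y = "(a \<otimes>\<^bsub>A\<^esub> a') \<diamondop> (dif B b \<otimes>\<^bsub>B\<^esub> b')" and ?z = "(a \<otimes>\<^bsub>A\<^esub> a') \<diamondop> (b \<otimes>\<^bsub>B\<^esub> dif B b')"
    let ?k = "q * p'"
    have "D ((a \<diamondop> b) \<cdot> (a' \<diamondop> b')) = (sg T ?k ?w \<oplus>\<^bsub>T\<^esub> sg T (?k + p) ?x) \<oplus>\<^bsub>T\<^esub>
        (sg T (?k + (p + p')) ?y \<oplus>\<^bsub>T\<^esub> sg T (?k + (p + p') + q) ?z)"
      using 1 2 d by (simp add: mult_pure td.sg dif_pure A.mult_leibniz[OF 1(1)] B.mult_leibniz[OF 1(2)]
          pure.add_left pure.add_right pure.sg_left pure.sg_right T.sg_add add.assoc)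
    moreover have "D (a \<diamondop> b) \<cdot> (a' \<diamondop> b') = sg T ?k ?w \<oplus>\<^bsub>T\<^esub> sg T (?k + (p + p')) ?y"
      using 1 2 by (simp add: dif_pure tm.add_left tm.sg_left mult_pure algebra_simps)
    moreover have "sg T n ((a \<diamondop> b) \<cdot> D (a' \<diamondop> b')) = sg T (?k + p) ?x \<oplus>\<^bsub>T\<^esub> sg T (?k + (p + p') + q) ?z"
    proof -
      have n: "n = p + q" using 1(3) by simp
      have "sg T n ((a \<diamondop> b) \<cdot> D (a' \<diamondop> b')) = sg T (n + q * (p' + 1)) ?x \<oplus>\<^bsub>T\<^esub> sg T (n + (p' + ?k)) ?z"
        using 1 2 by (simp add: dif_pure tm.add_right tm.sg_right mult_pure T.sg_add)
      also have "sg T (n + q * (p' + 1)) ?x = sg T (?k + p) ?x"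
        by (intro sg_cong) (auto simp: n)
      also have "sg T (n + (p' + ?k)) ?z = sg T (?k + (p + p') + q) ?z"
        by (simp add: n algebra_simps)
      finally show ?thesis .
    qed
    ultimately show ?case using 1 2 by (simp add: T.a_ac)
  next
    case (add u v)
    then show ?case using 1
      by (simp add: tm.add_right td.add T.sg_add T.a_ac)
  qed
next
  case (add u v)
  then show ?case using t by (simp add: tm.add_left td.add T.sg_add T.a_ac)
qed

lemma S_dg_algebra: "dg_algebra K S"
proof (intro dg_algebra.intro dg_module.intro S_graded_module dg_module_axioms.intro
    dg_algebra_axioms.intro)
  show "linear_map K S S (dif S)"
    using td.lin by (simp add: upd_linear[OF S_upd])
  show "bilinear_map K S S S (monoid.mult S)"
    using tm.bilin by (simp add: bilinear_map_def upd_linear[OF S_upd])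
qed (use D_degree D_D mult_assoc_T mult_degree_T leibniz_T in simp_all)

text \<open>The products \<open>e \<otimes> f\<close> of idempotents are orthogonal idempotents; those that vanish are discarded.\<close>

lemma S_dg_algebra_ei: "dg_algebra_ei K S"
proof -
  interpret S: dg_algebra K S by (rule S_dg_algebra)
  from A.enough_idempotents obtain EA where EA: "EA \<subseteq> gr A 0"
    "\<And>e. e \<in> EA \<Longrightarrow> e \<otimes>\<^bsub>A\<^esub> e = e" "\<And>e. e \<in> EA \<Longrightarrow> dif A e = \<zero>\<^bsub>A\<^esub>"
    "\<And>e f. e \<in> EA \<Longrightarrow> f \<in> EA \<Longrightarrow> e \<noteq> f \<Longrightarrow> e \<otimes>\<^bsub>A\<^esub> f = \<zero>\<^bsub>A\<^esub>"
    and decA: "internal_direct_sum A EA (\<lambda>e. {e \<otimes>\<^bsub>A\<^esub> a |a. a \<in> carrier A})"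
    "internal_direct_sum A EA (\<lambda>e. {a \<otimes>\<^bsub>A\<^esub> e |a. a \<in> carrier A})" by blast
  from B.enough_idempotents obtain EB where EB: "EB \<subseteq> gr B 0"
    "\<And>e. e \<in> EB \<Longrightarrow> e \<otimes>\<^bsub>B\<^esub> e = e" "\<And>e. e \<in> EB \<Longrightarrow> dif B e = \<zero>\<^bsub>B\<^esub>"
    "\<And>e f. e \<in> EB \<Longrightarrow> f \<in> EB \<Longrightarrow> e \<noteq> f \<Longrightarrow> e \<otimes>\<^bsub>B\<^esub> f = \<zero>\<^bsub>B\<^esub>"
    and decB: "internal_direct_sum B EB (\<lambda>e. {e \<otimes>\<^bsub>B\<^esub> a |a. a \<in> carrier B})"
    "internal_direct_sum B EB (\<lambda>e. {a \<otimes>\<^bsub>B\<^esub> e |a. a \<in> carrier B})" by blast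
  have 0: "e \<in> gr A 0" "e \<in> carrier A" if "e \<in> EA" for e using EA(1) A.gr_closed that by blast+
  have 1: "f \<in> gr B 0" "f \<in> carrier B" if "f \<in> EB" for f using EB(1) B.gr_closed that by blast+
  define E where "E = {e \<diamondop> f |e f. e \<in> EA \<and> f \<in> EB} - {\<zero>\<^bsub>T\<^esub>}"
  have EE: "(e \<diamondop> f) \<cdot> (e' \<diamondop> f') = (e \<otimes>\<^bsub>A\<^esub> e') \<diamondop> (f \<otimes>\<^bsub>B\<^esub> f')"
    if "e \<in> EA" "f \<in> EB" "e' \<in> EA" "f' \<in> EB" for e f e' f'
    using that by (simp add: mult_pure_unit_left 0 1)
  have Ec: "e \<in> carrier T" if "e \<in> E" for e using that 0 1 by (auto simp: E_def)
  have reduce: "x \<in> generate (add_monoid T) R"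
    if x: "x \<in> carrier T" and R: "R \<subseteq> carrier T"
      and XY: "\<And>a. a \<in> carrier A \<Longrightarrow> a \<in> generate (add_monoid A) X" "X \<subseteq> carrier A"
        "\<And>b. b \<in> carrier B \<Longrightarrow> b \<in> generate (add_monoid B) Y" "Y \<subseteq> carrier B"
      and base: "\<And>a b. a \<in> X \<Longrightarrow> b \<in> Y \<Longrightarrow> a \<diamondop> b \<in> generate (add_monoid T) R" for x X Y R
    using x
  proof (induction rule: pure_induct)
    case (pure a b)
    have P: "{a \<diamondop> b |a b. a \<in> X \<and> b \<in> Y} \<subseteq> carrier T" using XY(2,4) pure_closed by blast
    show ?case using pure_generate[OF XY(1)[OF pure(1)] XY(2) XY(3)[OF pure(2)] XY(4)]
    proof (induction rule: T.generator_induct)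
      case (gen s)
      then show ?case using base by blast
    next
      case (minus s)
      then obtain a b where "s = a \<diamondop> b" "a \<in> X" "b \<in> Y" by blast
      then show ?case using T.generate_minus[OF R base] by simp
    qed (rule P, rule T.generate_zero, rule T.generate_add)
  qed (simp add: T.generate_add)
  have left: "x \<in> generate (add_monoid T) (\<Union>e\<in>E. {e \<cdot> t |t. t \<in> carrier T})" (is "_ \<in> generate _ ?L")
    if x: "x \<in> carrier T" for x
  proof (rule reduce[OF x _ A.generate_direct_sum[OF decA(1)] _ B.generate_direct_sum[OF decB(1)]])
    fix a' b' assume "a' \<in> (\<Union>e\<in>EA. {e \<otimes>\<^bsub>A\<^esub> a |a. a \<in> carrier A})"
      "b' \<in> (\<Union>f\<in>EB. {f \<otimes>\<^bsub>B\<^esub> b |b. b \<in> carrier B})"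
    then obtain e a f b where ef: "e \<in> EA" "f \<in> EB" and ab: "a \<in> carrier A" "b \<in> carrier B"
      and a'b': "a' = e \<otimes>\<^bsub>A\<^esub> a" "b' = f \<otimes>\<^bsub>B\<^esub> b" by blast
    have eq: "a' \<diamondop> b' = (e \<diamondop> f) \<cdot> (a \<diamondop> b)"
      using ef ab 0 1 unfolding a'b' by (simp add: mult_pure_unit_left)
    have c: "a \<diamondop> b \<in> carrier T" using ab by simp
    show "a' \<diamondop> b' \<in> generate (add_monoid T) ?L"
    proof (cases "e \<diamondop> f = \<zero>\<^bsub>T\<^esub>")
      case True
      then show ?thesis unfolding eq True using c by (simp only: tm.zero_left T.generate_zero)
    next
      case False
      then have "e \<diamondop> f \<in> E" using ef unfolding E_def by blast
      then show ?thesis unfolding eq using c by (intro T.generate_incl) blast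
    qed
  qed (use Ec 0 1 in auto)
  have right: "x \<in> generate (add_monoid T) (\<Union>e\<in>E. {t \<cdot> e |t. t \<in> carrier T})" (is "_ \<in> generate _ ?R")
    if x: "x \<in> carrier T" for x
  proof (rule reduce[OF x _ A.generate_direct_sum[OF decA(2)] _ B.generate_direct_sum[OF decB(2)]])
    fix a' b' assume "a' \<in> (\<Union>e\<in>EA. {a \<otimes>\<^bsub>A\<^esub> e |a. a \<in> carrier A})"
      "b' \<in> (\<Union>f\<in>EB. {b \<otimes>\<^bsub>B\<^esub> f |b. b \<in> carrier B})"
    then obtain e a f b where ef: "e \<in> EA" "f \<in> EB" and ab: "a \<in> carrier A" "b \<in> carrier B"
      and a'b': "a' = a \<otimes>\<^bsub>A\<^esub> e" "b' = b \<otimes>\<^bsub>B\<^esub> f" by blast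
    have eq: "a' \<diamondop> b' = (a \<diamondop> b) \<cdot> (e \<diamondop> f)"
      using ef ab 0 1 unfolding a'b' by (simp add: mult_pure_unit_right)
    have c: "a \<diamondop> b \<in> carrier T" using ab by simp
    show "a' \<diamondop> b' \<in> generate (add_monoid T) ?R"
    proof (cases "e \<diamondop> f = \<zero>\<^bsub>T\<^esub>")
      case True
      then show ?thesis unfolding eq True using c by (simp only: tm.zero_right T.generate_zero)
    next
      case False
      then have "e \<diamondop> f \<in> E" using ef unfolding E_def by blast
      then show ?thesis unfolding eq using c by (intro T.generate_incl) blast
    qed
  qed (use Ec 0 1 in auto)
  show ?thesis
  proof (rule S.enough_idempotentsI[of E])
    show "E \<subseteq> gr S 0"
    proof
      fix x assume "x \<in> E"
      then obtain e f where "e \<in> EA" "f \<in> EB" "x = e \<diamondop> f" by (auto simp: E_def)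
      then show "x \<in> gr S 0" using pure_degree[of e 0 f 0] 0 1 by simp
    qed
    show "e \<otimes>\<^bsub>S\<^esub> e = e" if "e \<in> E" for e using that EA(2) EB(2) by (auto simp: E_def EE)
    show "dif S x = \<zero>\<^bsub>S\<^esub>" if x: "x \<in> E" for x
    proof -
      obtain e f where "e \<in> EA" "f \<in> EB" "x = e \<diamondop> f" using x unfolding E_def by blast
      then show ?thesis using EA(3) EB(3) 0 1 by (simp add: dif_pure[of e 0])
    qed
    show "x \<otimes>\<^bsub>S\<^esub> y = \<zero>\<^bsub>S\<^esub>" if xy: "x \<in> E" "y \<in> E" "x \<noteq> y" for x y
    proof -
      obtain e f e' f' where "e \<in> EA" "f \<in> EB" "x = e \<diamondop> f" "e' \<in> EA" "f' \<in> EB" "y = e' \<diamondop> f'"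
        using xy(1,2) by (auto simp: E_def)
      moreover from this have "e \<noteq> e' \<or> f \<noteq> f'" using xy(3) by auto
      ultimately show ?thesis using EA(4) EB(4) 0 1 by (auto simp: EE)
    qed
    show "x \<in> generate (add_monoid S) (\<Union>e\<in>E. {e \<otimes>\<^bsub>S\<^esub> a |a. a \<in> carrier S})" if "x \<in> carrier S" for x
      using left[of x] that by simp
    show "x \<in> generate (add_monoid S) (\<Union>e\<in>E. {a \<otimes>\<^bsub>S\<^esub> e |a. a \<in> carrier S})" if "x \<in> carrier S" for x
      using right[of x] that by simp
  qed (auto simp: E_def)
qed

end

section \<open>Modules over an anti-isomorphic algebra\<close>

context graded_left_module
begin

sublocale act: bilin_map K A M M l
  by unfold_locales (rule left_bilinear)

lemma left_generators: "{l a x |a x. a \<in> carrier A \<and> x \<in> carrier M} \<subseteq> carrier M"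
  by auto

lemma left_induct [consumes 1, case_names act add]:
  assumes x: "x \<in> carrier M"
    and act: "\<And>a x. a \<in> carrier A \<Longrightarrow> x \<in> carrier M \<Longrightarrow> P (l a x)"
    and add: "\<And>x y. x \<in> carrier M \<Longrightarrow> y \<in> carrier M \<Longrightarrow> P x \<Longrightarrow> P y \<Longrightarrow> P (x \<oplus>\<^bsub>M\<^esub> y)"
  shows "P x"
proof -
  have "x \<in> generate (add_monoid M) {l a x |a x. a \<in> carrier A \<and> x \<in> carrier M}"
    using x left_unitary by simp
  then show ?thesis
  proof (induction rule: M.generator_induct_neg)
  case (neg s)
  then obtain a x where "a \<in> carrier A" "x \<in> carrier M" "s = l a x" by blast
  then show ?case using act.minus_left[of a x] by (auto intro!: exI[of _ "\<ominus>\<^bsub>A\<^esub> a"] exI[of _ x])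
next
  case zero
  show ?case using act[of "\<zero>\<^bsub>A\<^esub>" "\<zero>\<^bsub>M\<^esub>"] by simp
  qed (use assms left_generators in auto)
qed

lemma eventually_left_unit:
  assumes "x \<in> carrier M"
  shows "\<forall>\<^sub>F u in unit_filter. u \<in> gr A 0 \<and> dif A u = \<zero>\<^bsub>A\<^esub> \<and> l u x = x"
  using assms
proof (induction rule: left_induct)
  case (act a x)
  from eventually_unit[OF act(1)] show ?case
    by eventually_elim (use act left_assoc[symmetric] in auto)
next
  case (add x y)
  from add(3,4) show ?case by eventually_elim (use add in \<open>auto simp: act.add_right dest: gr_closed\<close>)
qed

end

context graded_right_module
begin

sublocale act: bilin_map K M A M r
  by unfold_locales (rule right_bilinear)

lemma right_generators: "{r x a |x a. x \<in> carrier M \<and> a \<in> carrier A} \<subseteq> carrier M"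
  by auto

lemma right_induct [consumes 1, case_names act add]:
  assumes x: "x \<in> carrier M"
    and act: "\<And>a x. a \<in> carrier A \<Longrightarrow> x \<in> carrier M \<Longrightarrow> P (r x a)"
    and add: "\<And>x y. x \<in> carrier M \<Longrightarrow> y \<in> carrier M \<Longrightarrow> P x \<Longrightarrow> P y \<Longrightarrow> P (x \<oplus>\<^bsub>M\<^esub> y)"
  shows "P x"
proof -
  have "x \<in> generate (add_monoid M) {r x a |x a. x \<in> carrier M \<and> a \<in> carrier A}"
    using x right_unitary by simp
  then show ?thesis
  proof (induction rule: M.generator_induct_neg)
  case (neg s)
  then obtain a x where "a \<in> carrier A" "x \<in> carrier M" "s = r x a" by blast
  then show ?case using act.minus_left[of x a] by (auto intro!: exI[of _ "\<ominus>\<^bsub>M\<^esub> x"] exI[of _ a])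
next
  case zero
  show ?case using act[of "\<zero>\<^bsub>A\<^esub>" "\<zero>\<^bsub>M\<^esub>"] by simp
  qed (use assms right_generators in auto)
qed

lemma eventually_right_unit:
  assumes "x \<in> carrier M"
  shows "\<forall>\<^sub>F u in unit_filter. u \<in> gr A 0 \<and> dif A u = \<zero>\<^bsub>A\<^esub> \<and> r x u = x"
  using assms
proof (induction rule: right_induct)
  case (act a x)
  from eventually_unit[OF act(1)] show ?case
    by eventually_elim (use act right_assoc[symmetric] in auto)
next
  case (add x y)
  from add(3,4) show ?case
    by eventually_elim (use add in \<open>auto simp: act.add_left dest: gr_closed\<close>)
qed

end

text \<open>
  Along an antihomomorphism \<open>\<phi>\<close>, with the sign for exchanging factors, right modules become left
  modules by $t x = (-1)^{|t||x|} x \phi(t)$, and left modules right modules. Surjectivity keeps the actions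
  unitary.
\<close>

locale dg_antihom = T: dg_algebra_ei K T + S: dg_algebra_ei K S
  for K :: "'k ring" and T :: "('k, 't) dg" and S :: "('k, 's) dg" and \<phi> +
  assumes \<phi>_linear: "linear_map K T S \<phi>"
    and \<phi>_degree: "t \<in> gr T n \<Longrightarrow> \<phi> t \<in> gr S n"
    and \<phi>_mult: "t \<in> gr T p \<Longrightarrow> t' \<in> gr T q \<Longrightarrow> \<phi> (t \<otimes>\<^bsub>T\<^esub> t') = sg S (p * q) (\<phi> t' \<otimes>\<^bsub>S\<^esub> \<phi> t)"
    and \<phi>_dif: "t \<in> carrier T \<Longrightarrow> \<phi> (dif T t) = dif S (\<phi> t)"
    and \<phi>_surj: "\<phi> ` carrier T = carrier S"
begin

sublocale phi: lin_map K T S \<phi>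
  by unfold_locales (rule \<phi>_linear)

definition left_action :: "('k, 'm) dg \<Rightarrow> ('m \<Rightarrow> 's \<Rightarrow> 'm) \<Rightarrow> 't \<Rightarrow> 'm \<Rightarrow> 'm" where
  "left_action M \<rho> t x = (if t \<in> carrier T \<and> x \<in> carrier M
     then koszul T M M (\<lambda>t x. \<rho> x (\<phi> t)) t x else undefined)"

definition right_action :: "('k, 'm) dg \<Rightarrow> ('s \<Rightarrow> 'm \<Rightarrow> 'm) \<Rightarrow> 'm \<Rightarrow> 't \<Rightarrow> 'm" where
  "right_action M \<mu> x t = (if x \<in> carrier M \<and> t \<in> carrier T
     then koszul M T M (\<lambda>x t. \<mu> (\<phi> t) x) x t else undefined)"

lemma left_action_bilinear_homogeneous:
  fixes M :: "('k, 'm) dg"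
  assumes "graded_right_module K S M \<rho>"
  shows left_action_bilinear: "bilinear_map K T M M (left_action M \<rho>)"
    and left_action_homogeneous:
      "t \<in> gr T p \<Longrightarrow> x \<in> gr M q \<Longrightarrow> left_action M \<rho> t x = sg M (p * q) (\<rho> x (\<phi> t))"
proof -
  interpret R: graded_right_module K S M \<rho> by fact
  have pre: "bilinear_map K T M M (\<lambda>t x. \<rho> x (\<phi> t))"
    by (rule bilinear_mapI) (simp_all add: R.act.add_left R.act.add_right R.act.smult_left
        R.act.smult_right phi.add phi.smult)
  note facts = T.graded_module_axioms R.M.graded_module_axioms R.M.k_module_axioms pre
  interpret k: bilin_map K T M M "koszul T M M (\<lambda>t x. \<rho> x (\<phi> t))"
    by unfold_locales (rule koszul_bilinear[OF facts])
  show "bilinear_map K T M M (left_action M \<rho>)"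
    by (rule bilinear_mapI)
      (simp_all add: left_action_def k.add_left k.add_right k.smult_left k.smult_right)
  show "left_action M \<rho> t x = sg M (p * q) (\<rho> x (\<phi> t))" if "t \<in> gr T p" "x \<in> gr M q"
    unfolding left_action_def using that koszul_homogeneous[OF facts that] by simp
qed

lemma left_action_graded_module:
  fixes M :: "('k, 'm) dg"
  assumes \<rho>: "graded_right_module K S M \<rho>"
  shows "graded_left_module K T M (left_action M \<rho>)"
proof -
  interpret R: graded_right_module K S M \<rho> by fact
  let ?l = "left_action M \<rho>"
  note hom_eq = left_action_homogeneous[OF \<rho>]
  interpret l: bilin_map K T M M ?l by unfold_locales (rule left_action_bilinear[OF \<rho>])
  have degree: "?l a x \<in> gr M (p + q)" if "a \<in> gr T p" "x \<in> gr M q" for a x p q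
    using R.right_degree[OF that(2) \<phi>_degree[OF that(1)]] by (simp add: hom_eq[OF that] add.commute)
  \<comment> \<open>The two actions have the same products of homogeneous elements up to sign, hence span the same.\<close>
  have gen: "\<rho> x s \<in> generate (add_monoid M) {?l t x |t x. t \<in> carrier T \<and> x \<in> carrier M}"
    (is "_ \<in> ?G") if x: "x \<in> carrier M" and s: "s \<in> carrier S" for x s
  proof -
    obtain t where t: "t \<in> carrier T" "s = \<phi> t" using s \<phi>_surj by blast
    show ?thesis unfolding t(2) using t(1)
    proof (induction rule: T.gr_induct)
      case (hom p t)
      note t = hom T.gr_closed[OF hom]
      show ?case using x
      proof (induction rule: R.M.gr_induct)
        case (hom q x)
        note x = hom R.M.gr_closed[OF hom]
        have "\<rho> x (\<phi> t) = ?l (sg T (p * q) t) x"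
          using t x by (simp add: l.sg_left hom_eq)
        moreover have "sg T (p * q) t \<in> carrier T" using t by simp
        ultimately show ?case using x by (intro R.M.generate_incl) blast
      qed (use t in \<open>simp add: R.act.add_left R.M.generate_add\<close>)
    qed (use x in \<open>simp add: phi.add R.act.add_right R.M.generate_add\<close>)
  qed
  have assoc: "?l (a \<otimes>\<^bsub>T\<^esub> b) x = ?l a (?l b x)"
    if abx: "a \<in> carrier T" "b \<in> carrier T" "x \<in> carrier M" for a b x
    using abx(1)
  proof (induction rule: T.gr_induct)
    case (hom p a)
    note a = hom T.gr_closed[OF hom]
    show ?case using abx(2)
    proof (induction rule: T.gr_induct)
      case (hom q b)
      note b = hom T.gr_closed[OF hom]
      show ?case using abx(3)
      proof (induction rule: R.M.gr_induct)
        case (hom s x)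
        note x = hom R.M.gr_closed[OF hom]
        note d = T.mult_degree[OF a(1) b(1)] R.right_degree[OF x(1) \<phi>_degree[OF b(1)]]
        have "?l (a \<otimes>\<^bsub>T\<^esub> b) x = sg M ((p + q) * s + p * q) (\<rho> (\<rho> x (\<phi> b)) (\<phi> a))"
          using a b x d
          by (simp add: hom_eq[OF d(1)] \<phi>_mult R.act.sg_right flip: R.right_assoc)
        moreover have "?l a (?l b x) = sg M (q * s + p * (s + q)) (\<rho> (\<rho> x (\<phi> b)) (\<phi> a))"
          using a b x d by (simp add: hom_eq[OF b(1) x(1)] l.sg_right hom_eq[OF a(1) d(2)])
        ultimately show ?case by (simp add: algebra_simps)
      qed (use a b in \<open>simp add: l.add_right\<close>)
    qed (use a abx in \<open>simp add: l.add_left l.add_right T.mult.add_right\<close>)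
  qed (use abx in \<open>simp add: l.add_left T.mult.add_left\<close>)
  have sub: "{?l t x |t x. t \<in> carrier T \<and> x \<in> carrier M} \<subseteq> carrier M" by auto
  have "x \<in> ?G" if "x \<in> carrier M" for x
    using that by (induction rule: R.right_induct) (simp_all add: gen R.M.generate_add)
  then have unitary: "?G = carrier M" using R.M.generate_closed[OF sub] by blast
  show ?thesis
    by (intro graded_left_module.intro graded_left_module_axioms.intro T.dg_algebra_ei_axioms
        R.M.graded_module_axioms l.bilin assoc degree unitary)
      (simp_all add: ext2_def left_action_def)
qed

lemma left_action_dg_module:
  fixes M :: "('k, 'm) dg"
  assumes "right_dg_module K S M \<rho>"
  shows "left_dg_module K T M (left_action M \<rho>)"
proof -
  interpret R: right_dg_module K S M \<rho> by fact
  have \<rho>: "graded_right_module K S M \<rho>" ..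
  let ?l = "left_action M \<rho>"
  note hom_eq = left_action_homogeneous[OF \<rho>]
  interpret L: graded_left_module K T M ?l by (rule left_action_graded_module[OF \<rho>])
  have "dif M (?l a x) = ?l (dif T a) x \<oplus>\<^bsub>M\<^esub> sg M p (?l a (dif M x))"
    if a: "a \<in> gr T p" and x: "x \<in> carrier M" for a x p
    using x
  proof (induction rule: R.M.gr_induct)
    case (hom s x)
    note d = T.dif_degree[OF a] R.M.dif_degree[OF hom]
    note facts = a hom d T.gr_closed[OF a] R.M.gr_closed[OF hom] T.gr_closed[OF d(1)]
    have "dif M (?l a x) = sg M (p * s) (\<rho> (dif M x) (\<phi> a)) \<oplus>\<^bsub>M\<^esub> sg M (p * s + s) (\<rho> x (\<phi> (dif T a)))"
      using facts
      by (simp add: hom_eq[OF a hom] R.M.dif.sg R.right_leibniz[OF hom] \<phi>_dif R.M.sg_add)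
    moreover have "?l (dif T a) x = sg M (p * s + s) (\<rho> x (\<phi> (dif T a)))"
      by (simp add: hom_eq[OF d(1) hom] algebra_simps)
    moreover have "sg M p (?l a (dif M x)) = sg M (p * s) (\<rho> (dif M x) (\<phi> a))"
      using facts by (simp add: hom_eq[OF a d(2)]) (rule sg_cong, auto)
    ultimately show ?case using facts by (simp add: R.M.a_comm)
  next
    case (add x y)
    then show ?case using T.gr_closed[OF a]
      by (simp add: L.act.add_right R.M.dif.add R.M.sg_add R.M.a_ac)
  qed
  then show ?thesis
    by (intro left_dg_module.intro left_dg_module_axioms.intro L.graded_left_module_axioms
        R.M.dg_module_axioms)
qed

lemma right_action_bilinear_homogeneous:
  fixes M :: "('k, 'm) dg"
  assumes "graded_left_module K S M \<mu>"
  shows right_action_bilinear: "bilinear_map K M T M (right_action M \<mu>)"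
    and right_action_homogeneous:
      "x \<in> gr M p \<Longrightarrow> t \<in> gr T q \<Longrightarrow> right_action M \<mu> x t = sg M (p * q) (\<mu> (\<phi> t) x)"
proof -
  interpret L: graded_left_module K S M \<mu> by fact
  have pre: "bilinear_map K M T M (\<lambda>x t. \<mu> (\<phi> t) x)"
    by (rule bilinear_mapI) (simp_all add: L.act.add_left L.act.add_right L.act.smult_left
        L.act.smult_right phi.add phi.smult)
  note facts = L.M.graded_module_axioms T.graded_module_axioms L.M.k_module_axioms pre
  interpret k: bilin_map K M T M "koszul M T M (\<lambda>x t. \<mu> (\<phi> t) x)"
    by unfold_locales (rule koszul_bilinear[OF facts])
  show "bilinear_map K M T M (right_action M \<mu>)"
    by (rule bilinear_mapI)
      (simp_all add: right_action_def k.add_left k.add_right k.smult_left k.smult_right)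
  show "right_action M \<mu> x t = sg M (p * q) (\<mu> (\<phi> t) x)" if "x \<in> gr M p" "t \<in> gr T q"
    unfolding right_action_def using that koszul_homogeneous[OF facts that] by simp
qed

lemma right_action_graded_module:
  fixes M :: "('k, 'm) dg"
  assumes \<mu>: "graded_left_module K S M \<mu>"
  shows "graded_right_module K T M (right_action M \<mu>)"
proof -
  interpret L: graded_left_module K S M \<mu> by fact
  let ?r = "right_action M \<mu>"
  note hom_eq = right_action_homogeneous[OF \<mu>]
  interpret r: bilin_map K M T M ?r by unfold_locales (rule right_action_bilinear[OF \<mu>])
  have degree: "?r x a \<in> gr M (p + q)" if "x \<in> gr M p" "a \<in> gr T q" for a x p q
    using L.left_degree[OF \<phi>_degree[OF that(2)] that(1)] by (simp add: hom_eq[OF that] add.commute)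
  \<comment> \<open>The two actions have the same products of homogeneous elements up to sign, hence span the same.\<close>
  have gen: "\<mu> s x \<in> generate (add_monoid M) {?r x t |x t. x \<in> carrier M \<and> t \<in> carrier T}"
    (is "_ \<in> ?G") if x: "x \<in> carrier M" and s: "s \<in> carrier S" for x s
  proof -
    obtain t where t: "t \<in> carrier T" "s = \<phi> t" using s \<phi>_surj by blast
    show ?thesis unfolding t(2) using t(1)
    proof (induction rule: T.gr_induct)
      case (hom p t)
      note t = hom T.gr_closed[OF hom]
      show ?case using x
      proof (induction rule: L.M.gr_induct)
        case (hom q x)
        note x = hom L.M.gr_closed[OF hom]
        have "\<mu> (\<phi> t) x = ?r x (sg T (q * p) t)"
          using t x by (simp add: r.sg_right hom_eq)
        moreover have "sg T (q * p) t \<in> carrier T" using t by simp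
        ultimately show ?case using x by (intro L.M.generate_incl) blast
      qed (use t in \<open>simp add: L.act.add_right L.M.generate_add\<close>)
    qed (use x in \<open>simp add: phi.add L.act.add_left L.M.generate_add\<close>)
  qed
  have assoc: "?r x (a \<otimes>\<^bsub>T\<^esub> b) = ?r (?r x a) b"
    if abx: "a \<in> carrier T" "b \<in> carrier T" "x \<in> carrier M" for a b x
    using abx(1)
  proof (induction rule: T.gr_induct)
    case (hom p a)
    note a = hom T.gr_closed[OF hom]
    show ?case using abx(2)
    proof (induction rule: T.gr_induct)
      case (hom q b)
      note b = hom T.gr_closed[OF hom]
      show ?case using abx(3)
      proof (induction rule: L.M.gr_induct)
        case (hom s x)
        note x = hom L.M.gr_closed[OF hom]
        note d = T.mult_degree[OF a(1) b(1)] L.left_degree[OF \<phi>_degree[OF a(1)] x(1)]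
        have "?r x (a \<otimes>\<^bsub>T\<^esub> b) = sg M (s * (p + q) + p * q) (\<mu> (\<phi> b) (\<mu> (\<phi> a) x))"
          using a b x d
          by (simp add: hom_eq[OF x(1) d(1)] \<phi>_mult L.act.sg_left flip: L.left_assoc)
        moreover have "?r (?r x a) b = sg M (s * p + (p + s) * q) (\<mu> (\<phi> b) (\<mu> (\<phi> a) x))"
          using a b x d by (simp add: hom_eq[OF x(1) a(1)] r.sg_left hom_eq[OF d(2) b(1)])
        ultimately show ?case by (simp add: algebra_simps)
      qed (use a b in \<open>simp add: r.add_left\<close>)
    qed (use a abx in \<open>simp add: r.add_right T.mult.add_right\<close>)
  qed (use abx in \<open>simp add: r.add_left r.add_right T.mult.add_left\<close>)
  have sub: "{?r x t |x t. x \<in> carrier M \<and> t \<in> carrier T} \<subseteq> carrier M" by auto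
  have "x \<in> ?G" if "x \<in> carrier M" for x
    using that by (induction rule: L.left_induct) (simp_all add: gen L.M.generate_add)
  then have unitary: "?G = carrier M" using L.M.generate_closed[OF sub] by blast
  show ?thesis
    by (intro graded_right_module.intro graded_right_module_axioms.intro T.dg_algebra_ei_axioms
        L.M.graded_module_axioms r.bilin assoc degree unitary)
      (simp_all add: ext2_def right_action_def)
qed

lemma right_action_dg_module:
  fixes M :: "('k, 'm) dg"
  assumes "left_dg_module K S M \<mu>"
  shows "right_dg_module K T M (right_action M \<mu>)"
proof -
  interpret L: left_dg_module K S M \<mu> by fact
  have \<mu>: "graded_left_module K S M \<mu>" ..
  let ?r = "right_action M \<mu>"
  note hom_eq = right_action_homogeneous[OF \<mu>]
  interpret R: graded_right_module K T M ?r by (rule right_action_graded_module[OF \<mu>])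
  have "dif M (?r x a) = ?r (dif M x) a \<oplus>\<^bsub>M\<^esub> sg M s (?r x (dif T a))"
    if x: "x \<in> gr M s" and a: "a \<in> carrier T" for a x s
    using a
  proof (induction rule: T.gr_induct)
    case (hom p a)
    note d = T.dif_degree[OF hom] L.M.dif_degree[OF x]
    note facts = x hom d T.gr_closed[OF hom] L.M.gr_closed[OF x] T.gr_closed[OF d(1)]
    have "dif M (?r x a) = sg M (s * p) (\<mu> (\<phi> (dif T a)) x) \<oplus>\<^bsub>M\<^esub> sg M (s * p + p) (\<mu> (\<phi> a) (dif M x))"
      using facts
      by (simp add: hom_eq[OF x hom] L.M.dif.sg L.left_leibniz[OF \<phi>_degree[OF hom]] \<phi>_dif L.M.sg_add)
    moreover have "?r (dif M x) a = sg M (s * p + p) (\<mu> (\<phi> a) (dif M x))"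
      by (simp add: hom_eq[OF d(2) hom] algebra_simps)
    moreover have "sg M s (?r x (dif T a)) = sg M (s * p) (\<mu> (\<phi> (dif T a)) x)"
      using facts by (simp add: hom_eq[OF x d(1)]) (rule sg_cong, auto)
    ultimately show ?case using facts by (simp add: L.M.a_comm)
  next
    case (add a b)
    then show ?case using L.M.gr_closed[OF x]
      by (simp add: R.act.add_right L.M.dif.add T.dif.add L.M.sg_add L.M.a_ac)
  qed
  then show ?thesis
    by (intro right_dg_module.intro right_dg_module_axioms.intro R.graded_right_module_axioms
        L.M.dg_module_axioms)
qed

end

text \<open>
  For the identity map onto the opposite algebra this is the usual correspondence of left \<open>A\<close>-modules
  and right $A^{op}$-modules.
\<close>

lemma (in dg_algebra_ei) op_antihom: "dg_antihom K A (op_dg K A) (\<lambda>a. a)"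
proof -
  interpret op: dg_algebra_ei K "op_dg K A" by (rule op_dg_algebra_ei)
  show ?thesis
  proof
    show "linear_map K A (op_dg K A) (\<lambda>a. a)" by (rule linear_mapI) simp_all
    show "a \<otimes>\<^bsub>A\<^esub> b = sg (op_dg K A) (p * q) (b \<otimes>\<^bsub>op_dg K A\<^esub> a)" if "a \<in> gr A p" "b \<in> gr A q" for a b p q
      using that op_mult[OF that(2,1)] by (simp add: mult.commute)
  qed simp_all
qed


section \<open>Modules over an algebra of multipliers\<close>

text \<open>
  The factors of a tensor product of algebras without unit need not embed into it, but each acts on it
  by multiplication, as a limit: $s b = s (b \otimes u)$ for every sufficiently large local unit \<open>u\<close>
  of the other factor. The action on a unitary module extends to such multipliers.
\<close>

locale multiplier = graded_right_module K S M \<rho> + B: dg_algebra_ei K B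
  for K :: "'k ring" and S :: "('k, 's) dg" and M :: "('k, 'm) dg" and \<rho> and B :: "('k, 'b) dg" +
  fixes j :: "'i \<Rightarrow> 'b \<Rightarrow> 's" and F :: "'i filter"
  assumes F_nontrivial: "F \<noteq> bot"
    and j_linear: "\<forall>\<^sub>F i in F. linear_map K B S (j i)"
    and j_degree: "b \<in> gr B q \<Longrightarrow> \<forall>\<^sub>F i in F. j i b \<in> gr S q"
    and j_stable: "s \<in> carrier S \<Longrightarrow> b \<in> carrier B \<Longrightarrow>
      \<exists>t\<in>carrier S. \<forall>\<^sub>F i in F. s \<otimes>\<^bsub>S\<^esub> j i b = t"
    and j_mult: "b \<in> carrier B \<Longrightarrow> b' \<in> carrier B \<Longrightarrow>
      \<forall>\<^sub>F i in F. \<forall>\<^sub>F i' in F. j i b \<otimes>\<^bsub>S\<^esub> j i' b' = j i (b \<otimes>\<^bsub>B\<^esub> b')"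
    and j_unit: "s \<in> carrier S \<Longrightarrow>
      s \<in> generate (add_monoid S) {s \<in> carrier S. \<exists>b\<in>carrier B. \<forall>\<^sub>F i in F. s \<otimes>\<^bsub>S\<^esub> j i b = s}"
begin

definition action :: "'m \<Rightarrow> 'b \<Rightarrow> 'm" where
  "action x b = (if x \<in> carrier M \<and> b \<in> carrier B
     then (THE y. \<forall>\<^sub>F i in F. \<rho> x (j i b) = y) else undefined)"

lemma const: "(\<forall>\<^sub>F i in F. P) \<longleftrightarrow> P"
  using F_nontrivial by (rule eventually_const)

lemma j_closed: "b \<in> carrier B \<Longrightarrow> \<forall>\<^sub>F i in F. j i b \<in> carrier S"
  using j_linear by eventually_elim (auto simp: linear_map_def hom_def)

text \<open>
  For a product \<open>xs\<close> the value \<open>(xs) j i b = x (s j i b)\<close> is eventually constant since \<open>s j i b\<close> is;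
  and the module is spanned by products.
\<close>

lemma action_limit:
  assumes "x \<in> carrier M" and b: "b \<in> carrier B"
  shows "\<forall>\<^sub>F i in F. \<rho> x (j i b) = action x b"
proof -
  have ex: "\<exists>y\<in>carrier M. \<forall>\<^sub>F i in F. \<rho> x (j i b) = y"
    using assms(1)
  proof (induction rule: right_induct)
    case (act s x)
    obtain t where t: "t \<in> carrier S" "\<forall>\<^sub>F i in F. s \<otimes>\<^bsub>S\<^esub> j i b = t"
      using j_stable[OF act(1) b] by blast
    have "\<forall>\<^sub>F i in F. \<rho> (\<rho> x s) (j i b) = \<rho> x t"
      using t(2) j_closed[OF b] by eventually_elim (use act right_assoc in auto)
    then show ?case using act t by auto
  next
    case (add x y)
    then obtain v w where vw: "v \<in> carrier M" "w \<in> carrier M" "\<forall>\<^sub>F i in F. \<rho> x (j i b) = v"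
      "\<forall>\<^sub>F i in F. \<rho> y (j i b) = w" by blast
    have "\<forall>\<^sub>F i in F. \<rho> (x \<oplus>\<^bsub>M\<^esub> y) (j i b) = v \<oplus>\<^bsub>M\<^esub> w"
      using vw(3,4) j_closed[OF b] by eventually_elim (use add in \<open>simp add: act.add_left\<close>)
    then show ?case using vw by blast
  qed
  then obtain y where y: "\<forall>\<^sub>F i in F. \<rho> x (j i b) = y" by blast
  have uniq: "z = y" if "\<forall>\<^sub>F i in F. \<rho> x (j i b) = z" for z
  proof -
    have "\<forall>\<^sub>F i in F. z = y" using y that by eventually_elim simp
    then show ?thesis by (simp only: const)
  qed
  have "(THE y. \<forall>\<^sub>F i in F. \<rho> x (j i b) = y) = y"
    by (rule the_equality) (fact y, rule uniq)
  then show ?thesis using y assms by (simp add: action_def)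
qed

lemma action_closed: "x \<in> carrier M \<Longrightarrow> b \<in> carrier B \<Longrightarrow> action x b \<in> carrier M"
proof -
  assume xb: "x \<in> carrier M" "b \<in> carrier B"
  have "\<forall>\<^sub>F i in F. action x b \<in> carrier M"
    using action_limit[OF xb] j_closed[OF xb(2)] by eventually_elim (use xb in \<open>metis act.closed\<close>)
  then show ?thesis by (simp only: const)
qed

lemma action_bilinear: "bilinear_map K M B M action"
proof (rule bilinear_mapI)
  fix x x' b assume x: "x \<in> carrier M" "x' \<in> carrier M" and b: "b \<in> carrier B"
  then have "x \<oplus>\<^bsub>M\<^esub> x' \<in> carrier M" by simp
  from action_limit[OF x(1) b] action_limit[OF x(2) b] action_limit[OF this b] j_closed[OF b]
  have "\<forall>\<^sub>F i in F. action (x \<oplus>\<^bsub>M\<^esub> x') b = action x b \<oplus>\<^bsub>M\<^esub> action x' b"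
    by eventually_elim (use x act.add_left in metis)
  then show "action (x \<oplus>\<^bsub>M\<^esub> x') b = action x b \<oplus>\<^bsub>M\<^esub> action x' b" by (simp only: const)
next
  fix x b b' assume x: "x \<in> carrier M" and b: "b \<in> carrier B" "b' \<in> carrier B"
  then have "b \<oplus>\<^bsub>B\<^esub> b' \<in> carrier B" by simp
  from action_limit[OF x b(1)] action_limit[OF x b(2)] action_limit[OF x this]
    j_closed[OF b(1)] j_closed[OF b(2)] j_linear
  have "\<forall>\<^sub>F i in F. action x (b \<oplus>\<^bsub>B\<^esub> b') = action x b \<oplus>\<^bsub>M\<^esub> action x b'"
  proof eventually_elim
    case (elim i)
    have "j i (b \<oplus>\<^bsub>B\<^esub> b') = j i b \<oplus>\<^bsub>S\<^esub> j i b'"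
      using elim(6) b by (auto simp: linear_map_def hom_def)
    then show ?case using elim x act.add_right by metis
  qed
  then show "action x (b \<oplus>\<^bsub>B\<^esub> b') = action x b \<oplus>\<^bsub>M\<^esub> action x b'" by (simp only: const)
next
  fix k x b assume k: "k \<in> carrier K" and x: "x \<in> carrier M" and b: "b \<in> carrier B"
  then have "k \<odot>\<^bsub>M\<^esub> x \<in> carrier M" "k \<odot>\<^bsub>B\<^esub> b \<in> carrier B" by simp_all
  from action_limit[OF x b] action_limit[OF this(1) b] action_limit[OF x this(2)] j_closed[OF b] j_linear
  have "\<forall>\<^sub>F i in F. action (k \<odot>\<^bsub>M\<^esub> x) b = k \<odot>\<^bsub>M\<^esub> action x b \<and>
      action x (k \<odot>\<^bsub>B\<^esub> b) = k \<odot>\<^bsub>M\<^esub> action x b"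
  proof eventually_elim
    case (elim i)
    have "j i (k \<odot>\<^bsub>B\<^esub> b) = k \<odot>\<^bsub>S\<^esub> j i b"
      using elim(5) k b by (auto simp: linear_map_def)
    then show ?case using elim k x act.smult_left act.smult_right by metis
  qed
  then show "action (k \<odot>\<^bsub>M\<^esub> x) b = k \<odot>\<^bsub>M\<^esub> action x b"
    "action x (k \<odot>\<^bsub>B\<^esub> b) = k \<odot>\<^bsub>M\<^esub> action x b" by (simp_all only: const)
qed (rule action_closed)

lemma action_module: "graded_right_module K B M action"
proof (intro graded_right_module.intro graded_right_module_axioms.intro
    B.dg_algebra_ei_axioms M.graded_module_axioms action_bilinear)
  interpret a: bilin_map K M B M action by unfold_locales (rule action_bilinear)
  show "ext2 M B action" by (simp add: ext2_def action_def)
  show "action x (b \<otimes>\<^bsub>B\<^esub> b') = action (action x b) b'"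
    if b: "b \<in> carrier B" "b' \<in> carrier B" and x: "x \<in> carrier M" for x b b'
  proof -
    have bb: "b \<otimes>\<^bsub>B\<^esub> b' \<in> carrier B" and xb: "action x b \<in> carrier M" using b x by simp_all
    have "\<forall>\<^sub>F i in F. \<forall>\<^sub>F i' in F. action x (b \<otimes>\<^bsub>B\<^esub> b') = action (action x b) b'"
      using action_limit[OF x b(1)] action_limit[OF x bb] j_mult[OF b] j_closed[OF b(1)]
    proof eventually_elim
      case (elim i)
      from elim(3) action_limit[OF xb b(2)] j_closed[OF b(2)]
      show ?case
      proof eventually_elim
        case (elim i')
        then show ?case
          using \<open>\<rho> x (j i b) = action x b\<close> \<open>\<rho> x (j i (b \<otimes>\<^bsub>B\<^esub> b')) = action x (b \<otimes>\<^bsub>B\<^esub> b')\<close>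
            \<open>j i b \<in> carrier S\<close> right_assoc[of "j i b" "j i' b'" x] x by metis
      qed
    qed
    then show ?thesis by (simp only: const)
  qed
  show "action x b \<in> gr M (p + q)" if x: "x \<in> gr M p" and b: "b \<in> gr B q" for x b p q
  proof -
    have "\<forall>\<^sub>F i in F. action x b \<in> gr M (p + q)"
      using action_limit[OF M.gr_closed[OF x] B.gr_closed[OF b]] j_degree[OF b]
      by eventually_elim (use x right_degree in metis)
    then show ?thesis by (simp only: const)
  qed
  let ?G = "generate (add_monoid M) {action x b |x b. x \<in> carrier M \<and> b \<in> carrier B}"
  have sub: "{action x b |x b. x \<in> carrier M \<and> b \<in> carrier B} \<subseteq> carrier M" by auto
  have gen: "\<rho> x s \<in> ?G" if x: "x \<in> carrier M" and s: "s \<in> carrier S" for x s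
    using j_unit[OF s]
  proof (induction rule: generator_induct)
    case (gen s)
    then obtain b where s: "s \<in> carrier S" and b: "b \<in> carrier B" "\<forall>\<^sub>F i in F. s \<otimes>\<^bsub>S\<^esub> j i b = s" by blast
    have xs: "\<rho> x s \<in> carrier M" using x s by simp
    have "\<forall>\<^sub>F i in F. \<rho> x s = action (\<rho> x s) b"
      using b(2) action_limit[OF xs b(1)] j_closed[OF b(1)]
      by eventually_elim (use x s right_assoc in metis)
    then have "\<rho> x s = action (\<rho> x s) b" by (simp only: const)
    then show ?case using xs b by (intro M.generate_incl) blast
  next
    case (minus s)
    then obtain b where s: "s \<in> carrier S" and b: "b \<in> carrier B" "\<forall>\<^sub>F i in F. s \<otimes>\<^bsub>S\<^esub> j i b = s" by blast
    have xs: "\<rho> x s \<in> carrier M" using x s by simp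
    have "\<forall>\<^sub>F i in F. \<rho> x s = action (\<rho> x s) b"
      using b(2) action_limit[OF xs b(1)] j_closed[OF b(1)]
      by eventually_elim (use x s right_assoc in metis)
    then have "\<rho> x s = action (\<rho> x s) b" by (simp only: const)
    then have "\<rho> x (\<ominus>\<^bsub>S\<^esub> s) = action (\<ominus>\<^bsub>M\<^esub> \<rho> x s) b"
      using x s xs b by (simp add: act.minus_right a.minus_left)
    then show ?case using xs b by (intro M.generate_incl) blast
  next
    case zero
    show ?case using x by (simp add: M.generate_zero)
  next
    case (add s t)
    then show ?case using x by (simp add: act.add_right M.generate_add)
  qed auto
  have "x \<in> ?G" if "x \<in> carrier M" for x
    using that by (induction rule: right_induct) (simp_all add: gen M.generate_add)
  then show "?G = carrier M" using M.generate_closed[OF sub] by blast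
qed

end

context tensor_algebra
begin

text \<open>
  The factor \<open>A\<close> acts through $a \otimes u$ with \<open>u\<close> a local unit of \<open>B\<close>, and the factor \<open>B\<close> through
  $v \otimes b$. On a given tensor both become stationary, as its finitely many entries from the other
  factor are fixed by all large local units.
\<close>

lemma multiplier_left:
  assumes "graded_right_module K S M \<rho>"
  shows "multiplier K S M \<rho> A (\<lambda>u a. a \<diamondop> u) B.unit_filter"
proof -
  interpret R: graded_right_module K S M \<rho> by fact
  have unit: "\<forall>\<^sub>F u in B.unit_filter. u \<in> gr B 0"
    using B.eventually_unit[OF B.zero_closed] by eventually_elim blast
  show ?thesis
  proof
    show "B.unit_filter \<noteq> bot" by (rule B.unit_filter_nontrivial)
    show "\<forall>\<^sub>F u in B.unit_filter. linear_map K A S (\<lambda>a. a \<diamondop> u)"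
      using unit
      by eventually_elim (use lin_map.lin[OF pure.lin_left] B.gr_closed in \<open>auto simp: upd_linear[OF S_upd]\<close>)
    show "\<forall>\<^sub>F u in B.unit_filter. a \<diamondop> u \<in> gr S q" if "a \<in> gr A q" for a q
      using unit by eventually_elim (use pure_degree[OF that] in force)
    show "\<exists>t\<in>carrier S. \<forall>\<^sub>F u in B.unit_filter. s \<otimes>\<^bsub>S\<^esub> (a \<diamondop> u) = t"
      if "s \<in> carrier S" and a: "a \<in> carrier A" for s a
    proof -
      have "s \<in> carrier T" using that by simp
      then have "\<exists>t\<in>carrier T. \<forall>\<^sub>F u in B.unit_filter. s \<cdot> (a \<diamondop> u) = t"
      proof (induction rule: homogeneous_pure_induct)
        case (pure p q c b)
        note cb = pure A.gr_closed[OF pure(1)] B.gr_closed[OF pure(2)]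
        show ?case using a
        proof (induction rule: A.gr_induct)
          case (hom n a)
          have "\<forall>\<^sub>F u in B.unit_filter. (c \<diamondop> b) \<cdot> (a \<diamondop> u) = sg T (q * n) ((c \<otimes>\<^bsub>A\<^esub> a) \<diamondop> b)"
            using B.eventually_unit[OF cb(4)]
            by eventually_elim (use cb hom mult_pure B.gr_closed in metis)
          then show ?case using cb A.gr_closed[OF hom] by (intro bexI) auto
        next
          case (add a a')
          then obtain t t' where t: "t \<in> carrier T" "t' \<in> carrier T"
            "\<forall>\<^sub>F u in B.unit_filter. (c \<diamondop> b) \<cdot> (a \<diamondop> u) = t"
            "\<forall>\<^sub>F u in B.unit_filter. (c \<diamondop> b) \<cdot> (a' \<diamondop> u) = t'" by blast
          have "\<forall>\<^sub>F u in B.unit_filter. (c \<diamondop> b) \<cdot> ((a \<oplus>\<^bsub>A\<^esub> a') \<diamondop> u) = t \<oplus>\<^bsub>T\<^esub> t'"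
            using unit t(3,4)
            by eventually_elim (use add cb B.gr_closed in \<open>auto simp: pure.add_left tm.add_right\<close>)
          then show ?case using t by (intro bexI[of _ "t \<oplus>\<^bsub>T\<^esub> t'"]) simp_all
        qed
      next
        case (add s s')
        then obtain t t' where t: "t \<in> carrier T" "t' \<in> carrier T"
          "\<forall>\<^sub>F u in B.unit_filter. s \<cdot> (a \<diamondop> u) = t"
          "\<forall>\<^sub>F u in B.unit_filter. s' \<cdot> (a \<diamondop> u) = t'" by blast
        have "\<forall>\<^sub>F u in B.unit_filter. (s \<oplus>\<^bsub>T\<^esub> s') \<cdot> (a \<diamondop> u) = t \<oplus>\<^bsub>T\<^esub> t'"
          using unit t(3,4)
          by eventually_elim (use add a B.gr_closed in \<open>auto simp: tm.add_left\<close>)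
        then show ?case using t by (intro bexI[of _ "t \<oplus>\<^bsub>T\<^esub> t'"]) simp_all
      qed
      then show ?thesis by simp
    qed
    show "\<forall>\<^sub>F u in B.unit_filter. \<forall>\<^sub>F u' in B.unit_filter.
        (a \<diamondop> u) \<otimes>\<^bsub>S\<^esub> (a' \<diamondop> u') = (a \<otimes>\<^bsub>A\<^esub> a') \<diamondop> u"
      if "a \<in> carrier A" "a' \<in> carrier A" for a a'
      using unit
    proof eventually_elim
      case (elim u)
      from B.eventually_unit[OF B.gr_closed[OF elim]] show ?case
        by eventually_elim (use elim that mult_pure_unit_left B.gr_closed S_mult in metis)
    qed
    fix s assume "s \<in> carrier S"
    then have "s \<in> carrier T" by simp
    then have "s \<in> generate (add_monoid T)
        {s \<in> carrier T. \<exists>a\<in>carrier A. \<forall>\<^sub>F u in B.unit_filter. s \<cdot> (a \<diamondop> u) = s}"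
    proof (induction rule: pure_induct)
      case (pure c b)
      have "\<exists>v. v \<in> gr A 0 \<and> dif A v = \<zero>\<^bsub>A\<^esub> \<and> v \<otimes>\<^bsub>A\<^esub> c = c \<and> c \<otimes>\<^bsub>A\<^esub> v = c"
        by (rule eventually_happens'[OF A.unit_filter_nontrivial A.eventually_unit[OF pure(1)]])
      then obtain v where v: "v \<in> gr A 0" "c \<otimes>\<^bsub>A\<^esub> v = c" by blast
      have "\<forall>\<^sub>F u in B.unit_filter. (c \<diamondop> b) \<cdot> (v \<diamondop> u) = c \<diamondop> b"
        using B.eventually_unit[OF pure(2)]
        by eventually_elim (use v pure mult_pure_unit_right B.gr_closed in metis)
      then show ?case using pure A.gr_closed[OF v(1)] by (intro T.generate_incl) auto
    qed (rule T.generate_add)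
    then show "s \<in> generate (add_monoid S)
        {s \<in> carrier S. \<exists>a\<in>carrier A. \<forall>\<^sub>F u in B.unit_filter. s \<otimes>\<^bsub>S\<^esub> (a \<diamondop> u) = s}"
      by simp
  qed
qed

lemma multiplier_right:
  assumes "graded_right_module K S M \<rho>"
  shows "multiplier K S M \<rho> B (\<lambda>v b. v \<diamondop> b) A.unit_filter"
proof -
  interpret R: graded_right_module K S M \<rho> by fact
  have unit: "\<forall>\<^sub>F u in A.unit_filter. u \<in> gr A 0"
    using A.eventually_unit[OF A.zero_closed] by eventually_elim blast
  show ?thesis
  proof
    show "A.unit_filter \<noteq> bot" by (rule A.unit_filter_nontrivial)
    show "\<forall>\<^sub>F v in A.unit_filter. linear_map K B S (\<lambda>b. v \<diamondop> b)"
      using unit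
      by eventually_elim (use lin_map.lin[OF pure.lin_right] A.gr_closed in \<open>auto simp: upd_linear[OF S_upd]\<close>)
    show "\<forall>\<^sub>F v in A.unit_filter. v \<diamondop> b \<in> gr S q" if "b \<in> gr B q" for b q
      using unit by eventually_elim (use pure_degree[OF _ that] in force)
    show "\<exists>t\<in>carrier S. \<forall>\<^sub>F v in A.unit_filter. s \<otimes>\<^bsub>S\<^esub> (v \<diamondop> b) = t"
      if "s \<in> carrier S" and b: "b \<in> carrier B" for s b
    proof -
      have "s \<in> carrier T" using that by simp
      then have "\<exists>t\<in>carrier T. \<forall>\<^sub>F v in A.unit_filter. s \<cdot> (v \<diamondop> b) = t"
      proof (induction rule: pure_induct)
        case (pure c b')
        have "\<forall>\<^sub>F v in A.unit_filter. (c \<diamondop> b') \<cdot> (v \<diamondop> b) = c \<diamondop> (b' \<otimes>\<^bsub>B\<^esub> b)"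
          using A.eventually_unit[OF pure(1)]
          by eventually_elim (use pure b mult_pure_unit_right in metis)
        then show ?case using pure b by (intro bexI) auto
      next
        case (add s s')
        then obtain t t' where t: "t \<in> carrier T" "t' \<in> carrier T"
          "\<forall>\<^sub>F v in A.unit_filter. s \<cdot> (v \<diamondop> b) = t"
          "\<forall>\<^sub>F v in A.unit_filter. s' \<cdot> (v \<diamondop> b) = t'" by blast
        have "\<forall>\<^sub>F v in A.unit_filter. (s \<oplus>\<^bsub>T\<^esub> s') \<cdot> (v \<diamondop> b) = t \<oplus>\<^bsub>T\<^esub> t'"
          using unit t(3,4)
          by eventually_elim (use add b A.gr_closed in \<open>auto simp: tm.add_left\<close>)
        then show ?case using t by (intro bexI[of _ "t \<oplus>\<^bsub>T\<^esub> t'"]) simp_all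
      qed
      then show ?thesis by simp
    qed
    show "\<forall>\<^sub>F v in A.unit_filter. \<forall>\<^sub>F v' in A.unit_filter.
        (v \<diamondop> b) \<otimes>\<^bsub>S\<^esub> (v' \<diamondop> b') = v \<diamondop> (b \<otimes>\<^bsub>B\<^esub> b')"
      if "b \<in> carrier B" "b' \<in> carrier B" for b b'
      using unit
    proof eventually_elim
      case (elim v)
      from A.eventually_unit[OF A.gr_closed[OF elim]] show ?case
        by eventually_elim (use elim that mult_pure_unit_right A.gr_closed S_mult in metis)
    qed
    fix s assume "s \<in> carrier S"
    then have "s \<in> carrier T" by simp
    then have "s \<in> generate (add_monoid T)
        {s \<in> carrier T. \<exists>b\<in>carrier B. \<forall>\<^sub>F v in A.unit_filter. s \<cdot> (v \<diamondop> b) = s}"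
    proof (induction rule: pure_induct)
      case (pure c b)
      have "\<exists>u. u \<in> gr B 0 \<and> dif B u = \<zero>\<^bsub>B\<^esub> \<and> u \<otimes>\<^bsub>B\<^esub> b = b \<and> b \<otimes>\<^bsub>B\<^esub> u = b"
        by (rule eventually_happens'[OF B.unit_filter_nontrivial B.eventually_unit[OF pure(2)]])
      then obtain u where u: "u \<in> gr B 0" "b \<otimes>\<^bsub>B\<^esub> u = b" by blast
      have "\<forall>\<^sub>F v in A.unit_filter. (c \<diamondop> b) \<cdot> (v \<diamondop> u) = c \<diamondop> b"
        using A.eventually_unit[OF pure(1)]
        by eventually_elim (use u pure mult_pure_unit_right B.gr_closed in metis)
      then show ?case using pure B.gr_closed[OF u(1)] by (intro T.generate_incl) auto
    qed (rule T.generate_add)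
    then show "s \<in> generate (add_monoid S)
        {s \<in> carrier S. \<exists>b\<in>carrier B. \<forall>\<^sub>F v in A.unit_filter. s \<otimes>\<^bsub>S\<^esub> (v \<diamondop> b) = s}"
      by simp
  qed
qed

end


section \<open>Bimodules and right modules\<close>

locale bi_algebras = A: dg_algebra_ei K A + B: dg_algebra_ei K B
  for K :: "'k ring" and A :: "('k, 'a) dg" and B :: "('k, 'b) dg"
begin

sublocale Ao: dg_algebra_ei K "op_dg K A"
  by (rule A.op_dg_algebra_ei)

sublocale Bo: dg_algebra_ei K "op_dg K B"
  by (rule B.op_dg_algebra_ei)

sublocale S: tensor_algebra K B "op_dg K A" ..

sublocale T: tensor_algebra K A "op_dg K B" ..

sublocale SS: dg_algebra_ei K "tensor_dg K B (op_dg K A)"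
  by (rule S.S_dg_algebra_ei)

sublocale TT: dg_algebra_ei K "tensor_dg K A (op_dg K B)"
  by (rule T.S_dg_algebra_ei)

text \<open>
  The sign $(-1)^{(|x|+|b|)|a|}$ is inserted in two steps, \<open>|x||a|\<close> into the left action and
  \<open>|b||a|\<close> into the resulting map of \<open>b\<close> and \<open>a\<close>. Unitarity holds because \<open>x = uxv\<close> for local units
  \<open>u\<close> and \<open>v\<close>, which have degree 0.
\<close>

lemma right_module_of_bimodule:
  fixes M :: "('k, 'm) dg"
  assumes bim: "dg_bimodule K A B M l r"
  shows "\<exists>\<rho>. right_dg_module K (tensor_dg K B (op_dg K A)) M \<rho> \<and> right_identified K A B M l r \<rho>"
proof -
  interpret MM: dg_module K M using bim by (rule dg_bimodule.axioms(3))
  interpret M: dg_bimodule K A B M l r by fact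
  note gM = MM.graded_module_axioms and kM = MM.k_module_axioms
  note lk = A.graded_module_axioms gM kM M.left.act.bilin
  define l' where "l' = koszul A M M l"
  interpret l': bilin_map K A M M l'
    unfolding l'_def by unfold_locales (rule koszul_bilinear[OF lk])
  have l'_hom: "l' a x = sg M (p * s) (l a x)" if "a \<in> gr A p" "x \<in> gr M s" for a x p s
    unfolding l'_def by (rule koszul_homogeneous[OF lk that])
  define \<beta> where "\<beta> x = koszul B (op_dg K A) M (\<lambda>b a. r (l' a x) b)" for x
  have pre: "bilinear_map K B (op_dg K A) M (\<lambda>b a. r (l' a x) b)" if "x \<in> carrier M" for x
    using that by (intro bilinear_mapI) (simp_all add: M.right.act.add_left M.right.act.add_right
        M.right.act.smult_left M.right.act.smult_right l'.add_left l'.smult_left)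
  note rk = B.graded_module_axioms Ao.graded_module_axioms kM
  have \<beta>_bil: "bilinear_map K B (op_dg K A) M (\<beta> x)" if "x \<in> carrier M" for x
    unfolding \<beta>_def by (rule koszul_bilinear[OF rk pre[OF that]])
  have \<beta>_hom: "\<beta> x b a = sg M ((s + q) * p) (r (l a x) b)"
    if "x \<in> gr M s" "b \<in> gr B q" "a \<in> gr A p" for x b a s q p
    unfolding \<beta>_def
    using koszul_homogeneous[OF rk pre, of x b q a p] that
    by (simp add: l'_hom[OF that(3,1)] M.right.act.sg_left algebra_simps)
  define \<rho> where "\<rho> x t = (if x \<in> carrier M \<and> t \<in> carrier S.T then S.lift M (\<beta> x) t else undefined)"
    for x t
  have \<rho>_pure: "\<rho> x (pure K B (op_dg K A) b a) = \<beta> x b a"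
    if "x \<in> carrier M" "b \<in> carrier B" "a \<in> carrier A" for x b a
    unfolding \<rho>_def using that by (simp add: S.lift_pure[OF kM \<beta>_bil])
  have ident: "\<rho> x (pure K B (op_dg K A) b a) = sg M ((s + q) * p) (r (l a x) b)"
    if "x \<in> gr M s" "b \<in> gr B q" "a \<in> gr A p" for x b a s q p
    using \<rho>_pure[of x b a] \<beta>_hom[OF that] that by simp
  have L: "lin_map K S.T M (S.lift M (\<beta> x))" if "x \<in> carrier M" for x
    by unfold_locales (rule S.lift_linear[OF kM \<beta>_bil[OF that]])
  have bil: "bilinear_map K M S.T M \<rho>"
  proof (rule bilinear_mapI)
    fix x x' t assume *: "x \<in> carrier M" "x' \<in> carrier M" "t \<in> carrier S.T"
    have "\<beta> (x \<oplus>\<^bsub>M\<^esub> x') b a = \<beta> x b a \<oplus>\<^bsub>M\<^esub> \<beta> x' b a" if "b \<in> carrier B" "a \<in> carrier (op_dg K A)" for b a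
      unfolding \<beta>_def
      by (rule koszul_add[OF rk pre pre pre])
        (use * that in \<open>simp_all add: l'.add_right M.right.act.add_left\<close>)
    from S.lift_add[OF kM \<beta>_bil \<beta>_bil \<beta>_bil this, of t]
    show "\<rho> (x \<oplus>\<^bsub>M\<^esub> x') t = \<rho> x t \<oplus>\<^bsub>M\<^esub> \<rho> x' t"
      unfolding \<rho>_def using * by simp
  next
    fix k x t assume *: "k \<in> carrier K" "x \<in> carrier M" "t \<in> carrier S.T"
    have "\<beta> (k \<odot>\<^bsub>M\<^esub> x) b a = k \<odot>\<^bsub>M\<^esub> \<beta> x b a" if "b \<in> carrier B" "a \<in> carrier (op_dg K A)" for b a
      unfolding \<beta>_def
      by (rule koszul_smult[OF rk pre pre])
        (use * that in \<open>simp_all add: l'.smult_right M.right.act.smult_left\<close>)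
    from S.lift_smult[OF kM \<beta>_bil \<beta>_bil *(1) this, of t]
    show "\<rho> (k \<odot>\<^bsub>M\<^esub> x) t = k \<odot>\<^bsub>M\<^esub> \<rho> x t"
      unfolding \<rho>_def using * by simp
  qed (simp_all add: \<rho>_def lin_map.closed[OF L] lin_map.add[OF L] lin_map.smult[OF L])
  interpret \<rho>: bilin_map K M S.T M \<rho> by unfold_locales (rule bil)
  have degree: "\<rho> x t \<in> gr M (s + n)" if x: "x \<in> gr M s" and t: "t \<in> gr S.T n" for x t s n
    using t
  proof (induction rule: S.T_gr_induct)
    case (pure q p b a)
    then have "r (l a x) b \<in> gr M ((p + s) + q)"
      using x M.left.left_degree M.right.right_degree by simp
    moreover have "(p + s) + q = s + n" using pure by simp
    ultimately show ?case using pure x by (simp add: ident[OF x])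
  qed (use x MM.gr_closed[OF x] in \<open>simp add: \<rho>.add_right MM.gr_add\<close>)
  have unit: "\<rho> x (pure K B (op_dg K A) v u) = r (l u x) v"
    if "x \<in> carrier M" and u: "u \<in> gr A 0" and v: "v \<in> gr B 0" for x u v
    using that(1)
    by (induction rule: MM.gr_induct)
      (use u v A.gr_closed[OF u] B.gr_closed[OF v] in \<open>simp_all add: ident[OF _ v u] \<rho>.add_left
        M.left.act.add_right M.right.act.add_left\<close>)
  have gen: "x \<in> {\<rho> x t |x t. x \<in> carrier M \<and> t \<in> carrier S.T}" if x: "x \<in> carrier M" for x
  proof -
    obtain u where u: "u \<in> gr A 0" "l u x = x"
      using eventually_happens'[OF A.unit_filter_nontrivial M.left.eventually_left_unit[OF x]] by blast
    obtain v where v: "v \<in> gr B 0" "r x v = x"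
      using eventually_happens'[OF B.unit_filter_nontrivial M.right.eventually_right_unit[OF x]] by blast
    have "\<rho> x (pure K B (op_dg K A) v u) = x" using unit[OF x u(1) v(1)] u v by simp
    moreover have "pure K B (op_dg K A) v u \<in> carrier S.T" using u v by simp
    ultimately show ?thesis using x by (metis (mono_tags, lifting) mem_Collect_eq)
  qed
  have sub: "{\<rho> x t |x t. x \<in> carrier M \<and> t \<in> carrier S.T} \<subseteq> carrier M" by auto
  have unitary: "generate (add_monoid M) {\<rho> x t |x t. x \<in> carrier M \<and> t \<in> carrier S.T} = carrier M"
    using MM.generate_closed[OF sub] MM.generate_incl gen by blast
  have assoc: "\<rho> x (tensor_mult K B (op_dg K A) t t') = \<rho> (\<rho> x t) t'"
    if t: "t \<in> carrier S.T" and t': "t' \<in> carrier S.T" and x: "x \<in> carrier M" for x t t'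
    using x
  proof (induction rule: MM.gr_induct)
    case (hom s x)
    note x = hom MM.gr_closed[OF hom]
    show ?case using t
    proof (induction rule: S.homogeneous_pure_induct)
      case (pure q p b a)
      have ba: "b \<in> gr B q" "a \<in> gr A p" "b \<in> carrier B" "a \<in> carrier A" using pure by simp_all
      show ?case using t'
      proof (induction rule: S.homogeneous_pure_induct)
        case (pure q' p' b' a')
        have ba': "b' \<in> gr B q'" "a' \<in> gr A p'" "b' \<in> carrier B" "a' \<in> carrier A" using pure by simp_all
        note d = B.mult_degree[OF ba(1) ba'(1)] A.mult_degree[OF ba'(2) ba(2)]
          M.right.right_degree[OF M.left.left_degree[OF ba(2) x(1)] ba(1)]
        let ?y = "r (r (l a' (l a x)) b) b'"
        have "tensor_mult K B (op_dg K A) (pure K B (op_dg K A) b a) (pure K B (op_dg K A) b' a') =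
            sg S.T (p * q' + p * p') (pure K B (op_dg K A) (b \<otimes>\<^bsub>B\<^esub> b') (a' \<otimes>\<^bsub>A\<^esub> a))"
          using ba ba' d by (simp add: S.mult_pure A.op_mult S.pure.sg_right[unfolded A.op_sg])
        then have "\<rho> x (tensor_mult K B (op_dg K A) (pure K B (op_dg K A) b a) (pure K B (op_dg K A) b' a')) =
            sg M (p * q' + p * p' + (s + (q + q')) * (p' + p)) ?y"
          using ba ba' x d by (simp add: \<rho>.sg_right ident[OF x(1) d(1,2)] M.left.left_assoc M.right.right_assoc)
        moreover have "\<rho> (\<rho> x (pure K B (op_dg K A) b a)) (pure K B (op_dg K A) b' a') =
            sg M ((s + q) * p + ((p + s + q) + q') * p') ?y"
          using ba ba' x d
          by (simp add: ident[OF x(1) ba(1,2)] \<rho>.sg_left ident[OF d(3) ba'(1,2)] flip: M.actions_commute)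
        moreover have "sg M (p * q' + p * p' + (s + (q + q')) * (p' + p)) ?y =
            sg M ((s + q) * p + ((p + s + q) + q') * p') ?y"
          by (rule sg_cong) auto
        ultimately show ?case by simp
      qed (use x ba in \<open>simp add: \<rho>.add_right S.tm.add_right\<close>)
    qed (use x t' in \<open>simp add: \<rho>.add_right \<rho>.add_left S.tm.add_left\<close>)
  qed (use t t' in \<open>simp add: \<rho>.add_left\<close>)
  have leibniz: "dif M (\<rho> x t) = \<rho> (dif M x) t \<oplus>\<^bsub>M\<^esub> sg M s (\<rho> x (tensor_dif K B (op_dg K A) t))"
    if x: "x \<in> gr M s" and t: "t \<in> carrier S.T" for x t s
    using t
  proof (induction rule: S.homogeneous_pure_induct)
    case (pure q p b a)
    have ba: "b \<in> gr B q" "a \<in> gr A p" "b \<in> carrier B" "a \<in> carrier A" using pure by simp_all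
    note d = B.dif_degree[OF ba(1)] A.dif_degree[OF ba(2)] MM.dif_degree[OF x]
    note facts = ba d x MM.gr_closed[OF x]
    let ?u = "r (l (dif A a) x) b" and ?v = "r (l a (dif M x)) b" and ?w = "r (l a x) (dif B b)"
    let ?k = "(s + q) * p"
    have "dif M (\<rho> x (pure K B (op_dg K A) b a)) = sg M ?k ?u \<oplus>\<^bsub>M\<^esub> sg M (?k + p) ?v \<oplus>\<^bsub>M\<^esub> sg M (?k + (p + s)) ?w"
      using facts
      by (simp add: ident[OF x ba(1,2)] MM.dif.sg M.bimodule_leibniz[OF ba(2) x ba(3)] MM.sg_add)
    moreover have "\<rho> (dif M x) (pure K B (op_dg K A) b a) = sg M (?k + p) ?v"
      by (simp add: ident[OF d(3) ba(1,2)] algebra_simps)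
    moreover have "sg M s (\<rho> x (tensor_dif K B (op_dg K A) (pure K B (op_dg K A) b a))) =
        sg M (?k + (p + s)) ?w \<oplus>\<^bsub>M\<^esub> sg M ?k ?u"
    proof -
      have "sg M s (\<rho> x (tensor_dif K B (op_dg K A) (pure K B (op_dg K A) b a))) =
          sg M (s + (s + (q + 1)) * p) ?w \<oplus>\<^bsub>M\<^esub> sg M (s + (q + (s + q) * (p + 1))) ?u"
        using facts
        by (simp add: S.dif_pure[OF ba(1)] \<rho>.add_right \<rho>.sg_right ident[OF x d(1) ba(2)]
            ident[OF x ba(1) d(2)] MM.sg_add)
      also have "sg M (s + (s + (q + 1)) * p) ?w = sg M (?k + (p + s)) ?w"
        by (simp add: algebra_simps)
      also have "sg M (s + (q + (s + q) * (p + 1))) ?u = sg M ?k ?u"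
        by (rule sg_cong) auto
      finally show ?thesis .
    qed
    ultimately show ?case using facts by (simp add: MM.a_ac)
  next
    case (add t t')
    then show ?case using MM.gr_closed[OF x]
      by (simp add: \<rho>.add_right MM.dif.add S.td.add MM.sg_add MM.a_ac)
  qed
  have "right_dg_module K (tensor_dg K B (op_dg K A)) M \<rho>"
  proof (intro right_dg_module.intro graded_right_module.intro graded_right_module_axioms.intro
      right_dg_module_axioms.intro SS.dg_algebra_ei_axioms gM MM.dg_module_axioms)
    show "bilinear_map K M (tensor_dg K B (op_dg K A)) M \<rho>"
      using bil by (simp add: bilinear_map_def upd_linear[OF S.S_upd])
    show "ext2 M (tensor_dg K B (op_dg K A)) \<rho>" by (simp add: ext2_def \<rho>_def)
  qed (use assoc degree unitary leibniz in simp_all)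
  moreover have "right_identified K A B M l r \<rho>"
    unfolding right_identified_def using ident by blast
  ultimately show ?thesis by blast
qed

text \<open>
  The two factors act as multipliers. Acting by \<open>b\<close> and then by \<open>a\<close> amounts to $b \otimes a^o$, since
  $(b \otimes u)(v \otimes a^o) = b \otimes a^o$ for large local units; in the other order the factors have
  to be exchanged, which costs the sign $(-1)^{|a||b|}$. These two facts (\<open>b_c\<close> and \<open>c_b\<close>) give the
  identification and the commutation of the actions. The Leibniz rule is read off from that for the
  right module through the identification.
\<close>

lemma bimodule_of_right_module:
  fixes M :: "('k, 'm) dg"
  assumes right: "right_dg_module K (tensor_dg K B (op_dg K A)) M \<rho>"
  shows "\<exists>l r. dg_bimodule K A B M l r \<and> right_identified K A B M l r \<rho>"
proof -
  interpret R: right_dg_module K "tensor_dg K B (op_dg K A)" M \<rho> by fact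
  have gr: "graded_right_module K (tensor_dg K B (op_dg K A)) M \<rho>" ..
  interpret \<rho>T: bilin_map K M S.T M \<rho>
    using R.act.bilin by unfold_locales (simp add: bilinear_map_def upd_linear[OF S.S_upd])
  interpret b: multiplier K "tensor_dg K B (op_dg K A)" M \<rho> B "\<lambda>u b. pure K B (op_dg K A) b u" Ao.unit_filter
    by (rule S.multiplier_left[OF gr])
  interpret c: multiplier K "tensor_dg K B (op_dg K A)" M \<rho> "op_dg K A" "\<lambda>v a. pure K B (op_dg K A) v a" B.unit_filter
    by (rule S.multiplier_right[OF gr])
  let ?r = b.action
  interpret r: graded_right_module K B M ?r by (rule b.action_module)
  interpret c': graded_right_module K "op_dg K A" M c.action by (rule c.action_module)
  interpret op: dg_antihom K A "op_dg K A" "\<lambda>a. a" by (rule A.op_antihom)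
  let ?l = "op.left_action M c.action"
  interpret l: graded_left_module K A M ?l by (rule op.left_action_graded_module[OF c.action_module])
  note l_hom = op.left_action_homogeneous[OF c.action_module]
  have b_c: "c.action (?r x b) a = \<rho> x (pure K B (op_dg K A) b a)"
    if x: "x \<in> carrier M" and b: "b \<in> carrier B" and a: "a \<in> carrier A" for x a b
  proof -
    have xb: "?r x b \<in> carrier M" and ao: "a \<in> carrier (op_dg K A)" using x b a by simp_all
    have "\<forall>\<^sub>F u in Ao.unit_filter. \<forall>\<^sub>F v in B.unit_filter.
        c.action (?r x b) a = \<rho> x (pure K B (op_dg K A) b a)"
      using b.action_limit[OF x b] Ao.eventually_unit[OF ao]
    proof eventually_elim
      case (elim u)
      then have u: "u \<in> carrier (op_dg K A)" "u \<otimes>\<^bsub>op_dg K A\<^esub> a = a" using Ao.gr_closed by blast+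
      from c.action_limit[OF xb ao] B.eventually_unit[OF b] show ?case
      proof eventually_elim
        case (elim v)
        have "tensor_mult K B (op_dg K A) (pure K B (op_dg K A) b u) (pure K B (op_dg K A) v a) =
            pure K B (op_dg K A) b a"
          using S.mult_pure_unit_right[OF b u(1) _ ao, of v] u elim by simp
        moreover have "pure K B (op_dg K A) b u \<in> carrier S.S" "pure K B (op_dg K A) v a \<in> carrier S.S"
          using B.gr_closed[of v 0] elim(2) u b ao by simp_all
        ultimately show ?case
          using elim \<open>\<rho> x (pure K B (op_dg K A) b u) = ?r x b\<close>
            R.right_assoc[of "pure K B (op_dg K A) b u" "pure K B (op_dg K A) v a" x] x by simp
      qed
    qed
    then show ?thesis by (simp only: b.const c.const)
  qed
  have c_b: "?r (c.action x a) b = sg M (p * q) (\<rho> x (pure K B (op_dg K A) b a))"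
    if x: "x \<in> carrier M" and b: "b \<in> gr B q" and a: "a \<in> gr A p" for x a b p q
  proof -
    have bc: "b \<in> carrier B" and ao: "a \<in> gr (op_dg K A) p" and ac: "a \<in> carrier (op_dg K A)"
      using b a by simp_all
    have xa: "c.action x a \<in> carrier M" using x ac by (rule c.action_closed)
    have "\<forall>\<^sub>F v in B.unit_filter. \<forall>\<^sub>F u in Ao.unit_filter.
        ?r (c.action x a) b = sg M (p * q) (\<rho> x (pure K B (op_dg K A) b a))"
      using c.action_limit[OF x ac] B.eventually_unit[OF bc]
    proof eventually_elim
      case (elim v)
      then have v: "v \<in> carrier B" "v \<otimes>\<^bsub>B\<^esub> b = b" using B.gr_closed by blast+
      from b.action_limit[OF xa bc] Ao.eventually_unit[OF ac] show ?case
      proof eventually_elim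
        case (elim u)
        then have u: "u \<in> carrier (op_dg K A)" and au: "a \<otimes>\<^bsub>op_dg K A\<^esub> u = a"
          using Ao.gr_closed by blast+
        have "tensor_mult K B (op_dg K A) (pure K B (op_dg K A) v a) (pure K B (op_dg K A) b u) =
            sg S.T (p * q) (pure K B (op_dg K A) b a)"
          using S.mult_pure[OF v(1) ao b u] au by (simp only: v(2))
        moreover have "pure K B (op_dg K A) v a \<in> carrier S.S" "pure K B (op_dg K A) b u \<in> carrier S.S"
          using v u ac bc by auto
        moreover have "\<rho> x (sg S.T (p * q) (pure K B (op_dg K A) b a)) =
            sg M (p * q) (\<rho> x (pure K B (op_dg K A) b a))"
          using R.act.sg_right[of x "pure K B (op_dg K A) b a" "p * q"] x bc ac by simp
        ultimately show ?case
          using R.right_assoc[of "pure K B (op_dg K A) v a" "pure K B (op_dg K A) b u" x] x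
          by (simp only: S.S_mult elim(1) \<open>\<rho> x (pure K B (op_dg K A) v a) = c.action x a\<close>)
      qed
    qed
    then show ?thesis by (simp only: b.const c.const)
  qed
  have ident: "?r (?l a x) b = sg M ((s + q) * p) (\<rho> x (pure K B (op_dg K A) b a))"
    if x: "x \<in> gr M s" and b: "b \<in> gr B q" and a: "a \<in> gr A p" for x a b p q s
  proof -
    have "?r (?l a x) b = sg M (p * s + p * q) (\<rho> x (pure K B (op_dg K A) b a))"
      using x a b c_b[OF R.M.gr_closed[OF x] b a]
      by (simp add: l_hom[OF a x] r.act.sg_left)
    then show ?thesis by (simp add: algebra_simps)
  qed
  have commute_hom: "?l a (?r x b) = ?r (?l a x) b"
    if x: "x \<in> gr M s" and b: "b \<in> gr B q" and a: "a \<in> gr A p" for x a b p q s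
  proof -
    have "?l a (?r x b) = sg M (p * (s + q)) (c.action (?r x b) a)"
      by (rule l_hom[OF a r.right_degree[OF x b]])
    also have "\<dots> = sg M ((s + q) * p) (\<rho> x (pure K B (op_dg K A) b a))"
      using x b a by (simp add: b_c mult.commute)
    finally show ?thesis by (simp add: ident[OF that])
  qed
  have commute: "?r (?l a x) b = ?l a (?r x b)"
    if a: "a \<in> carrier A" and x: "x \<in> carrier M" and b: "b \<in> carrier B" for a x b
    using a
  proof (induction rule: A.gr_induct)
    case (hom p a)
    note a = hom A.gr_closed[OF hom]
    show ?case using x
    proof (induction rule: R.M.gr_induct)
      case (hom s x)
      note x = hom R.M.gr_closed[OF hom]
      show ?case using b
      proof (induction rule: B.gr_induct)
        case (hom q b)
        show ?case by (rule commute_hom[OF x(1) hom a(1), symmetric])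
      qed (use x a in \<open>simp add: r.act.add_right l.act.add_right\<close>)
    qed (use a b in \<open>simp add: r.act.add_left l.act.add_right\<close>)
  qed (use x b in \<open>simp add: r.act.add_left l.act.add_left\<close>)
  have leibniz_hom: "dif M (?r (?l a x) b) = ?r (?l (dif A a) x) b \<oplus>\<^bsub>M\<^esub> sg M p (?r (?l a (dif M x)) b)
      \<oplus>\<^bsub>M\<^esub> sg M (p + s) (?r (?l a x) (dif B b))"
    if a: "a \<in> gr A p" and x: "x \<in> gr M s" and b: "b \<in> gr B q" for a x b p q s
  proof -
    note d = A.dif_degree[OF a] R.M.dif_degree[OF x] B.dif_degree[OF b]
    note facts = a x b d
    have ac: "a \<in> carrier A" "dif A a \<in> carrier A" and bc: "b \<in> carrier B" "dif B b \<in> carrier B"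
      and xc: "x \<in> carrier M" using facts by simp_all
    let ?u = "\<rho> x (pure K B (op_dg K A) b (dif A a))" and ?v = "\<rho> (dif M x) (pure K B (op_dg K A) b a)"
    let ?w = "\<rho> x (pure K B (op_dg K A) (dif B b) a)"
    have c: "?u \<in> carrier M" "?v \<in> carrier M" "?w \<in> carrier M" using ac bc xc by simp_all
    let ?k = "(s + q) * p"
    have "dif M (?r (?l a x) b) =
        sg M ?k ?v \<oplus>\<^bsub>M\<^esub> (sg M (?k + s) ?w \<oplus>\<^bsub>M\<^esub> sg M (?k + (s + q)) ?u)"
      using ac bc xc
      by (simp add: ident[OF x b a] R.M.dif.sg R.right_leibniz[OF x] S.dif_pure[OF b] \<rho>T.add_right
          \<rho>T.sg_right R.M.sg_add)
    moreover have "?r (?l (dif A a) x) b = sg M (?k + (s + q)) ?u"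
      using ident[OF x b d(1)] by (simp add: algebra_simps)
    moreover have "sg M p (?r (?l a (dif M x)) b) = sg M ?k ?v"
      using ident[OF d(2) b a] c by simp (rule sg_cong, auto)
    moreover have "sg M (p + s) (?r (?l a x) (dif B b)) = sg M (?k + s) ?w"
      using ident[OF x d(3) a] c by simp (rule sg_cong, auto)
    ultimately show ?thesis using c by (simp add: R.M.a_ac)
  qed
  have leibniz: "dif M (?r (?l a x) b) = ?r (?l (dif A a) x) b \<oplus>\<^bsub>M\<^esub> sg M p (?r (?l a (dif M x)) b)
      \<oplus>\<^bsub>M\<^esub> sg M (p + s) (?r (?l a x) (dif B b))"
    if a: "a \<in> gr A p" and x: "x \<in> gr M s" and b: "b \<in> carrier B" for a x b p s
    using b
  proof (induction rule: B.gr_induct)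
    case (hom q b)
    show ?case by (rule leibniz_hom[OF a x hom])
  next
    case (add b b')
    then show ?case using A.gr_closed[OF a] R.M.gr_closed[OF x]
      by (simp add: r.act.add_right R.M.dif.add B.dif.add R.M.sg_add R.M.a_ac)
  qed
  have "dg_bimodule K A B M ?l ?r"
    by (intro dg_bimodule.intro dg_bimodule_axioms.intro l.graded_left_module_axioms
        r.graded_right_module_axioms R.M.dg_module_axioms commute leibniz)
  moreover have "right_identified K A B M ?l ?r \<rho>"
    unfolding right_identified_def
  proof (intro allI ballI)
    fix p q s a b x assume *: "a \<in> gr A p" "b \<in> gr B q" "x \<in> gr M s"
    then show "\<rho> x (pure K B (op_dg K A) b a) = sg M ((s + q) * p) (?r (?l a x) b)"
      by (simp add: ident[OF *(3,2,1)])
  qed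
  ultimately show ?thesis by blast
qed
end

section \<open>Uniqueness of the identified structures\<close>

lemma one_to_oneI:
  assumes "\<And>s. P s \<Longrightarrow> \<exists>t. Q t \<and> R s t" and "\<And>t. Q t \<Longrightarrow> \<exists>s. P s \<and> R s t"
    and "\<And>s t t'. P s \<Longrightarrow> Q t \<Longrightarrow> Q t' \<Longrightarrow> R s t \<Longrightarrow> R s t' \<Longrightarrow> t = t'"
    and "\<And>s s' t. P s \<Longrightarrow> P s' \<Longrightarrow> Q t \<Longrightarrow> R s t \<Longrightarrow> R s' t \<Longrightarrow> s = s'"
  shows "one_to_one P Q R"
  unfolding one_to_one_def using assms by metis

context tensor_algebra
begin

lemma right_action_eqI:
  fixes M :: "('k, 'm) dg"
  assumes "graded_right_module K S M \<rho>" "graded_right_module K S M \<rho>'"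
    and eq: "\<And>p q s a b x. a \<in> gr A p \<Longrightarrow> b \<in> gr B q \<Longrightarrow> x \<in> gr M s \<Longrightarrow> \<rho> x (a \<diamondop> b) = \<rho>' x (a \<diamondop> b)"
  shows "\<rho> = \<rho>'"
proof -
  interpret R: graded_right_module K S M \<rho> by fact
  interpret R': graded_right_module K S M \<rho>' by fact
  have "\<rho> x t = \<rho>' x t" if x: "x \<in> carrier M" and t: "t \<in> carrier T" for x t
    using x
  proof (induction rule: R.M.gr_induct)
    case (hom s x)
    show ?case using t
    proof (induction rule: homogeneous_pure_induct)
      case (add t t')
      then show ?case
        using R.act.add_right[of x t t'] R'.act.add_right[of x t t'] R.M.gr_closed[OF hom] by simp
    qed (rule eq[OF _ _ hom])
  qed (use t in \<open>simp add: R.act.add_left R'.act.add_left\<close>)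
  then show ?thesis
    using R.right_ext R'.right_ext unfolding ext2_def fun_eq_iff by (metis S_fields(1))
qed

lemma left_action_eqI:
  fixes M :: "('k, 'm) dg"
  assumes "graded_left_module K S M \<mu>" "graded_left_module K S M \<mu>'"
    and eq: "\<And>p q s a b x. a \<in> gr A p \<Longrightarrow> b \<in> gr B q \<Longrightarrow> x \<in> gr M s \<Longrightarrow> \<mu> (a \<diamondop> b) x = \<mu>' (a \<diamondop> b) x"
  shows "\<mu> = \<mu>'"
proof -
  interpret L: graded_left_module K S M \<mu> by fact
  interpret L': graded_left_module K S M \<mu>' by fact
  have "\<mu> t x = \<mu>' t x" if x: "x \<in> carrier M" and t: "t \<in> carrier T" for x t
    using x
  proof (induction rule: L.M.gr_induct)
    case (hom s x)
    show ?case using t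
    proof (induction rule: homogeneous_pure_induct)
      case (add t t')
      then show ?case
        using L.act.add_left[of t t' x] L'.act.add_left[of t t' x] L.M.gr_closed[OF hom] by simp
    qed (rule eq[OF _ _ hom])
  qed (use t in \<open>simp add: L.act.add_right L'.act.add_right\<close>)
  then show ?thesis
    using L.left_ext L'.left_ext unfolding ext2_def fun_eq_iff by (metis S_fields(1))
qed

end

text \<open>
  The two actions of a bimodule can be recovered from the elements \<open>axb\<close>, since one of \<open>a\<close> and \<open>b\<close>
  can be taken to be a local unit.
\<close>

lemma bimodule_actions_eqI:
  fixes M :: "('k, 'm) dg"
  assumes 1: "dg_bimodule K A B M l r" and 2: "dg_bimodule K A B M l' r'"
    and eq: "\<And>p q s a b x. a \<in> gr A p \<Longrightarrow> b \<in> gr B q \<Longrightarrow> x \<in> gr M s \<Longrightarrow> r (l a x) b = r' (l' a x) b"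
  shows "l = l' \<and> r = r'"
proof -
  interpret M: dg_module K M using 1 by (rule dg_bimodule.axioms(3))
  interpret U: dg_bimodule K A B M l r by fact
  interpret V: dg_bimodule K A B M l' r' by fact
  have axb: "r (l a x) b = r' (l' a x) b"
    if a: "a \<in> carrier A" and x: "x \<in> carrier M" and b: "b \<in> carrier B" for a x b
    using a
  proof (induction rule: U.left.gr_induct)
    case (hom p a)
    note a = hom U.left.gr_closed[OF hom]
    show ?case using x
    proof (induction rule: M.gr_induct)
      case (hom s x)
      note x = hom M.gr_closed[OF hom]
      show ?case using b
      proof (induction rule: U.right.gr_induct)
        case (hom q b)
        show ?case by (rule eq[OF a(1) hom x(1)])
      qed (use x a in \<open>simp add: U.right.act.add_right V.right.act.add_right\<close>)
    qed (use a b in \<open>simp add: U.right.act.add_left V.right.act.add_left U.left.act.add_right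
        V.left.act.add_right\<close>)
  qed (use x b in \<open>simp add: U.right.act.add_left V.right.act.add_left U.left.act.add_left
        V.left.act.add_left\<close>)
  have "r x b = r' x b" if x: "x \<in> carrier M" and b: "b \<in> carrier B" for x b
  proof -
    have "\<forall>\<^sub>F u in U.left.unit_filter. r x b = r' x b"
      using U.left.eventually_left_unit[OF x] V.left.eventually_left_unit[OF x]
      by eventually_elim (use axb x b U.left.gr_closed in metis)
    then show ?thesis using eventually_const[OF U.left.unit_filter_nontrivial] by simp
  qed
  moreover have "l a x = l' a x" if a: "a \<in> carrier A" and x: "x \<in> carrier M" for a x
  proof -
    have "l a x \<in> carrier M" "l' a x \<in> carrier M" using a x by simp_all
    from U.right.eventually_right_unit[OF this(1)] V.right.eventually_right_unit[OF this(2)]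
    have "\<forall>\<^sub>F v in U.right.unit_filter. l a x = l' a x"
      by eventually_elim (use axb a x U.right.gr_closed in metis)
    then show ?thesis using eventually_const[OF U.right.unit_filter_nontrivial] by simp
  qed
  ultimately show ?thesis
    using U.left.left_ext V.left.left_ext U.right.right_ext V.right.right_ext
    unfolding ext2_def fun_eq_iff by metis
qed


section \<open>The exchange of the tensor factors\<close>

context bi_algebras
begin

text \<open>
  The exchange $a \otimes b^o \mapsto (-1)^{|a||b|} b \otimes a^o$ is an antihomomorphism from
  $A \otimes B^{op}$ to $B \otimes A^{op}$.
\<close>

definition exchange :: "('a \<times> 'b \<Rightarrow>\<^sub>0 int) set \<Rightarrow> ('b \<times> 'a \<Rightarrow>\<^sub>0 int) set" where
  "exchange = T.lift S.T (koszul A (op_dg K B) S.T (\<lambda>a b. S.tensor_pure b a))"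

lemma exchange_linear_pure:
  shows exchange_linear: "linear_map K T.T S.T exchange"
    and exchange_pure: "a \<in> gr A p \<Longrightarrow> b \<in> gr B q \<Longrightarrow>
      exchange (T.tensor_pure a b) = sg S.T (p * q) (S.tensor_pure b a)"
proof -
  have pre: "bilinear_map K A (op_dg K B) S.T (\<lambda>a b. S.tensor_pure b a)"
    using S.pure.add_right S.pure.smult_right
    by (intro bilinear_mapI) (simp_all add: S.pure.add_left S.pure.smult_left)
  note k = A.graded_module_axioms Bo.graded_module_axioms S.T.k_module_axioms pre
  note l = S.T.k_module_axioms koszul_bilinear[OF k]
  show "linear_map K T.T S.T exchange" unfolding exchange_def by (rule T.lift_linear[OF l])
  show "exchange (T.tensor_pure a b) = sg S.T (p * q) (S.tensor_pure b a)" if "a \<in> gr A p" "b \<in> gr B q"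
    unfolding exchange_def using that T.lift_pure[OF l, of a b] koszul_homogeneous[OF k, of a p b q]
    by simp
qed

sublocale ex: lin_map K T.T S.T exchange
  by unfold_locales (rule exchange_linear)

lemma exchange_degree: "t \<in> gr T.T n \<Longrightarrow> exchange t \<in> gr S.T n"
proof (induction rule: T.T_gr_induct)
  case (pure p q a b)
  then have "S.tensor_pure b a \<in> gr S.T n" using S.pure_degree[of b q a p] by (simp add: add.commute)
  then show ?case using pure by (simp add: exchange_pure)
qed (simp add: ex.add S.TG.gr_add)

lemma exchange_mult:
  assumes t: "t \<in> gr T.T m" and t': "t' \<in> gr T.T n"
  shows "exchange (tensor_mult K A (op_dg K B) t t') =
    sg S.T (m * n) (tensor_mult K B (op_dg K A) (exchange t') (exchange t))"
  using t
proof (induction rule: T.T_gr_induct)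
  case (pure p q a b)
  have ab: "a \<in> gr A p" "b \<in> gr B q" "a \<in> carrier A" "b \<in> carrier B" and m: "m = p + q"
    using pure by simp_all
  show ?case using t'
  proof (induction rule: T.T_gr_induct)
    case (pure p' q' a' b')
    have ab': "a' \<in> gr A p'" "b' \<in> gr B q'" "a' \<in> carrier A" "b' \<in> carrier B" and n: "n = p' + q'"
      using pure by simp_all
    have d: "a \<otimes>\<^bsub>A\<^esub> a' \<in> gr A (p + p')" "b' \<otimes>\<^bsub>B\<^esub> b \<in> gr B (q' + q)"
      using ab ab' A.mult_degree B.mult_degree by auto
    let ?y = "S.tensor_pure (b' \<otimes>\<^bsub>B\<^esub> b) (a \<otimes>\<^bsub>A\<^esub> a')"
    have "tensor_mult K A (op_dg K B) (T.tensor_pure a b) (T.tensor_pure a' b') =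
        sg T.T (q * p' + q * q') (T.tensor_pure (a \<otimes>\<^bsub>A\<^esub> a') (b' \<otimes>\<^bsub>B\<^esub> b))"
      using ab ab' d by (simp add: T.mult_pure B.op_mult T.pure.sg_right[unfolded B.op_sg])
    then have "exchange (tensor_mult K A (op_dg K B) (T.tensor_pure a b) (T.tensor_pure a' b')) =
        sg S.T (q * p' + q * q' + (p + p') * (q' + q)) ?y"
      using d by (simp add: ex.sg exchange_pure[OF d])
    moreover have "tensor_mult K B (op_dg K A) (exchange (T.tensor_pure a' b')) (exchange (T.tensor_pure a b)) =
        sg S.T (p * q + (p' * q' + (p' * q + p' * p))) ?y"
      using ab ab' d by (simp add: exchange_pure S.tm.sg_left S.tm.sg_right S.mult_pure A.op_mult
          S.pure.sg_right[unfolded A.op_sg])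
    moreover have "sg S.T (q * p' + q * q' + (p + p') * (q' + q)) ?y =
        sg S.T (m * n + (p * q + (p' * q' + (p' * q + p' * p)))) ?y"
      unfolding m n by (rule sg_cong) auto
    ultimately show ?case using d by simp
  next
    case (add u v)
    then show ?case
      using ab by (simp add: T.tm.add_right ex.add S.tm.add_left S.T.sg_add)
  qed
next
  case (add u v)
  then show ?case
    using T.TG.gr_closed[OF t'] by (simp add: T.tm.add_left ex.add S.tm.add_right S.T.sg_add)
qed

lemma exchange_dif:
  assumes t: "t \<in> carrier T.T"
  shows "exchange (tensor_dif K A (op_dg K B) t) = tensor_dif K B (op_dg K A) (exchange t)"
  using t
proof (induction rule: T.homogeneous_pure_induct)
  case (pure p q a b)
  have ab: "a \<in> gr A p" "b \<in> gr B q" "a \<in> carrier A" "b \<in> carrier B" using pure by simp_all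
  note d = A.dif_degree[OF ab(1)] B.dif_degree[OF ab(2)]
  let ?v = "S.tensor_pure b (dif A a)" and ?w = "S.tensor_pure (dif B b) a"
  have "exchange (tensor_dif K A (op_dg K B) (T.tensor_pure a b)) =
      sg S.T ((p + 1) * q) ?v \<oplus>\<^bsub>S.T\<^esub> sg S.T (p + p * (q + 1)) ?w"
    using ab d by (simp add: T.dif_pure ex.add ex.sg exchange_pure)
  moreover have "tensor_dif K B (op_dg K A) (exchange (T.tensor_pure a b)) =
      sg S.T (p * q) ?w \<oplus>\<^bsub>S.T\<^esub> sg S.T (p * q + q) ?v"
    using ab d by (simp add: exchange_pure S.td.sg S.dif_pure[OF ab(2)] S.T.sg_add)
  moreover have "sg S.T (p + p * (q + 1)) ?w = sg S.T (p * q) ?w" by (rule sg_cong) auto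
  moreover have "sg S.T ((p + 1) * q) ?v = sg S.T (p * q + q) ?v" by (simp add: algebra_simps)
  ultimately show ?case using ab d by (simp add: S.T.a_comm)
qed (simp add: ex.add T.td.add S.td.add)

end

text \<open>
  The roles of \<open>A\<close> and \<open>B\<close> are symmetric, and the sign of the exchange occurs twice. Hence the
  exchange is bijective.
\<close>

lemma exchange_exchange:
  assumes "dg_algebra_ei K A" "dg_algebra_ei K B" and t: "t \<in> carrier (tensor_module K B (op_dg K A))"
  shows "bi_algebras.exchange K A B (bi_algebras.exchange K B A t) = t"
proof -
  interpret A: dg_algebra_ei K A by fact
  interpret B: dg_algebra_ei K B by fact
  interpret AB: bi_algebras K A B ..
  interpret BA: bi_algebras K B A ..
  show ?thesis using t
  proof (induction rule: AB.S.homogeneous_pure_induct)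
    case (pure q p b a)
    then have ba: "b \<in> gr B q" "a \<in> gr A p" by simp_all
    then show ?case
      by (simp add: BA.exchange_pure AB.ex.sg AB.exchange_pure)
  qed (simp add: BA.ex.add AB.ex.add)
qed

context bi_algebras
begin

lemma exchange_surj: "exchange ` carrier T.T = carrier S.T"
proof
  interpret flip: bi_algebras K B A ..
  show "exchange ` carrier T.T \<subseteq> carrier S.T" by auto
  show "carrier S.T \<subseteq> exchange ` carrier T.T"
  proof
    fix s assume "s \<in> carrier S.T"
    then show "s \<in> exchange ` carrier T.T"
      using exchange_exchange[OF A.dg_algebra_ei_axioms B.dg_algebra_ei_axioms] flip.ex.closed
      by (metis imageI)
  qed
qed

lemma exchange_antihom:
  "dg_antihom K (tensor_dg K A (op_dg K B)) (tensor_dg K B (op_dg K A)) exchange"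
proof
  show "linear_map K (tensor_dg K A (op_dg K B)) (tensor_dg K B (op_dg K A)) exchange"
    using exchange_linear by (simp add: upd_linear[OF T.S_upd] upd_linear[OF S.S_upd])
qed (use exchange_degree exchange_mult exchange_dif exchange_surj in simp_all)

text \<open>
  The signs of the exchange, of the passage from right to left modules and of the identification with
  right modules add up to $|a||b| + (|a|+|b|)|x| + (|x|+|b|)|a| \equiv |b||x|$.
\<close>

lemma left_module_of_bimodule:
  fixes M :: "('k, 'm) dg"
  assumes "dg_bimodule K A B M l r"
  shows "\<exists>\<mu>. left_dg_module K (tensor_dg K A (op_dg K B)) M \<mu> \<and> left_identified K A B M l r \<mu>"
proof -
  interpret M: dg_module K M using assms by (rule dg_bimodule.axioms(3))
  interpret U: dg_bimodule K A B M l r by fact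
  obtain \<rho> where \<rho>: "right_dg_module K (tensor_dg K B (op_dg K A)) M \<rho>" "right_identified K A B M l r \<rho>"
    using right_module_of_bimodule[OF assms] by blast
  interpret e: dg_antihom K "tensor_dg K A (op_dg K B)" "tensor_dg K B (op_dg K A)" exchange
    by (rule exchange_antihom)
  interpret R: right_dg_module K "tensor_dg K B (op_dg K A)" M \<rho> by (rule \<rho>(1))
  have "graded_right_module K (tensor_dg K B (op_dg K A)) M \<rho>" ..
  note hom = e.left_action_homogeneous[OF this]
  let ?\<mu> = "e.left_action M \<rho>"
  have "?\<mu> (T.tensor_pure a b) x = sg M (q * s) (r (l a x) b)"
    if a: "a \<in> gr A p" and b: "b \<in> gr B q" and x: "x \<in> gr M s" for p q s a b x
  proof -
    have ab: "a \<in> carrier A" "b \<in> carrier B" "x \<in> carrier M" using a b x by simp_all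
    have t: "T.tensor_pure a b \<in> gr (tensor_dg K A (op_dg K B)) (p + q)"
      using T.pure_degree[OF a, of b q] b by simp
    have "?\<mu> (T.tensor_pure a b) x = sg M ((p + q) * s) (\<rho> x (sg S.T (p * q) (S.tensor_pure b a)))"
      using hom[OF t x] exchange_pure[OF a b] by simp
    also have "\<dots> = sg M ((p + q) * s + p * q + (s + q) * p) (r (l a x) b)"
      using R.act.sg_right[of x "S.tensor_pure b a" "p * q"] \<rho>(2) a b x ab
      by (simp add: right_identified_def add.assoc)
    also have "\<dots> = sg M (q * s) (r (l a x) b)" by (rule sg_cong) auto
    finally show ?thesis .
  qed
  then show ?thesis using e.left_action_dg_module[OF \<rho>(1)] unfolding left_identified_def by blast
qed

lemma bimodule_of_left_module:
  fixes M :: "('k, 'm) dg"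
  assumes \<mu>: "left_dg_module K (tensor_dg K A (op_dg K B)) M \<mu>"
  shows "\<exists>l r. dg_bimodule K A B M l r \<and> left_identified K A B M l r \<mu>"
proof -
  interpret flip: bi_algebras K B A ..
  interpret e: dg_antihom K "tensor_dg K B (op_dg K A)" "tensor_dg K A (op_dg K B)" flip.exchange
    by (rule flip.exchange_antihom)
  interpret L: left_dg_module K "tensor_dg K A (op_dg K B)" M \<mu> by fact
  have "graded_left_module K (tensor_dg K A (op_dg K B)) M \<mu>" ..
  note hom = e.right_action_homogeneous[OF this]
  let ?\<rho> = "e.right_action M \<mu>"
  obtain l r where lr: "dg_bimodule K A B M l r" "right_identified K A B M l r ?\<rho>"
    using bimodule_of_right_module[OF e.right_action_dg_module[OF \<mu>]] by blast
  have "\<mu> (T.tensor_pure a b) x = sg M (q * s) (r (l a x) b)"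
    if a: "a \<in> gr A p" and b: "b \<in> gr B q" and x: "x \<in> gr M s" for p q s a b x
  proof -
    interpret U: dg_bimodule K A B M l r by (rule lr(1))
    have ab: "a \<in> carrier A" "b \<in> carrier B" "x \<in> carrier M" using a b x L.M.gr_closed by simp_all
    have t: "S.tensor_pure b a \<in> gr (tensor_dg K B (op_dg K A)) (q + p)"
      using S.pure_degree[OF b, of a p] a by simp
    have "?\<rho> x (S.tensor_pure b a) = sg M (s * (q + p)) (\<mu> (sg T.T (q * p) (T.tensor_pure a b)) x)"
      using hom[OF x t] flip.exchange_pure[OF b a] by simp
    also have "\<dots> = sg M (s * (q + p) + q * p) (\<mu> (T.tensor_pure a b) x)"
      using L.act.sg_left[of "T.tensor_pure a b" x "q * p"] ab by simp
    finally have "sg M (s * (q + p) + q * p) (\<mu> (T.tensor_pure a b) x) = sg M ((s + q) * p) (r (l a x) b)"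
      using lr(2) a b x by (simp add: right_identified_def)
    then have "sg M (s * (q + p) + q * p + (s * (q + p) + q * p)) (\<mu> (T.tensor_pure a b) x) =
        sg M (s * (q + p) + q * p + (s + q) * p) (r (l a x) b)"
      using ab L.M.sg_sg by (metis L.act.closed T.S_fields(1) T.pure_closed U.left.act.closed
          U.right.act.closed B.op_fields(1))
    moreover have "sg M (s * (q + p) + q * p + (s + q) * p) (r (l a x) b) = sg M (q * s) (r (l a x) b)"
      by (rule sg_cong) auto
    ultimately show ?thesis by simp
  qed
  then show ?thesis using lr(1) unfolding left_identified_def by blast
qed

lemma right_one_to_one:
  fixes M :: "('k, 'm) dg"
  shows "one_to_one (\<lambda>(l, r). dg_bimodule K A B M l r)
    (\<lambda>\<rho>. right_dg_module K (tensor_dg K B (op_dg K A)) M \<rho>)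
    (\<lambda>(l, r) \<rho>. right_identified K A B M l r \<rho>)"
proof (rule one_to_oneI; clarsimp)
  show "\<exists>\<rho>. right_dg_module K (tensor_dg K B (op_dg K A)) M \<rho> \<and> right_identified K A B M l r \<rho>"
    if "dg_bimodule K A B M l r" for l r using right_module_of_bimodule[OF that] .
  show "\<exists>l r. dg_bimodule K A B M l r \<and> right_identified K A B M l r \<rho>"
    if "right_dg_module K (tensor_dg K B (op_dg K A)) M \<rho>" for \<rho>
    using bimodule_of_right_module[OF that] .
next
  fix l r \<rho> \<rho>'
  assume *: "right_dg_module K (tensor_dg K B (op_dg K A)) M \<rho>"
    "right_dg_module K (tensor_dg K B (op_dg K A)) M \<rho>'"
    "right_identified K A B M l r \<rho>" "right_identified K A B M l r \<rho>'"
  show "\<rho> = \<rho>'"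
    by (rule S.right_action_eqI[OF right_dg_module.axioms(1)[OF *(1)] right_dg_module.axioms(1)[OF *(2)]])
      (use *(3,4) in \<open>simp add: right_identified_def\<close>)
next
  fix l r l' r' \<rho>
  assume *: "dg_bimodule K A B M l r" "dg_bimodule K A B M l' r'"
    "right_identified K A B M l r \<rho>" "right_identified K A B M l' r' \<rho>"
  interpret M: dg_module K M using *(1) by (rule dg_bimodule.axioms(3))
  interpret U: dg_bimodule K A B M l r by fact
  interpret V: dg_bimodule K A B M l' r' by fact
  show "l = l' \<and> r = r'"
  proof (rule bimodule_actions_eqI[OF *(1,2)])
    fix p q s a b x assume h: "a \<in> gr A p" "b \<in> gr B q" "x \<in> gr M s"
    then have c: "r (l a x) b \<in> carrier M" "r' (l' a x) b \<in> carrier M" by simp_all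
    have "sg M ((s + q) * p) (r (l a x) b) = sg M ((s + q) * p) (r' (l' a x) b)"
      using *(3,4) h unfolding right_identified_def by metis
    then show "r (l a x) b = r' (l' a x) b" using c by (rule M.sg_inject)
  qed
qed

lemma left_one_to_one:
  fixes M :: "('k, 'm) dg"
  shows "one_to_one (\<lambda>(l, r). dg_bimodule K A B M l r)
    (\<lambda>\<mu>. left_dg_module K (tensor_dg K A (op_dg K B)) M \<mu>)
    (\<lambda>(l, r) \<mu>. left_identified K A B M l r \<mu>)"
proof (rule one_to_oneI; clarsimp)
  show "\<exists>\<mu>. left_dg_module K (tensor_dg K A (op_dg K B)) M \<mu> \<and> left_identified K A B M l r \<mu>"
    if "dg_bimodule K A B M l r" for l r using left_module_of_bimodule[OF that] .
  show "\<exists>l r. dg_bimodule K A B M l r \<and> left_identified K A B M l r \<mu>"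
    if "left_dg_module K (tensor_dg K A (op_dg K B)) M \<mu>" for \<mu>
    using bimodule_of_left_module[OF that] .
next
  fix l r \<mu> \<mu>'
  assume *: "left_dg_module K (tensor_dg K A (op_dg K B)) M \<mu>"
    "left_dg_module K (tensor_dg K A (op_dg K B)) M \<mu>'"
    "left_identified K A B M l r \<mu>" "left_identified K A B M l r \<mu>'"
  show "\<mu> = \<mu>'"
    by (rule T.left_action_eqI[OF left_dg_module.axioms(1)[OF *(1)] left_dg_module.axioms(1)[OF *(2)]])
      (use *(3,4) in \<open>simp add: left_identified_def\<close>)
next
  fix l r l' r' \<mu>
  assume *: "dg_bimodule K A B M l r" "dg_bimodule K A B M l' r'"
    "left_identified K A B M l r \<mu>" "left_identified K A B M l' r' \<mu>"
  interpret M: dg_module K M using *(1) by (rule dg_bimodule.axioms(3))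
  interpret U: dg_bimodule K A B M l r by fact
  interpret V: dg_bimodule K A B M l' r' by fact
  show "l = l' \<and> r = r'"
  proof (rule bimodule_actions_eqI[OF *(1,2)])
    fix p q s a b x assume h: "a \<in> gr A p" "b \<in> gr B q" "x \<in> gr M s"
    then have c: "r (l a x) b \<in> carrier M" "r' (l' a x) b \<in> carrier M" by simp_all
    have "sg M (q * s) (r (l a x) b) = sg M (q * s) (r' (l' a x) b)"
      using *(3,4) h unfolding left_identified_def by metis
    then show "r (l a x) b = r' (l' a x) b" using c by (rule M.sg_inject)
  qed
qed

end

section \<open>Complexes of homomorphisms\<close>

lemma (in k_module) minus_sg: "x \<in> carrier M \<Longrightarrow> y \<in> carrier M \<Longrightarrow> x \<ominus>\<^bsub>M\<^esub> sg M n y = x \<oplus>\<^bsub>M\<^esub> sg M (n + 1) y"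
  by (simp add: sg_def a_minus_def M.minus_minus)

lemma fun_module_simps:
  "carrier (fun_module M N) = carrier M \<rightarrow>\<^sub>E carrier N"
  "f \<oplus>\<^bsub>fun_module M N\<^esub> g = (\<lambda>x\<in>carrier M. f x \<oplus>\<^bsub>N\<^esub> g x)"
  "\<zero>\<^bsub>fun_module M N\<^esub> = (\<lambda>x\<in>carrier M. \<zero>\<^bsub>N\<^esub>)"
  "k \<odot>\<^bsub>fun_module M N\<^esub> f = (\<lambda>x\<in>carrier M. k \<odot>\<^bsub>N\<^esub> f x)"
  by (simp_all add: fun_module_def)

lemma fun_module: 
  assumes "k_module K N"
  shows "k_module K (fun_module M N)"
proof -
  interpret N: k_module K N by fact
  note [simp] = fun_module_simps
  have "abelian_group (fun_module M N)"
  proof (rule abelian_groupI)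
    fix f g h assume *: "f \<in> carrier (fun_module M N)" "g \<in> carrier (fun_module M N)" "h \<in> carrier (fun_module M N)"
    have cl: "f x \<in> carrier N" "g x \<in> carrier N" "h x \<in> carrier N" if "x \<in> carrier M" for x
      using * that by auto
    show "f \<oplus>\<^bsub>fun_module M N\<^esub> g \<in> carrier (fun_module M N)" using cl by simp
    show "f \<oplus>\<^bsub>fun_module M N\<^esub> g \<oplus>\<^bsub>fun_module M N\<^esub> h = f \<oplus>\<^bsub>fun_module M N\<^esub> (g \<oplus>\<^bsub>fun_module M N\<^esub> h)"
      using cl by (auto simp: N.a_assoc)
    show "f \<oplus>\<^bsub>fun_module M N\<^esub> g = g \<oplus>\<^bsub>fun_module M N\<^esub> f"
      using cl by (auto simp: N.a_comm)
    show "\<zero>\<^bsub>fun_module M N\<^esub> \<oplus>\<^bsub>fun_module M N\<^esub> f = f"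
      using * cl by (auto simp: fun_eq_iff PiE_iff extensional_def)
    show "\<exists>g\<in>carrier (fun_module M N). g \<oplus>\<^bsub>fun_module M N\<^esub> f = \<zero>\<^bsub>fun_module M N\<^esub>"
      using cl by (intro bexI[of _ "\<lambda>x\<in>carrier M. \<ominus>\<^bsub>N\<^esub> f x"]) (auto simp: N.l_neg)
  qed simp
  then have "module K (fun_module M N)"
  proof (rule moduleI[OF N.is_cring])
    fix k l f g assume *: "k \<in> carrier K" "l \<in> carrier K" "f \<in> carrier (fun_module M N)" "g \<in> carrier (fun_module M N)"
    have cl: "f x \<in> carrier N" "g x \<in> carrier N" if "x \<in> carrier M" for x
      using * that by auto
    show "k \<odot>\<^bsub>fun_module M N\<^esub> f \<in> carrier (fun_module M N)" using * cl by simp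
    show "(k \<oplus>\<^bsub>K\<^esub> l) \<odot>\<^bsub>fun_module M N\<^esub> f =
        k \<odot>\<^bsub>fun_module M N\<^esub> f \<oplus>\<^bsub>fun_module M N\<^esub> l \<odot>\<^bsub>fun_module M N\<^esub> f"
      using * cl by (auto simp: N.smult_l_distr)
    show "k \<odot>\<^bsub>fun_module M N\<^esub> (f \<oplus>\<^bsub>fun_module M N\<^esub> g) =
        k \<odot>\<^bsub>fun_module M N\<^esub> f \<oplus>\<^bsub>fun_module M N\<^esub> k \<odot>\<^bsub>fun_module M N\<^esub> g"
      using * cl by (auto simp: N.smult_r_distr)
    show "(k \<otimes>\<^bsub>K\<^esub> l) \<odot>\<^bsub>fun_module M N\<^esub> f = k \<odot>\<^bsub>fun_module M N\<^esub> (l \<odot>\<^bsub>fun_module M N\<^esub> f)"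
      using * cl by (auto simp: N.smult_assoc1)
    next
    fix f assume "f \<in> carrier (fun_module M N)"
    then show "\<one>\<^bsub>K\<^esub> \<odot>\<^bsub>fun_module M N\<^esub> f = f"
      by (auto simp: fun_eq_iff PiE_iff extensional_def)
  qed
  then show ?thesis by (rule k_module.intro)
qed

text \<open>
  The conditions on the sets \<open>H n\<close> of maps of degree \<open>n\<close> under which their sum is a complex. The
  differential $d_N \circ f - (-1)^n f \circ d_M$ is written as a sum, with the exponent \<open>n + 1\<close>.
\<close>

locale hom_pieces = M: dg_module K M + N: dg_module K N
  for K :: "'k ring" and M :: "('k, 'm) dg" and N :: "('k, 'n) dg" +
  fixes H :: "int \<Rightarrow> ('m \<Rightarrow> 'n) set"
  assumes H_maps: "H n \<subseteq> graded_maps K M N n"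
    and H_zero: "(\<lambda>x\<in>carrier M. \<zero>\<^bsub>N\<^esub>) \<in> H n"
    and H_add: "f \<in> H n \<Longrightarrow> g \<in> H n \<Longrightarrow> (\<lambda>x\<in>carrier M. f x \<oplus>\<^bsub>N\<^esub> g x) \<in> H n"
    and H_smult: "k \<in> carrier K \<Longrightarrow> f \<in> H n \<Longrightarrow> (\<lambda>x\<in>carrier M. k \<odot>\<^bsub>N\<^esub> f x) \<in> H n"
    and H_dif: "f \<in> H n \<Longrightarrow>
      (\<lambda>x\<in>carrier M. dif N (f x) \<oplus>\<^bsub>N\<^esub> sg N (n + 1) (f (dif M x))) \<in> H (n + 1)"
begin

abbreviation "U \<equiv> fun_module M N"
abbreviation "G \<equiv> hom_graded M N H"

sublocale U: k_module K U
  by (rule fun_module[OF N.k_module_axioms])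

lemma H_linear: "f \<in> H n \<Longrightarrow> lin_map K M N f"
  using H_maps by unfold_locales (auto simp: graded_maps_def)

lemma H_ext: "f \<in> H n \<Longrightarrow> f \<in> extensional (carrier M)"
  using H_maps by (auto simp: graded_maps_def)

lemma H_degree: "f \<in> H n \<Longrightarrow> x \<in> gr M p \<Longrightarrow> f x \<in> gr N (p + n)"
  using H_maps by (fastforce simp: graded_maps_def)

lemma H_U: "f \<in> H n \<Longrightarrow> f \<in> carrier U"
  using lin_map.closed[OF H_linear, of f n] H_ext[of f n] by (simp add: fun_module_simps PiE_iff)

lemma H_minus: "f \<in> H n \<Longrightarrow> \<ominus>\<^bsub>U\<^esub> f \<in> H n"
  using U.smult_l_minus[of "\<one>\<^bsub>K\<^esub>" f] H_smult[of "\<ominus>\<^bsub>K\<^esub> \<one>\<^bsub>K\<^esub>" f n] H_U[of f n]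
  by (simp flip: fun_module_simps(4))

lemma G_carrier: "carrier G = generate (add_monoid U) (\<Union>n. H n)"
  by (simp add: hom_graded_def)

lemma G_simps [simp]: "gr G = H"
  "f \<oplus>\<^bsub>G\<^esub> g = (\<lambda>x\<in>carrier M. f x \<oplus>\<^bsub>N\<^esub> g x)" "\<zero>\<^bsub>G\<^esub> = (\<lambda>x\<in>carrier M. \<zero>\<^bsub>N\<^esub>)"
  "k \<odot>\<^bsub>G\<^esub> f = (\<lambda>x\<in>carrier M. k \<odot>\<^bsub>N\<^esub> f x)"
  by (simp_all add: hom_graded_def fun_module_simps)

lemma sum_H_U: "(\<Union>n. H n) \<subseteq> carrier U"
  using H_U by blast

lemma G_induct [consumes 1, case_names hom add]:
  assumes f: "f \<in> carrier G" and hom: "\<And>n f. f \<in> H n \<Longrightarrow> P f"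
    and add: "\<And>f g. f \<in> carrier G \<Longrightarrow> g \<in> carrier G \<Longrightarrow> P f \<Longrightarrow> P g \<Longrightarrow>
      P (\<lambda>x\<in>carrier M. f x \<oplus>\<^bsub>N\<^esub> g x)"
  shows "P f"
  using f unfolding G_carrier
proof (induction rule: U.generator_induct_neg)
  case zero
  show ?case using hom[OF H_zero] by (simp add: fun_module_simps del: restrict_apply)
next
  case (add f g)
  then show ?case using assms(3)[of f g] by (simp add: fun_module_simps G_carrier del: restrict_apply)
qed (use sum_H_U H_minus hom in blast)+

lemma H_G: "f \<in> H n \<Longrightarrow> f \<in> carrier G"
  unfolding G_carrier by (rule U.generate_incl) blast

lemma G_add_closed: "f \<in> carrier G \<Longrightarrow> g \<in> carrier G \<Longrightarrow> (\<lambda>x\<in>carrier M. f x \<oplus>\<^bsub>N\<^esub> g x) \<in> carrier G"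
  using U.generate_add[of f "\<Union>n. H n" g] unfolding G_carrier by (simp add: fun_module_simps(2) del: restrict_apply)

lemma G_linear: "f \<in> carrier G \<Longrightarrow> lin_map K M N f"
proof (induction rule: G_induct)
  case (add f g)
  interpret f: lin_map K M N f by fact
  interpret g: lin_map K M N g by fact
  show ?case
    by unfold_locales
      (rule linear_mapI, simp_all add: f.add g.add f.smult g.smult N.smult_r_distr N.a_ac)
qed (rule H_linear)

lemma G_ext: "f \<in> carrier G \<Longrightarrow> f \<in> extensional (carrier M)"
  by (induction rule: G_induct) (rule H_ext, assumption, rule restrict_extensional)

lemma G_smult_closed:
  assumes k: "k \<in> carrier K" and f: "f \<in> carrier G"
  shows "(\<lambda>x\<in>carrier M. k \<odot>\<^bsub>N\<^esub> f x) \<in> carrier G"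
  using f
proof (induction rule: G_induct)
  case (hom n f)
  show ?case by (rule H_G[OF H_smult[OF k hom]])
next
  case (add f g)
  have "(\<lambda>x\<in>carrier M. k \<odot>\<^bsub>N\<^esub> (\<lambda>x\<in>carrier M. f x \<oplus>\<^bsub>N\<^esub> g x) x) =
      (\<lambda>x\<in>carrier M. (\<lambda>x\<in>carrier M. k \<odot>\<^bsub>N\<^esub> f x) x \<oplus>\<^bsub>N\<^esub> (\<lambda>x\<in>carrier M. k \<odot>\<^bsub>N\<^esub> g x) x)"
    using k lin_map.closed[OF G_linear[OF add(1)]] lin_map.closed[OF G_linear[OF add(2)]]
    by (auto simp: N.smult_r_distr)
  then show ?case using G_add_closed[OF add(3,4)] by (simp only:)
qed

lemma G_submodule: "submodule (carrier G) K U"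
proof (rule U.submoduleI)
  show "carrier G \<subseteq> carrier U" unfolding G_carrier using U.generate_closed[OF sum_H_U] by blast
  show "\<zero>\<^bsub>U\<^esub> \<in> carrier G" unfolding G_carrier by (rule U.generate_zero)
  show "\<ominus>\<^bsub>U\<^esub> f \<in> carrier G" if "f \<in> carrier G" for f
    using that unfolding G_carrier by (rule U.generate_minus[OF sum_H_U])
qed (use G_add_closed G_smult_closed in \<open>simp_all add: fun_module_simps(2,4) del: restrict_apply\<close>)

lemma G_module: "module K G"
proof -
  have "module K (U\<lparr>carrier := carrier G\<rparr>)"
    by (rule submodule.submodule_is_module[OF G_submodule U.module_axioms])
  then show ?thesis
    by (simp add: hom_graded_def module_def module_axioms_def abelian_group_def abelian_monoid_def
      abelian_group_axioms_def)
qed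

sublocale G: k_module K G
  by (rule k_module.intro) (rule G_module)

lemma sg_G: "f \<in> carrier G \<Longrightarrow> sg G n f = (\<lambda>x\<in>carrier M. sg N n (f x))"
proof -
  assume f: "f \<in> carrier G"
  then interpret f: lin_map K M N f by (rule G_linear)
  have f1: "f = (\<lambda>x\<in>carrier M. f x)" using G_ext[OF f] by (simp add: extensional_restrict)
  have "(\<lambda>x\<in>carrier M. (\<ominus>\<^bsub>K\<^esub> \<one>\<^bsub>K\<^esub>) \<odot>\<^bsub>N\<^esub> f x) \<in> carrier G" by (rule G_smult_closed[OF _ f]) simp
  moreover have "(\<lambda>x\<in>carrier M. (\<ominus>\<^bsub>K\<^esub> \<one>\<^bsub>K\<^esub>) \<odot>\<^bsub>N\<^esub> f x) = (\<lambda>x\<in>carrier M. \<ominus>\<^bsub>N\<^esub> f x)"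
    by (auto simp: N.smult_l_minus)
  ultimately have "\<ominus>\<^bsub>G\<^esub> f = (\<lambda>x\<in>carrier M. \<ominus>\<^bsub>N\<^esub> f x)"
    using f by (intro G.minus_equality) (auto simp: N.l_neg)
  then show ?thesis using f1 by (simp add: sg_def)
qed

lemma G_graded: "graded_module K G"
proof (intro graded_module.intro graded_module_axioms.intro G_module)
  show sub: "submodule (gr G n) K G" for n
  proof (rule G.submoduleI)
    show "gr G n \<subseteq> carrier G" using H_G by auto
    show "\<zero>\<^bsub>G\<^esub> \<in> gr G n" using H_zero by simp
    show "\<ominus>\<^bsub>G\<^esub> f \<in> gr G n" if "f \<in> gr G n" for f
      using that H_smult[of "\<ominus>\<^bsub>K\<^esub> \<one>\<^bsub>K\<^esub>" f n] G.smult_l_minus[of "\<one>\<^bsub>K\<^esub>" f] H_G[of f n]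
      by (metis G.smult_one M.one_closed M.R.a_inv_closed G_simps(1,4))
  qed (use H_add H_smult in auto)
  show "internal_direct_sum G UNIV (gr G)"
  proof (rule internal_direct_sumI[OF G.k_module_axioms N.k_module_axioms sub])
    fix f assume "f \<in> carrier G"
    then show "f \<in> generate (add_monoid G) (\<Union>n\<in>UNIV. gr G n)"
    proof (induction rule: G_induct)
      case (hom n f)
      then show ?case by (intro G.generate_incl) auto
    next
      case (add f g)
      show ?case unfolding G_simps(2)[symmetric, of f g] by (rule G.generate_add[OF add(3,4)])
    qed
  next
    fix n s assume s: "s \<in> gr G n" "s \<noteq> \<zero>\<^bsub>G\<^esub>"
    then have sH: "s \<in> H n" by simp
    obtain p x where x: "x \<in> gr M p" "s x \<noteq> \<zero>\<^bsub>N\<^esub>"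
    proof (rule ccontr)
      assume "\<not> thesis"
      then have z: "s x = \<zero>\<^bsub>N\<^esub>" if "x \<in> gr M p" for x p using that \<open>\<And>p x. x \<in> gr M p \<Longrightarrow> s x \<noteq> \<zero>\<^bsub>N\<^esub> \<Longrightarrow> thesis\<close> by blast
      have "s x = \<zero>\<^bsub>N\<^esub>" if "x \<in> carrier M" for x
        using that by (induction rule: M.gr_induct) (simp_all add: z lin_map.add[OF H_linear[OF sH]])
      then have "s = \<zero>\<^bsub>G\<^esub>" using H_ext[OF sH] by (auto simp: extensional_def fun_eq_iff)
      with s(2) show False ..
    qed
    \<comment> \<open>Only maps of degree \<open>n\<close> have a component of degree \<open>p + n\<close> at an element of degree \<open>p\<close>.\<close>
    let ?h = "\<lambda>f. component N (f x) (p + n)"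
    have "linear_map K G N ?h"
      by (rule linear_mapI)
        (use x M.gr_closed[OF x(1)] lin_map.closed[OF G_linear] in
          \<open>simp_all add: N.component_add N.component_smult\<close>)
    moreover have "?h t = \<zero>\<^bsub>N\<^esub>" if "t \<in> gr G m" "m \<noteq> n" for m t
      using that H_degree[of t m x p] x by (simp add: N.component_homogeneous)
    moreover have "?h s \<noteq> \<zero>\<^bsub>N\<^esub>"
      using H_degree[OF sH x(1)] x(2) by (simp add: N.component_homogeneous)
    ultimately show "\<exists>h. linear_map K G N h \<and> (\<forall>m\<in>UNIV. m \<noteq> n \<longrightarrow> (\<forall>t\<in>gr G m. h t = \<zero>\<^bsub>N\<^esub>)) \<and> h s \<noteq> \<zero>\<^bsub>N\<^esub>"
      by (intro exI[of _ ?h]) blast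
  qed
qed

sublocale GG: graded_module K G
  by (rule G_graded)

definition delta :: "int \<Rightarrow> ('m \<Rightarrow> 'n) \<Rightarrow> 'm \<Rightarrow> 'n" where
  "delta n f = (\<lambda>x\<in>carrier M. dif N (f x) \<oplus>\<^bsub>N\<^esub> sg N (n + 1) (f (dif M x)))"

lemma delta_formula:
  assumes "f \<in> H n"
  shows "(\<lambda>x\<in>carrier M. dif N (f x) \<ominus>\<^bsub>N\<^esub> sg N n (f (dif M x))) = delta n f"
  using lin_map.closed[OF H_linear[OF assms]] by (auto simp: delta_def N.minus_sg)

sublocale delta: graded_family K G G delta
proof
  fix n
  have cl: "f x \<in> carrier N" if "f \<in> H n" "x \<in> carrier M" for f x
    using lin_map.closed[OF H_linear] that by blast
  show "linear_on K G (gr G n) G (delta n)"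
    unfolding linear_on_def
  proof (intro conjI ballI)
    fix f assume "f \<in> gr G n"
    then show "delta n f \<in> carrier G" using H_G[OF H_dif] by (simp add: delta_def)
  next
    fix f g assume "f \<in> gr G n" "g \<in> gr G n"
    then show "delta n (f \<oplus>\<^bsub>G\<^esub> g) = delta n f \<oplus>\<^bsub>G\<^esub> delta n g"
      using cl by (auto simp: delta_def N.dif.add N.sg_add N.a_ac)
  next
    fix k f assume "k \<in> carrier K" "f \<in> gr G n"
    then show "delta n (k \<odot>\<^bsub>G\<^esub> f) = k \<odot>\<^bsub>G\<^esub> delta n f"
      using cl by (auto simp: delta_def N.dif.smult N.sg_smult N.smult_r_distr)
  qed
qed

lemma hom_dif_unique: "\<exists>!D. D \<in> extensional (carrier G) \<and> linear_map K G G D \<and>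
    (\<forall>n. \<forall>f\<in>H n. D f = (\<lambda>x\<in>carrier M. dif N (f x) \<ominus>\<^bsub>N\<^esub> sg N n (f (dif M x))))"
proof -
  let ?E = "graded_ext G G delta"
  interpret E: lin_map K G G ?E by unfold_locales (rule delta.ext_linear)
  let ?D = "restrict ?E (carrier G)"
  have hom: "?E f = delta n f" if "f \<in> H n" for f n using delta.ext_homogeneous that by simp
  have lin: "linear_map K G G ?D"
    by (rule linear_mapI)
      (use E.add E.smult E.closed G.a_closed G.smult_closed in \<open>simp_all del: G_simps\<close>)
  show ?thesis
  proof (rule ex1I[of _ ?D])
    show "?D \<in> extensional (carrier G) \<and> linear_map K G G ?D \<and>
      (\<forall>n. \<forall>f\<in>H n. ?D f = (\<lambda>x\<in>carrier M. dif N (f x) \<ominus>\<^bsub>N\<^esub> sg N n (f (dif M x))))"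
      using lin H_G by (simp add: hom delta_formula)
  next
    fix D assume D: "D \<in> extensional (carrier G) \<and> linear_map K G G D \<and>
      (\<forall>n. \<forall>f\<in>H n. D f = (\<lambda>x\<in>carrier M. dif N (f x) \<ominus>\<^bsub>N\<^esub> sg N n (f (dif M x))))"
    interpret D: lin_map K G G D by unfold_locales (use D in blast)
    have "D f = ?E f" if "f \<in> carrier G" for f
      by (rule GG.gr_eqI[OF that D.lin_map_axioms E.lin_map_axioms])
        (use D in \<open>simp add: hom delta_formula\<close>)
    then show "D = ?D" using D by (auto simp: extensional_def fun_eq_iff)
  qed
qed

abbreviation "Hm \<equiv> hom_dg K M N H"

lemma Hm_upd: "Hm = G\<lparr>monoid.mult := monoid.mult G, dif := dif Hm\<rparr>"
  by (simp add: hom_dg_def Let_def)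

lemmas Hm_fields [simp] = upd_fields[OF Hm_upd]
lemmas Hm_sg [simp] = upd_sg[OF Hm_upd]

lemma
  shows Hm_dif_linear: "linear_map K G G (dif Hm)"
    and Hm_dif: "f \<in> H n \<Longrightarrow> dif Hm f = delta n f"
proof -
  have "dif Hm = (THE D. D \<in> extensional (carrier G) \<and> linear_map K G G D \<and>
    (\<forall>n. \<forall>f\<in>H n. D f = (\<lambda>x\<in>carrier M. dif N (f x) \<ominus>\<^bsub>N\<^esub> sg N n (f (dif M x)))))"
    by (simp add: hom_dg_def Let_def)
  note t = theI'[OF hom_dif_unique, folded this]
  show "linear_map K G G (dif Hm)" using t by blast
  show "dif Hm f = delta n f" if "f \<in> H n" using t that by (simp add: delta_formula)
qed

sublocale Hd: lin_map K G G "dif Hm"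
  by unfold_locales (rule Hm_dif_linear)

lemma Hm_dg_module: "dg_module K Hm"
proof (intro dg_module.intro dg_module_axioms.intro)
  show "graded_module K Hm" using G_graded upd_graded_module[OF Hm_upd] by blast
  show "linear_map K Hm Hm (dif Hm)" using Hm_dif_linear by (simp only: upd_linear[OF Hm_upd])
  show "dif Hm f \<in> gr Hm (n + 1)" if "f \<in> gr Hm n" for f n
    using that H_dif[of f n] by (simp add: Hm_dif delta_def)
  have "dif Hm (dif Hm f) = \<zero>\<^bsub>G\<^esub>" if "f \<in> carrier G" for f
    using that
  proof (induction rule: GG.gr_induct)
    case (hom n f)
    then have f: "f \<in> H n" by simp
    interpret f: lin_map K M N f by (rule H_linear[OF f])
    have d: "delta n f \<in> H (n + 1)" using H_dif[OF f] by (simp add: delta_def)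
    \<comment> \<open>The two mixed terms have opposite signs.\<close>
    have "dif Hm (dif Hm f) = delta (n + 1) (delta n f)" by (simp add: Hm_dif[OF f] Hm_dif[OF d])
    also have "\<dots> = (\<lambda>x\<in>carrier M. \<zero>\<^bsub>N\<^esub>)"
    proof -
      have "sg N (n + 1) y \<oplus>\<^bsub>N\<^esub> sg N (n + 1 + 1) y = \<zero>\<^bsub>N\<^esub>" if "y \<in> carrier N" for y
        using that by (simp add: sg_def N.l_neg N.r_neg)
      then show ?thesis
        by (auto simp: delta_def N.dif.add N.dif.sg N.dif_dif M.dif_dif)
    qed
    finally show ?case by simp
  next
    case (add f g)
    then show ?case using Hd.add[OF add(1,2)] Hd.add[of "dif Hm f" "dif Hm g"] Hd.closed G.l_zero G.zero_closed
      by (simp del: G_simps Hm_fields)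
  qed
  then show "dif Hm (dif Hm f) = \<zero>\<^bsub>Hm\<^esub>" if "f \<in> carrier Hm" for f
    using that by (simp del: G_simps)
qed

end


section \<open>Concrete dg categories\<close>

text \<open>Hom complexes that are closed under composition and contain the identities form a dg category.\<close>

lemma concrete_dg_category:
  fixes Obs :: "(('k, 'm) dg \<times> 's) set"
  assumes "cring K"
    and pieces: "\<And>X Y. X \<in> Obs \<Longrightarrow> Y \<in> Obs \<Longrightarrow> hom_pieces K (fst X) (fst Y) (H X Y)"
    and comp: "\<And>X Y Z p q g f. X \<in> Obs \<Longrightarrow> Y \<in> Obs \<Longrightarrow> Z \<in> Obs \<Longrightarrow> g \<in> H Y Z p \<Longrightarrow> f \<in> H X Y q \<Longrightarrow>
      compose (carrier (fst X)) g f \<in> H X Z (p + q)"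
    and ident: "\<And>X. X \<in> Obs \<Longrightarrow> (\<lambda>x\<in>carrier (fst X). x) \<in> H X X 0"
  shows "dg_category K (concrete_dg_cat K Obs H)"
proof -
  let ?C = "concrete_dg_cat K Obs H"
  have C: "Obj ?C = Obs" "Hom ?C X Y = hom_dg K (fst X) (fst Y) (H X Y)"
    "Comp ?C X Y Z g f = compose (carrier (fst X)) g f" "Ident ?C X = (\<lambda>x\<in>carrier (fst X). x)" for X Y Z g f
    by (simp_all add: concrete_dg_cat_def)
  note car = hom_pieces.Hm_fields(1)[OF pieces]
  have closed: "f x \<in> carrier (fst Y)" if "X \<in> Obs" "Y \<in> Obs" "f \<in> carrier (Hom ?C X Y)" "x \<in> carrier (fst X)" for X Y f x
    using lin_map.closed[OF hom_pieces.G_linear[OF pieces]] that by (simp only: C car)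
  have bil: "bilinear_map K (Hom ?C Y Z) (Hom ?C X Y) (Hom ?C X Z) (Comp ?C X Y Z)"
    if XYZ: "X \<in> Obs" "Y \<in> Obs" "Z \<in> Obs" for X Y Z
  proof -
    interpret XY: hom_pieces K "fst X" "fst Y" "H X Y" by (rule pieces) fact+
    interpret YZ: hom_pieces K "fst Y" "fst Z" "H Y Z" by (rule pieces) fact+
    interpret XZ: hom_pieces K "fst X" "fst Z" "H X Z" by (rule pieces) fact+
    have al: "compose (carrier (fst X)) (\<lambda>x\<in>carrier (fst Y). g x \<oplus>\<^bsub>fst Z\<^esub> g' x) f =
        (\<lambda>x\<in>carrier (fst X). compose (carrier (fst X)) g f x \<oplus>\<^bsub>fst Z\<^esub> compose (carrier (fst X)) g' f x)"
      if "f \<in> carrier XY.G" for g g' f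
      using lin_map.closed[OF XY.G_linear[OF that]] by (auto simp: compose_def)
    have ar: "compose (carrier (fst X)) g (\<lambda>x\<in>carrier (fst X). f x \<oplus>\<^bsub>fst Y\<^esub> f' x) =
        (\<lambda>x\<in>carrier (fst X). compose (carrier (fst X)) g f x \<oplus>\<^bsub>fst Z\<^esub> compose (carrier (fst X)) g f' x)"
      if "g \<in> carrier YZ.G" "f \<in> carrier XY.G" "f' \<in> carrier XY.G" for g f f'
      using lin_map.closed[OF XY.G_linear[OF that(2)]] lin_map.closed[OF XY.G_linear[OF that(3)]]
        lin_map.add[OF YZ.G_linear[OF that(1)]] by (auto simp: compose_def)
    have cl: "compose (carrier (fst X)) g f \<in> carrier XZ.G" if g: "g \<in> carrier YZ.G" and f: "f \<in> carrier XY.G" for g f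
      using g
    proof (induction rule: YZ.G_induct)
      case (hom p g)
      show ?case using f
      proof (induction rule: XY.G_induct)
        case (hom q f)
        show ?case by (rule XZ.H_G[OF comp[OF XYZ \<open>g \<in> H Y Z p\<close> hom]])
      next
        case (add f f')
        show ?case unfolding ar[OF YZ.H_G[OF hom] add(1,2)] by (rule XZ.G_add_closed[OF add(3,4)])
      qed
    next
      case (add g g')
      show ?case unfolding al[OF f] by (rule XZ.G_add_closed[OF add(3,4)])
    qed
    have "bilinear_map K YZ.G XY.G XZ.G (\<lambda>g f. compose (carrier (fst X)) g f)"
    proof (rule bilinear_mapI)
      fix g f k assume g: "g \<in> carrier YZ.G" and f: "f \<in> carrier XY.G" and k: "k \<in> carrier K"
      interpret g: lin_map K "fst Y" "fst Z" g by (rule YZ.G_linear[OF g])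
      interpret f: lin_map K "fst X" "fst Y" f by (rule XY.G_linear[OF f])
      show "compose (carrier (fst X)) (k \<odot>\<^bsub>YZ.G\<^esub> g) f = k \<odot>\<^bsub>XZ.G\<^esub> compose (carrier (fst X)) g f"
        "compose (carrier (fst X)) g (k \<odot>\<^bsub>XY.G\<^esub> f) = k \<odot>\<^bsub>XZ.G\<^esub> compose (carrier (fst X)) g f"
        using k by (auto simp: compose_def g.smult)
    qed (use al ar cl in \<open>simp_all\<close>)
    then show ?thesis
      unfolding bilinear_map_def C
      by (simp only: upd_linear[OF XY.Hm_upd] upd_linear[OF YZ.Hm_upd] upd_linear[OF XZ.Hm_upd]
          XY.Hm_fields YZ.Hm_fields XZ.Hm_fields C(3))
  qed
  show ?thesis
  proof (intro dg_category.intro dg_category_axioms.intro \<open>cring K\<close>)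
    show "dg_module K (Hom ?C X Y)" if "X \<in> Obj ?C" "Y \<in> Obj ?C" for X Y
      using hom_pieces.Hm_dg_module[OF pieces] that by (simp only: C)
    show "bilinear_map K (Hom ?C Y Z) (Hom ?C X Y) (Hom ?C X Z) (Comp ?C X Y Z)"
      if "X \<in> Obj ?C" "Y \<in> Obj ?C" "Z \<in> Obj ?C" for X Y Z
      using bil that by (simp only: C(1))
    show "Comp ?C X Y Z g f \<in> gr (Hom ?C X Z) (p + q)"
      if "X \<in> Obj ?C" "Y \<in> Obj ?C" "Z \<in> Obj ?C" "g \<in> gr (Hom ?C Y Z) p" "f \<in> gr (Hom ?C X Y) q" for X Y Z g f p q
      using that comp
      by (simp only: C hom_pieces.Hm_fields(5)[OF pieces] hom_pieces.G_simps(1)[OF pieces])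
    show "Comp ?C W X Z (Comp ?C X Y Z h g) f = Comp ?C W Y Z h (Comp ?C W X Y g f)"
      if "W \<in> Obj ?C" "X \<in> Obj ?C" "Y \<in> Obj ?C" "Z \<in> Obj ?C" "h \<in> carrier (Hom ?C Y Z)"
        "g \<in> carrier (Hom ?C X Y)" "f \<in> carrier (Hom ?C W X)" for W X Y Z h g f
      using closed[of W X f] that unfolding C(1,3) by (auto simp: compose_def)
    have id: "Ident ?C X \<in> carrier (Hom ?C X X)" if "X \<in> Obs" for X
    proof -
      interpret XX: hom_pieces K "fst X" "fst X" "H X X" by (rule pieces[OF that that])
      show ?thesis using XX.H_G[OF ident[OF that]] unfolding C by (simp only: XX.Hm_fields)
    qed
    then show "Ident ?C X \<in> carrier (Hom ?C X X)" if "X \<in> Obj ?C" for X using that by (simp only: C(1))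
    have ext: "f \<in> extensional (carrier (fst X))" if "X \<in> Obs" "Y \<in> Obs" "f \<in> carrier (Hom ?C X Y)" for X Y f
      using hom_pieces.G_ext[OF pieces] that by (simp only: C car)
    show "Comp ?C X Y Y (Ident ?C Y) f = f"
      if "X \<in> Obj ?C" "Y \<in> Obj ?C" "f \<in> carrier (Hom ?C X Y)" for X Y f
      using closed[of X Y f] ext[of X Y f] that unfolding C(1,3,4)
      by (auto simp: compose_def extensional_def fun_eq_iff)
    show "Comp ?C X X Y f (Ident ?C X) = f"
      if "X \<in> Obj ?C" "Y \<in> Obj ?C" "f \<in> carrier (Hom ?C X Y)" for X Y f
      using ext[of X Y f] that unfolding C(1,3,4)
      by (auto simp: compose_def extensional_def fun_eq_iff)
  next
    fix X Y Z g f p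
    assume "X \<in> Obj ?C" "Y \<in> Obj ?C" "Z \<in> Obj ?C" and g0: "g \<in> gr (Hom ?C Y Z) p" and f0: "f \<in> carrier (Hom ?C X Y)"
    then have XYZ: "X \<in> Obs" "Y \<in> Obs" "Z \<in> Obs" by (simp_all only: C)
    interpret XY: hom_pieces K "fst X" "fst Y" "H X Y" by (rule pieces) fact+
    interpret YZ: hom_pieces K "fst Y" "fst Z" "H Y Z" by (rule pieces) fact+
    interpret XZ: hom_pieces K "fst X" "fst Z" "H X Z" by (rule pieces) fact+
    let ?c = "\<lambda>g f. compose (carrier (fst X)) g f"
    interpret b: bilin_map K YZ.G XY.G XZ.G ?c
    proof unfold_locales
      show "bilinear_map K YZ.G XY.G XZ.G ?c"
        using bil[OF XYZ] unfolding bilinear_map_def C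
        by (simp only: upd_linear[OF XY.Hm_upd] upd_linear[OF YZ.Hm_upd] upd_linear[OF XZ.Hm_upd]
          XY.Hm_fields YZ.Hm_fields XZ.Hm_fields C(3))
    qed
    have g: "g \<in> H Y Z p" using g0 by (simp add: C)
    then interpret g: lin_map K "fst Y" "fst Z" g by (rule YZ.H_linear)
    have gG: "g \<in> carrier YZ.G" "dif YZ.Hm g \<in> carrier YZ.G" using YZ.H_G[OF g] YZ.Hd.closed by blast+
    have "f \<in> carrier XY.G" using f0 unfolding C(2) by (simp only: XY.Hm_fields)
    then have "dif XZ.Hm (?c g f) = ?c (dif YZ.Hm g) f \<oplus>\<^bsub>XZ.G\<^esub> sg XZ.G p (?c g (dif XY.Hm f))"
    proof (induction rule: XY.GG.gr_induct)
      case (hom q f)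
      then have f: "f \<in> H X Y q" by simp
      then interpret f: lin_map K "fst X" "fst Y" f by (rule XY.H_linear)
      have fG: "f \<in> carrier XY.G" "dif XY.Hm f \<in> carrier XY.G" using XY.H_G[OF f] XY.Hd.closed by blast+
      have gd: "dif YZ.Hm g = YZ.delta p g" and fd: "dif XY.Hm f = XY.delta q f"
        and gfd: "dif XZ.Hm (?c g f) = XZ.delta (p + q) (?c g f)"
        by (simp_all only: YZ.Hm_dif[OF g] XY.Hm_dif[OF f] XZ.Hm_dif[OF comp[OF XYZ g f]])
      have cc: "?c g (XY.delta q f) \<in> carrier XZ.G" using b.closed[OF gG(1) fG(2)] by (simp only: fd)
      show ?case unfolding gd fd gfd XZ.sg_G[OF cc] XZ.G_simps(2)
      proof (rule ext)
        fix x
        show "XZ.delta (p + q) (?c g f) x = (\<lambda>x\<in>carrier (fst X). ?c (YZ.delta p g) f x \<oplus>\<^bsub>fst Z\<^esub>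
            (\<lambda>x\<in>carrier (fst X). sg (fst Z) p (?c g (XY.delta q f) x)) x) x"
        proof (cases "x \<in> carrier (fst X)")
          case x: True
          let ?u = "g (dif (fst Y) (f x))"
          have u: "?u \<in> carrier (fst Z)" using x by simp
          have "sg (fst Z) (p + 1) ?u \<oplus>\<^bsub>fst Z\<^esub> sg (fst Z) p ?u = \<zero>\<^bsub>fst Z\<^esub>"
            using u by (simp add: sg_def YZ.N.l_neg YZ.N.r_neg)
          then have canc: "sg (fst Z) (p + 1) ?u \<oplus>\<^bsub>fst Z\<^esub> (sg (fst Z) p ?u \<oplus>\<^bsub>fst Z\<^esub> w) = w"
            if "w \<in> carrier (fst Z)" for w
            using u that by (simp flip: YZ.N.a_assoc)
          show ?thesis
            using x u by (simp add: compose_def XY.delta_def YZ.delta_def XZ.delta_def g.add g.sg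
                YZ.N.sg_add YZ.N.a_assoc canc add.assoc)
        qed (simp add: XZ.delta_def)
      qed
    next
      case (add f f')
      note D = YZ.Hd.closed XY.Hd.closed XZ.Hd.closed
      have "?c g (f \<oplus>\<^bsub>XY.G\<^esub> f') = ?c g f \<oplus>\<^bsub>XZ.G\<^esub> ?c g f'" by (rule b.add_right[OF gG(1) add(1,2)])
      moreover have "dif XZ.Hm (?c g f \<oplus>\<^bsub>XZ.G\<^esub> ?c g f') = dif XZ.Hm (?c g f) \<oplus>\<^bsub>XZ.G\<^esub> dif XZ.Hm (?c g f')"
        by (rule XZ.Hd.add) (rule b.closed[OF gG(1)], fact)+
      moreover have "?c (dif YZ.Hm g) (f \<oplus>\<^bsub>XY.G\<^esub> f') = ?c (dif YZ.Hm g) f \<oplus>\<^bsub>XZ.G\<^esub> ?c (dif YZ.Hm g) f'"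
        by (rule b.add_right[OF gG(2) add(1,2)])
      moreover have "?c g (dif XY.Hm (f \<oplus>\<^bsub>XY.G\<^esub> f')) = ?c g (dif XY.Hm f) \<oplus>\<^bsub>XZ.G\<^esub> ?c g (dif XY.Hm f')"
        unfolding XY.Hd.add[OF add(1,2)] by (rule b.add_right[OF gG(1) D(2)[OF add(1)] D(2)[OF add(2)]])
      ultimately show ?case
        using add b.closed[OF gG(1) add(1)] b.closed[OF gG(1) add(2)] b.closed[OF gG(2) add(1)]
          b.closed[OF gG(2) add(2)] b.closed[OF gG(1) D(2)[OF add(1)]] b.closed[OF gG(1) D(2)[OF add(2)]]
        by (simp only: XZ.G.sg_add XZ.G.a_ac XZ.G.a_closed XZ.G.sg_closed)
    qed
    then show "dif (Hom ?C X Z) (Comp ?C X Y Z g f) =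
        Comp ?C X Y Z (dif (Hom ?C Y Z) g) f \<oplus>\<^bsub>Hom ?C X Z\<^esub>
          sg (Hom ?C X Z) p (Comp ?C X Y Z g (dif (Hom ?C X Y) f))"
      unfolding C by (simp only: XZ.Hm_fields XZ.Hm_sg)
  qed
qed

text \<open>
  A category whose Hom complexes are those of another one, along a map of objects, inherits the axioms,
  and the map of objects extends to an equivalence as soon as it is onto.
\<close>

lemma concrete_dg_cat_fields [simp]:
  "Obj (concrete_dg_cat K Obs H) = Obs"
  "Hom (concrete_dg_cat K Obs H) X Y = hom_dg K (fst X) (fst Y) (H X Y)"
  "Comp (concrete_dg_cat K Obs H) X Y Z g f = compose (carrier (fst X)) g f"
  "Ident (concrete_dg_cat K Obs H) X = (\<lambda>x\<in>carrier (fst X). x)"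
  by (simp_all add: concrete_dg_cat_def)

locale concrete_functor = target: dg_category K "concrete_dg_cat K Obs' H'"
  for K :: "'k ring" and Obs' :: "(('k, 'm) dg \<times> 't) set" and H' +
  fixes Obs :: "(('k, 'm) dg \<times> 's) set" and H and F0
  assumes F0_Obs: "X \<in> Obs \<Longrightarrow> F0 X \<in> Obs'"
    and F0_fst: "X \<in> Obs \<Longrightarrow> fst (F0 X) = fst X"
    and F0_H: "X \<in> Obs \<Longrightarrow> Y \<in> Obs \<Longrightarrow> H' (F0 X) (F0 Y) = H X Y"
begin

lemma source_dg_category: "dg_category K (concrete_dg_cat K Obs H)"
proof (intro dg_category.intro dg_category_axioms.intro target.is_cring, goal_cases)
  case (1 X Y)
  then show ?case using target.Hom_dg[of "F0 X" "F0 Y"] by (simp add: F0_Obs F0_fst F0_H)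
next
  case (2 X Y Z)
  have eq: "Comp (concrete_dg_cat K Obs H) X Y Z = Comp (concrete_dg_cat K Obs' H') (F0 X) (F0 Y) (F0 Z)"
    using 2 by (simp add: fun_eq_iff F0_fst)
  show ?case unfolding eq
    using 2 target.Comp_bilinear[of "F0 X" "F0 Y" "F0 Z"] by (simp add: F0_Obs F0_fst F0_H)
next
  case (3 X Y Z g p f q)
  then show ?case using target.Comp_degree[of "F0 X" "F0 Y" "F0 Z" g p f q] by (simp add: F0_Obs F0_fst F0_H)
next
  case (4 W X Y Z h g f)
  then show ?case
    using target.Comp_assoc[of "F0 W" "F0 X" "F0 Y" "F0 Z" h g f] by (simp add: F0_Obs F0_fst F0_H)
next
  case (5 X)
  then show ?case using target.Ident_carrier[of "F0 X"] by (simp add: F0_Obs F0_fst F0_H)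
next
  case (6 X Y f)
  then show ?case using target.Ident_left[of "F0 X" "F0 Y" f] by (simp add: F0_Obs F0_fst F0_H)
next
  case (7 X Y f)
  then show ?case using target.Ident_right[of "F0 X" "F0 Y" f] by (simp add: F0_Obs F0_fst F0_H)
next
  case (8 X Y Z g p f)
  then show ?case
    using target.Comp_leibniz[of "F0 X" "F0 Y" "F0 Z" g p f] by (simp add: F0_Obs F0_fst F0_H)
qed

lemma equivalence:
  assumes ident: "\<And>Z. Z \<in> Obs' \<Longrightarrow> (\<lambda>x\<in>carrier (fst Z). x) \<in> H' Z Z 0"
    and onto: "\<And>Z. Z \<in> Obs' \<Longrightarrow> \<exists>X\<in>Obs. F0 X = Z"
  shows "dg_equivalence K (concrete_dg_cat K Obs H) (concrete_dg_cat K Obs' H') F0 (\<lambda>X Y f. f)"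
proof (intro dg_equivalence.intro dg_functor.intro dg_functor_axioms.intro dg_equivalence_axioms.intro
    source_dg_category target.dg_category_axioms, goal_cases)
  case (2 X Y)
  then interpret Hm: dg_module K "Hom (concrete_dg_cat K Obs H) X Y"
    by (rule dg_category.Hom_dg[OF source_dg_category])
  show ?case using 2 by (intro linear_mapI) (simp_all add: F0_fst F0_H)
next
  case (9 Z)
  let ?C = "concrete_dg_cat K Obs' H'"
  have Z: "Z \<in> Obj ?C" "Z \<in> Obs'" using 9 by simp_all
  let ?i = "Ident ?C Z" and ?M = "Hom ?C Z Z"
  interpret Hm: dg_module K ?M using target.Hom_dg[OF Z(1,1)] .
  have gr: "gr ?M = H' Z Z" by (simp add: hom_dg_def hom_graded_def Let_def)
  have i: "?i \<in> gr ?M 0" unfolding gr using ident[OF Z(2)] by simp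
  then have ic: "?i \<in> carrier ?M" "dif ?M ?i \<in> carrier ?M" using Hm.gr_closed Hm.dif.closed by blast+
  \<comment> \<open>The Leibniz rule for the identity composed with itself, so that the identity is closed.\<close>
  have "dif ?M ?i = dif ?M ?i \<oplus>\<^bsub>?M\<^esub> dif ?M ?i"
    using target.Comp_leibniz[OF Z(1,1,1) i ic(1)] target.Ident_left[OF Z(1,1)] target.Ident_right[OF Z(1,1)] ic
    by (simp only: sg_even even_zero)
  then have d: "dif ?M ?i = \<zero>\<^bsub>?M\<^esub>" using Hm.M.add.r_cancel_one'[of "dif ?M ?i" "dif ?M ?i"] ic by simp
  have "dg_isomorphic ?C Z Z"
    unfolding dg_isomorphic_def
    using i d target.Ident_left[OF Z(1,1) ic(1)] by blast
  then show ?case using onto[OF Z(2)] by auto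
qed (simp_all add: F0_Obs F0_fst F0_H)

end


section \<open>Homomorphisms of bimodules\<close>

context bi_algebras
begin

definition bi_maps :: "('k, 'm) dg \<times> ('a \<Rightarrow> 'm \<Rightarrow> 'm) \<times> ('m \<Rightarrow> 'b \<Rightarrow> 'm) \<Rightarrow>
    ('k, 'm) dg \<times> ('a \<Rightarrow> 'm \<Rightarrow> 'm) \<times> ('m \<Rightarrow> 'b \<Rightarrow> 'm) \<Rightarrow> int \<Rightarrow> ('m \<Rightarrow> 'm) set" where
  "bi_maps = (\<lambda>(M, l, r) (N, l', r') n. {f \<in> graded_maps K M N n.
     \<forall>p. \<forall>a\<in>gr A p. \<forall>x\<in>carrier M. \<forall>b\<in>carrier B.
       f (r (l a x) b) = sg N (n * p) (r' (l' a (f x)) b)})"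

definition right_maps :: "('k, 'm) dg \<times> ('m \<Rightarrow> ('b \<times> 'a \<Rightarrow>\<^sub>0 int) set \<Rightarrow> 'm) \<Rightarrow>
    ('k, 'm) dg \<times> ('m \<Rightarrow> ('b \<times> 'a \<Rightarrow>\<^sub>0 int) set \<Rightarrow> 'm) \<Rightarrow> int \<Rightarrow> ('m \<Rightarrow> 'm) set" where
  "right_maps = (\<lambda>(M, r) (N, r') n. {f \<in> graded_maps K M N n.
     \<forall>x\<in>carrier M. \<forall>a\<in>carrier (tensor_dg K B (op_dg K A)). f (r x a) = r' (f x) a})"

definition left_maps :: "('k, 'm) dg \<times> (('a \<times> 'b \<Rightarrow>\<^sub>0 int) set \<Rightarrow> 'm \<Rightarrow> 'm) \<Rightarrow>
    ('k, 'm) dg \<times> (('a \<times> 'b \<Rightarrow>\<^sub>0 int) set \<Rightarrow> 'm \<Rightarrow> 'm) \<Rightarrow> int \<Rightarrow> ('m \<Rightarrow> 'm) set" where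
  "left_maps = (\<lambda>(M, l) (N, l') n. {f \<in> graded_maps K M N n.
     \<forall>p. \<forall>a\<in>gr (tensor_dg K A (op_dg K B)) p. \<forall>x\<in>carrier M.
       f (l a x) = sg N (n * p) (l' a (f x))})"

lemma bi_maps_iff: "f \<in> bi_maps (M, l, r) (N, l', r') n \<longleftrightarrow> f \<in> graded_maps K M N n \<and>
    (\<forall>p. \<forall>a\<in>gr A p. \<forall>x\<in>carrier M. \<forall>b\<in>carrier B.
       f (r (l a x) b) = sg N (n * p) (r' (l' a (f x)) b))"
  by (simp add: bi_maps_def)

lemma bi_mapsI:
  fixes M N :: "('k, 'm) dg"
  assumes U: "dg_bimodule K A B M l r" and V: "dg_bimodule K A B N l' r'"
    and f: "f \<in> graded_maps K M N n"
    and eq: "\<And>p q s a b x. a \<in> gr A p \<Longrightarrow> b \<in> gr B q \<Longrightarrow> x \<in> gr M s \<Longrightarrow>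
      f (r (l a x) b) = sg N (n * p) (r' (l' a (f x)) b)"
  shows "f \<in> bi_maps (M, l, r) (N, l', r') n"
proof -
  interpret M: dg_module K M using U by (rule dg_bimodule.axioms(3))
  interpret N: dg_module K N using V by (rule dg_bimodule.axioms(3))
  interpret U: dg_bimodule K A B M l r by fact
  interpret V: dg_bimodule K A B N l' r' by fact
  interpret f: lin_map K M N f using f by unfold_locales (simp add: graded_maps_def)
  have "f (r (l a x) b) = sg N (n * p) (r' (l' a (f x)) b)"
    if a: "a \<in> gr A p" and x: "x \<in> carrier M" and b: "b \<in> carrier B" for p a x b
    using x
  proof (induction rule: M.gr_induct)
    case (hom s x)
    note x = hom M.gr_closed[OF hom]
    show ?case using b
    proof (induction rule: B.gr_induct)
      case (hom q b)
      show ?case by (rule eq[OF a hom x(1)])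
    qed (use x a in \<open>simp add: U.right.act.add_right V.right.act.add_right f.add N.sg_add\<close>)
  qed (use A.gr_closed[OF a] b in \<open>simp add: U.right.act.add_left V.right.act.add_left
      U.left.act.add_right V.left.act.add_right f.add N.sg_add\<close>)
  then show ?thesis using f by (simp add: bi_maps_iff)
qed

text \<open>
  For the differential, both \<open>d(f(axb))\<close> and \<open>f(d(axb))\<close> are expanded into three terms. Those with
  \<open>da\<close> and those with \<open>db\<close> cancel, and the others combine to \<open>a\<cdot>(df)(x)\<cdot>b\<close>.
\<close>

lemma bi_maps_pieces:
  fixes M N :: "('k, 'm) dg"
  assumes U: "dg_bimodule K A B M l r" and V: "dg_bimodule K A B N l' r'"
  shows "hom_pieces K M N (bi_maps (M, l, r) (N, l', r'))"
proof -
  interpret M: dg_module K M using U by (rule dg_bimodule.axioms(3))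
  interpret N: dg_module K N using V by (rule dg_bimodule.axioms(3))
  interpret U: dg_bimodule K A B M l r by fact
  interpret V: dg_bimodule K A B N l' r' by fact
  let ?H = "bi_maps (M, l, r) (N, l', r')"
  have lin: "lin_map K M N f" if "f \<in> ?H n" for f n
    using that by unfold_locales (simp add: bi_maps_iff graded_maps_def)
  have deg: "f x \<in> gr N (p + n)" if "f \<in> ?H n" "x \<in> gr M p" for f n x p
    using that by (simp add: bi_maps_iff graded_maps_def)
  have bi: "f (r (l a x) b) = sg N (n * p) (r' (l' a (f x)) b)"
    if "f \<in> ?H n" "a \<in> gr A p" "x \<in> carrier M" "b \<in> carrier B" for f n a p x b
    using that by (simp add: bi_maps_iff)
  have I: "restrict f (carrier M) \<in> ?H n"
    if "linear_map K M N f" "\<And>x p. x \<in> gr M p \<Longrightarrow> f x \<in> gr N (p + n)"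
      "\<And>p q s a b x. a \<in> gr A p \<Longrightarrow> b \<in> gr B q \<Longrightarrow> x \<in> gr M s \<Longrightarrow>
        f (r (l a x) b) = sg N (n * p) (r' (l' a (f x)) b)" for f n
  proof (rule bi_mapsI[OF U V])
    have f: "lin_map K M N f" by unfold_locales (rule that(1))
    have "linear_map K M N (restrict f (carrier M))"
      by (rule linear_mapI) (simp_all add: lin_map.closed[OF f] lin_map.add[OF f] lin_map.smult[OF f])
    then show "restrict f (carrier M) \<in> graded_maps K M N n"
      using that(2) by (simp add: graded_maps_def)
  qed (simp add: that(3))
  show ?thesis
  proof
    show "?H n \<subseteq> graded_maps K M N n" for n by (auto simp: bi_maps_iff)
    show "(\<lambda>x\<in>carrier M. \<zero>\<^bsub>N\<^esub>) \<in> ?H n" for n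
      by (rule I) (rule linear_mapI, simp_all)
    show "(\<lambda>x\<in>carrier M. f x \<oplus>\<^bsub>N\<^esub> g x) \<in> ?H n" if f: "f \<in> ?H n" and g: "g \<in> ?H n" for f g n
    proof (rule I)
      interpret f: lin_map K M N f by (rule lin[OF f])
      interpret g: lin_map K M N g by (rule lin[OF g])
      show "linear_map K M N (\<lambda>x. f x \<oplus>\<^bsub>N\<^esub> g x)"
        by (rule linear_mapI) (simp_all add: f.add g.add f.smult g.smult N.smult_r_distr N.a_ac)
      show "f x \<oplus>\<^bsub>N\<^esub> g x \<in> gr N (p + n)" if "x \<in> gr M p" for x p
        by (rule N.gr_add[OF deg[OF f that] deg[OF g that]])
      show "f (r (l a x) b) \<oplus>\<^bsub>N\<^esub> g (r (l a x) b) = sg N (n * p) (r' (l' a (f x \<oplus>\<^bsub>N\<^esub> g x)) b)"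
        if "a \<in> gr A p" "b \<in> gr B q" "x \<in> gr M s" for a b x p q s
        using that by (simp add: bi[OF f that(1)] bi[OF g that(1)] V.left.act.add_right
            V.right.act.add_left N.sg_add)
    qed
    show "(\<lambda>x\<in>carrier M. k \<odot>\<^bsub>N\<^esub> f x) \<in> ?H n" if k: "k \<in> carrier K" and f: "f \<in> ?H n" for k f n
    proof (rule I)
      interpret f: lin_map K M N f by (rule lin[OF f])
      show "linear_map K M N (\<lambda>x. k \<odot>\<^bsub>N\<^esub> f x)"
        by (rule linear_mapI)
          (use k in \<open>simp_all add: f.add f.smult N.smult_r_distr A.m_comm flip: N.smult_assoc1\<close>)
      show "k \<odot>\<^bsub>N\<^esub> f x \<in> gr N (p + n)" if "x \<in> gr M p" for x p
        by (rule N.gr_smult[OF k deg[OF f that]])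
      show "k \<odot>\<^bsub>N\<^esub> f (r (l a x) b) = sg N (n * p) (r' (l' a (k \<odot>\<^bsub>N\<^esub> f x)) b)"
        if "a \<in> gr A p" "b \<in> gr B q" "x \<in> gr M s" for a b x p q s
        using that k by (simp add: bi[OF f that(1)] V.left.act.smult_right V.right.act.smult_left N.sg_smult)
    qed
    show "(\<lambda>x\<in>carrier M. dif N (f x) \<oplus>\<^bsub>N\<^esub> sg N (n + 1) (f (dif M x))) \<in> ?H (n + 1)"
      if f: "f \<in> ?H n" for f n
    proof (rule I)
      interpret f: lin_map K M N f by (rule lin[OF f])
      show "linear_map K M N (\<lambda>x. dif N (f x) \<oplus>\<^bsub>N\<^esub> sg N (n + 1) (f (dif M x)))"
        by (rule linear_mapI) (simp_all add: f.add f.smult M.dif.add M.dif.smult N.dif.add N.dif.smult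
            N.sg_add N.sg_smult N.smult_r_distr N.a_ac)
      show "dif N (f x) \<oplus>\<^bsub>N\<^esub> sg N (n + 1) (f (dif M x)) \<in> gr N (p + (n + 1))" if "x \<in> gr M p" for x p
        using N.dif_degree[OF deg[OF f that]] deg[OF f M.dif_degree[OF that]]
        by (intro N.gr_add) (simp_all add: algebra_simps)
      show "dif N (f (r (l a x) b)) \<oplus>\<^bsub>N\<^esub> sg N (n + 1) (f (dif M (r (l a x) b))) =
          sg N ((n + 1) * p) (r' (l' a (dif N (f x) \<oplus>\<^bsub>N\<^esub> sg N (n + 1) (f (dif M x)))) b)"
        if a: "a \<in> gr A p" and b: "b \<in> gr B q" and x: "x \<in> gr M s" for a b x p q s
      proof -
        note da = A.dif_degree[OF a]
        have c: "a \<in> carrier A" "dif A a \<in> carrier A" "b \<in> carrier B" "dif B b \<in> carrier B"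
            "x \<in> carrier M" "dif M x \<in> carrier M"
          using a b x A.dif.closed B.dif.closed by simp_all
        let ?u = "r' (l' (dif A a) (f x)) b" and ?v = "r' (l' a (dif N (f x))) b"
        let ?w = "r' (l' a (f x)) (dif B b)" and ?z = "r' (l' a (f (dif M x))) b"
        have cl: "?u \<in> carrier N" "?v \<in> carrier N" "?w \<in> carrier N" "?z \<in> carrier N" using c by simp_all
        have 1: "dif N (f (r (l a x) b)) =
            sg N (n * p) ?u \<oplus>\<^bsub>N\<^esub> sg N (n * p + p) ?v \<oplus>\<^bsub>N\<^esub> sg N (n * p + (p + (s + n))) ?w"
          using c by (simp add: bi[OF f a] N.dif.sg V.bimodule_leibniz[OF a deg[OF f x]] N.sg_add)
        have 2: "f (dif M (r (l a x) b)) =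
            sg N (n * (p + 1)) ?u \<oplus>\<^bsub>N\<^esub> sg N (p + n * p) ?z \<oplus>\<^bsub>N\<^esub> sg N (p + s + n * p) ?w"
          using c by (simp add: U.bimodule_leibniz[OF a x] f.add f.sg bi[OF f da] bi[OF f a])
        have 3: "sg N (n + 1) (f (dif M (r (l a x) b))) =
            sg N (n * p + 1) ?u \<oplus>\<^bsub>N\<^esub> sg N (n + 1 + (p + n * p)) ?z \<oplus>\<^bsub>N\<^esub> sg N (n * p + (p + (s + n)) + 1) ?w"
        proof -
          have "sg N (n + 1 + n * (p + 1)) ?u = sg N (n * p + 1) ?u"
            "sg N (n + 1 + (p + s + n * p)) ?w = sg N (n * p + (p + (s + n)) + 1) ?w"
            by (rule sg_cong; auto)+
          then show ?thesis unfolding 2 using cl by (simp add: N.sg_add)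
        qed
        have canc: "sg N k y \<oplus>\<^bsub>N\<^esub> sg N (k + 1) y = \<zero>\<^bsub>N\<^esub>" if "y \<in> carrier N" for k y
          using that by (simp add: sg_def N.l_neg N.r_neg)
        have "dif N (f (r (l a x) b)) \<oplus>\<^bsub>N\<^esub> sg N (n + 1) (f (dif M (r (l a x) b))) =
            (sg N (n * p) ?u \<oplus>\<^bsub>N\<^esub> sg N (n * p + 1) ?u) \<oplus>\<^bsub>N\<^esub>
            ((sg N (n * p + p) ?v \<oplus>\<^bsub>N\<^esub> sg N (n + 1 + (p + n * p)) ?z) \<oplus>\<^bsub>N\<^esub>
            (sg N (n * p + (p + (s + n))) ?w \<oplus>\<^bsub>N\<^esub> sg N (n * p + (p + (s + n)) + 1) ?w))"
          unfolding 1 3 using cl N.sg_closed by (simp only: N.a_ac N.a_closed)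
        also have "\<dots> = sg N (n * p + p) ?v \<oplus>\<^bsub>N\<^esub> sg N (n + 1 + (p + n * p)) ?z"
          using cl by (simp only: canc N.l_zero N.r_zero N.a_closed N.sg_closed)
        also have "\<dots> = sg N ((n + 1) * p) (r' (l' a (dif N (f x) \<oplus>\<^bsub>N\<^esub> sg N (n + 1) (f (dif M x)))) b)"
          using c by (simp add: V.left.act.add_right V.left.act.sg_right V.right.act.add_left
              V.right.act.sg_left N.sg_add algebra_simps)
        finally show ?thesis .
      qed
    qed
  qed
qed

lemma bi_Dg_eq: "bi_Dg K A B = concrete_dg_cat K {(M, l, r). dg_bimodule K A B M l r} bi_maps"
  by (simp add: bi_Dg_def bi_maps_def)

lemma right_Dg_eq: "right_Dg K (tensor_dg K B (op_dg K A)) =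
    concrete_dg_cat K {(M, r). right_dg_module K (tensor_dg K B (op_dg K A)) M r} right_maps"
  by (simp add: right_Dg_def right_maps_def)

lemma left_Dg_eq: "left_Dg K (tensor_dg K A (op_dg K B)) =
    concrete_dg_cat K {(M, l). left_dg_module K (tensor_dg K A (op_dg K B)) M l} left_maps"
  by (simp add: left_Dg_def left_maps_def)

lemma bi_maps_ident:
  assumes U: "dg_bimodule K A B M l r"
  shows "(\<lambda>x\<in>carrier M. x) \<in> bi_maps (M, l, r) (M, l, r) 0"
proof -
  interpret M: dg_module K M using U by (rule dg_bimodule.axioms(3))
  interpret U: dg_bimodule K A B M l r by fact
  show ?thesis
    by (auto simp: bi_maps_iff graded_maps_def intro!: linear_mapI)
qed

lemma bi_Dg_category:
  "dg_category K (concrete_dg_cat K {(M, l, r). dg_bimodule K A B M l r} bi_maps)"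
proof (rule concrete_dg_category[OF A.is_cring], goal_cases)
  case (1 X Y)
  then show ?case using bi_maps_pieces by (auto split: prod.splits)
next
  case (2 X Y Z p q g f)
  obtain M l r where X: "X = (M, l, r)" by (cases X)
  obtain N l' r' where Y: "Y = (N, l', r')" by (cases Y)
  obtain P l'' r'' where Z: "Z = (P, l'', r'')" by (cases Z)
  have U: "dg_bimodule K A B M l r" and V: "dg_bimodule K A B N l' r'" and W: "dg_bimodule K A B P l'' r''"
    using 2 unfolding X Y Z by simp_all
  interpret M: dg_module K M using U by (rule dg_bimodule.axioms(3))
  interpret N: dg_module K N using V by (rule dg_bimodule.axioms(3))
  interpret P: dg_module K P using W by (rule dg_bimodule.axioms(3))
  interpret U: dg_bimodule K A B M l r by fact
  interpret V: dg_bimodule K A B N l' r' by fact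
  interpret W: dg_bimodule K A B P l'' r'' by fact
  have g: "g \<in> graded_maps K N P p" and f: "f \<in> graded_maps K M N q"
    using 2 unfolding X Y Z bi_maps_iff by simp_all
  interpret g: lin_map K N P g using g by unfold_locales (simp add: graded_maps_def)
  interpret f: lin_map K M N f using f by unfold_locales (simp add: graded_maps_def)
  have fg: "compose (carrier M) g f \<in> graded_maps K M P (p + q)"
  proof -
    have "linear_map K M P (compose (carrier M) g f)"
      by (rule linear_mapI) (simp_all add: compose_def f.add g.add f.smult g.smult)
    moreover have "g (f x) \<in> gr P (s + (p + q))" if "x \<in> gr M s" for x s
    proof -
      have "g (f x) \<in> gr P ((s + q) + p)" using f g that unfolding graded_maps_def by blast
      then show ?thesis by (simp add: algebra_simps)
    qed
    ultimately show ?thesis by (simp add: graded_maps_def compose_def)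
  qed
  have "compose (carrier M) g f (r (l a x) b) = sg P ((p + q) * n) (r'' (l'' a (compose (carrier M) g f x)) b)"
    if "a \<in> gr A n" "x \<in> carrier M" "b \<in> carrier B" for a n x b
  proof -
    have a: "a \<in> carrier A" using that by simp
    have "f (r (l a x) b) = sg N (q * n) (r' (l' a (f x)) b)"
      using 2(5) that unfolding X Y bi_maps_iff by blast
    moreover have "g (r' (l' a (f x)) b) = sg P (p * n) (r'' (l'' a (g (f x))) b)"
      using 2(4) that f.closed unfolding Y Z bi_maps_iff by blast
    ultimately show ?thesis
      using that a by (simp add: compose_def g.sg algebra_simps)
  qed
  then show ?case unfolding X Y Z using fg by (simp add: bi_maps_iff)
next
  case (3 X)
  then show ?case using bi_maps_ident by auto
qed

text \<open>
  On homogeneous elements the two conditions on \<open>f\<close> differ by the signs of the two identifications,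
  at \<open>x\<close> and at \<open>f(x)\<close>. The degrees of these elements differ by \<open>n\<close>, which leaves the sign
  $(-1)^{n|a|}$ of a bimodule homomorphism.
\<close>

lemma right_maps_eq:
  fixes M N :: "('k, 'm) dg"
  assumes U: "dg_bimodule K A B M l r" and V: "dg_bimodule K A B N l' r'"
    and \<rho>: "right_dg_module K (tensor_dg K B (op_dg K A)) M \<rho>" "right_identified K A B M l r \<rho>"
    and \<rho>': "right_dg_module K (tensor_dg K B (op_dg K A)) N \<rho>'" "right_identified K A B N l' r' \<rho>'"
  shows "right_maps (M, \<rho>) (N, \<rho>') n = bi_maps (M, l, r) (N, l', r') n"
proof -
  interpret M: dg_module K M using U by (rule dg_bimodule.axioms(3))
  interpret N: dg_module K N using V by (rule dg_bimodule.axioms(3))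
  interpret U: dg_bimodule K A B M l r by fact
  interpret V: dg_bimodule K A B N l' r' by fact
  interpret R: right_dg_module K "tensor_dg K B (op_dg K A)" M \<rho> by (rule \<rho>(1))
  interpret R': right_dg_module K "tensor_dg K B (op_dg K A)" N \<rho>' by (rule \<rho>'(1))
  have id: "\<rho> x (S.tensor_pure b a) = sg M ((s + q) * p) (r (l a x) b)"
    if "a \<in> gr A p" "b \<in> gr B q" "x \<in> gr M s" for a b x p q s
    using \<rho>(2) that by (simp add: right_identified_def)
  have id': "\<rho>' x (S.tensor_pure b a) = sg N ((s + q) * p) (r' (l' a x) b)"
    if "a \<in> gr A p" "b \<in> gr B q" "x \<in> gr N s" for a b x p q s
    using \<rho>'(2) that by (simp add: right_identified_def)
  have "f \<in> right_maps (M, \<rho>) (N, \<rho>') n \<longleftrightarrow> f \<in> bi_maps (M, l, r) (N, l', r') n"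
    if f: "f \<in> graded_maps K M N n" for f
  proof -
    interpret f: lin_map K M N f using f by unfold_locales (simp add: graded_maps_def)
    have deg: "f x \<in> gr N (s + n)" if "x \<in> gr M s" for x s using f that by (simp add: graded_maps_def)
    have key: "f (\<rho> x (S.tensor_pure b a)) = \<rho>' (f x) (S.tensor_pure b a) \<longleftrightarrow>
        f (r (l a x) b) = sg N (n * p) (r' (l' a (f x)) b)"
      if a: "a \<in> gr A p" and b: "b \<in> gr B q" and x: "x \<in> gr M s" for a b x p q s
    proof -
      have c: "f (r (l a x) b) \<in> carrier N" "r (l a x) b \<in> carrier M" "r' (l' a (f x)) b \<in> carrier N"
        using a b x by simp_all
      have "sg N ((s + n + q) * p) (r' (l' a (f x)) b) = sg N ((s + q) * p) (sg N (n * p) (r' (l' a (f x)) b))"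
        using c by (simp add: algebra_simps)
      then show ?thesis
        using c N.sg_inject[of "(s + q) * p" "f (r (l a x) b)"]
        by (auto simp: id[OF a b x] id'[OF a b deg[OF x]] f.sg simp del: N.sg_sg)
    qed
    show ?thesis
    proof
      assume "f \<in> right_maps (M, \<rho>) (N, \<rho>') n"
      then have "f (\<rho> x t) = \<rho>' (f x) t" if "x \<in> carrier M" "t \<in> carrier S.T" for x t
        using that by (simp add: right_maps_def)
      then show "f \<in> bi_maps (M, l, r) (N, l', r') n"
        by (intro bi_mapsI[OF U V f]) (simp flip: key)
    next
      assume bi: "f \<in> bi_maps (M, l, r) (N, l', r') n"
      have "f (\<rho> x t) = \<rho>' (f x) t" if x: "x \<in> carrier M" and t: "t \<in> carrier S.T" for x t
        using x
      proof (induction rule: M.gr_induct)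
        case (hom s x)
        note x = hom M.gr_closed[OF hom]
        show ?case using t
        proof (induction rule: S.homogeneous_pure_induct)
          case (pure q p b a)
          then have ab: "a \<in> gr A p" "b \<in> gr B q" by simp_all
          show ?case unfolding key[OF ab x(1)] using bi ab x by (simp add: bi_maps_iff)
        next
          case (add t t')
          then show ?case using x R.act.add_right[of x t t'] R'.act.add_right[of "f x" t t']
              R.act.closed[of x t] R.act.closed[of x t'] by (simp add: f.add)
        qed
      next
        case (add x y)
        then show ?case using t R.act.add_left[of x y t] R'.act.add_left[of "f x" "f y" t]
            R.act.closed[of x t] R.act.closed[of y t] by (simp add: f.add)
      qed
      then show "f \<in> right_maps (M, \<rho>) (N, \<rho>') n" using f by (simp add: right_maps_def)
    qed
  qed
  moreover have "right_maps (M, \<rho>) (N, \<rho>') n \<subseteq> graded_maps K M N n" by (auto simp: right_maps_def)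
  moreover have "bi_maps (M, l, r) (N, l', r') n \<subseteq> graded_maps K M N n" by (auto simp: bi_maps_def)
  ultimately show ?thesis by blast
qed

text \<open>
  As for right modules: the sign $(-1)^{n(|a|+|b|)}$ of a homomorphism of left modules and the sign
  $(-1)^{n|b|}$ from the change of degree leave $(-1)^{n|a|}$.
\<close>

lemma left_maps_eq:
  fixes M N :: "('k, 'm) dg"
  assumes U: "dg_bimodule K A B M l r" and V: "dg_bimodule K A B N l' r'"
    and \<mu>: "left_dg_module K (tensor_dg K A (op_dg K B)) M \<mu>" "left_identified K A B M l r \<mu>"
    and \<mu>': "left_dg_module K (tensor_dg K A (op_dg K B)) N \<mu>'" "left_identified K A B N l' r' \<mu>'"
  shows "left_maps (M, \<mu>) (N, \<mu>') n = bi_maps (M, l, r) (N, l', r') n"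
proof -
  interpret M: dg_module K M using U by (rule dg_bimodule.axioms(3))
  interpret N: dg_module K N using V by (rule dg_bimodule.axioms(3))
  interpret U: dg_bimodule K A B M l r by fact
  interpret V: dg_bimodule K A B N l' r' by fact
  interpret L: left_dg_module K "tensor_dg K A (op_dg K B)" M \<mu> by (rule \<mu>(1))
  interpret L': left_dg_module K "tensor_dg K A (op_dg K B)" N \<mu>' by (rule \<mu>'(1))
  have id: "\<mu> (T.tensor_pure a b) x = sg M (q * s) (r (l a x) b)"
    if "a \<in> gr A p" "b \<in> gr B q" "x \<in> gr M s" for a b x p q s
    using \<mu>(2) that by (simp add: left_identified_def)
  have id': "\<mu>' (T.tensor_pure a b) x = sg N (q * s) (r' (l' a x) b)"
    if "a \<in> gr A p" "b \<in> gr B q" "x \<in> gr N s" for a b x p q s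
    using \<mu>'(2) that by (simp add: left_identified_def)
  have "f \<in> left_maps (M, \<mu>) (N, \<mu>') n \<longleftrightarrow> f \<in> bi_maps (M, l, r) (N, l', r') n"
    if f: "f \<in> graded_maps K M N n" for f
  proof -
    interpret f: lin_map K M N f using f by unfold_locales (simp add: graded_maps_def)
    have deg: "f x \<in> gr N (s + n)" if "x \<in> gr M s" for x s using f that by (simp add: graded_maps_def)
    have key: "f (\<mu> (T.tensor_pure a b) x) = sg N (n * (p + q)) (\<mu>' (T.tensor_pure a b) (f x)) \<longleftrightarrow>
        f (r (l a x) b) = sg N (n * p) (r' (l' a (f x)) b)"
      if a: "a \<in> gr A p" and b: "b \<in> gr B q" and x: "x \<in> gr M s" for a b x p q s
    proof -
      have c: "f (r (l a x) b) \<in> carrier N" "r (l a x) b \<in> carrier M" "r' (l' a (f x)) b \<in> carrier N"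
        using a b x by simp_all
      have "sg N (n * (p + q)) (sg N (q * (s + n)) (r' (l' a (f x)) b)) =
          sg N (n * (p + q) + q * (s + n)) (r' (l' a (f x)) b)"
        using c by simp
      also have "\<dots> = sg N (q * s + n * p) (r' (l' a (f x)) b)" by (rule sg_cong) auto
      also have "\<dots> = sg N (q * s) (sg N (n * p) (r' (l' a (f x)) b))" using c by simp
      finally show ?thesis
        using c N.sg_inject[of "q * s" "f (r (l a x) b)"]
        by (auto simp: id[OF a b x] id'[OF a b deg[OF x]] f.sg simp del: N.sg_sg)
    qed
    show ?thesis
    proof
      assume left: "f \<in> left_maps (M, \<mu>) (N, \<mu>') n"
      show "f \<in> bi_maps (M, l, r) (N, l', r') n"
      proof (rule bi_mapsI[OF U V f])
        fix p q s a b x assume h: "a \<in> gr A p" "b \<in> gr B q" "x \<in> gr M s"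
        have "T.tensor_pure a b \<in> gr T.T (p + q)" using T.pure_degree[of a p b q] h by simp
        then have "f (\<mu> (T.tensor_pure a b) x) = sg N (n * (p + q)) (\<mu>' (T.tensor_pure a b) (f x))"
          using left M.gr_closed[OF h(3)] by (simp add: left_maps_def)
        then show "f (r (l a x) b) = sg N (n * p) (r' (l' a (f x)) b)" unfolding key[OF h] .
      qed
    next
      assume bi: "f \<in> bi_maps (M, l, r) (N, l', r') n"
      have "f (\<mu> t x) = sg N (n * m) (\<mu>' t (f x))" if x: "x \<in> carrier M" and t: "t \<in> gr T.T m" for x t m
        using x
      proof (induction rule: M.gr_induct)
        case (hom s x)
        note x = hom M.gr_closed[OF hom]
        show ?case using t
        proof (induction rule: T.T_gr_induct)
          case (pure p q a b)
          then have ab: "a \<in> gr A p" "b \<in> gr B q" and m: "m = p + q" by simp_all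
          show ?case unfolding m key[OF ab x(1)] using bi ab x by (simp add: bi_maps_iff)
        next
          case (add t t')
          then show ?case using x L.act.add_left[of t t' x] L'.act.add_left[of t t' "f x"]
              L.act.closed[of t x] L.act.closed[of t' x] L'.act.closed[of t "f x"] L'.act.closed[of t' "f x"]
            by (simp add: f.add N.sg_add)
        qed
      next
        case (add x y)
        then show ?case using T.TG.gr_closed[OF t] L.act.add_right[of t x y] L'.act.add_right[of t "f x" "f y"]
            L.act.closed[of t x] L.act.closed[of t y] L'.act.closed[of t "f x"] L'.act.closed[of t "f y"]
          by (simp add: f.add N.sg_add)
      qed
      then show "f \<in> left_maps (M, \<mu>) (N, \<mu>') n" using f by (simp add: left_maps_def)
    qed
  qed
  moreover have "left_maps (M, \<mu>) (N, \<mu>') n \<subseteq> graded_maps K M N n" by (auto simp: left_maps_def)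
  moreover have "bi_maps (M, l, r) (N, l', r') n \<subseteq> graded_maps K M N n" by (auto simp: bi_maps_def)
  ultimately show ?thesis by blast
qed

end

section \<open>The three notions of bimodule\<close>

context bi_algebras
begin

abbreviation bi_objects :: "(('k, 'm) dg \<times> ('a \<Rightarrow> 'm \<Rightarrow> 'm) \<times> ('m \<Rightarrow> 'b \<Rightarrow> 'm)) set" where
  "bi_objects \<equiv> {(M, l, r). dg_bimodule K A B M l r}"

abbreviation right_objects :: "(('k, 'm) dg \<times> ('m \<Rightarrow> ('b \<times> 'a \<Rightarrow>\<^sub>0 int) set \<Rightarrow> 'm)) set" where
  "right_objects \<equiv> {(M, r). right_dg_module K (tensor_dg K B (op_dg K A)) M r}"

abbreviation left_objects :: "(('k, 'm) dg \<times> (('a \<times> 'b \<Rightarrow>\<^sub>0 int) set \<Rightarrow> 'm \<Rightarrow> 'm)) set" where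
  "left_objects \<equiv> {(M, l). left_dg_module K (tensor_dg K A (op_dg K B)) M l}"

text \<open>
  By the one-to-one correspondences, the chosen structures are the only ones.
\<close>

definition bimodule_of_right where
  "bimodule_of_right = (\<lambda>(M, \<rho>). (M, SOME (l, r). dg_bimodule K A B M l r \<and> right_identified K A B M l r \<rho>))"

definition bimodule_of_left where
  "bimodule_of_left = (\<lambda>(M, \<mu>). (M, SOME (l, r). dg_bimodule K A B M l r \<and> left_identified K A B M l r \<mu>))"

definition left_of_bimodule where
  "left_of_bimodule = (\<lambda>(M, l, r). (M, SOME \<mu>. left_dg_module K (tensor_dg K A (op_dg K B)) M \<mu> \<and>
     left_identified K A B M l r \<mu>))"

lemma bimodule_of_right:
  assumes "right_dg_module K (tensor_dg K B (op_dg K A)) M \<rho>"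
  shows "\<exists>l r. bimodule_of_right (M, \<rho>) = (M, l, r) \<and> dg_bimodule K A B M l r \<and> right_identified K A B M l r \<rho>"
proof -
  let ?P = "\<lambda>(l, r). dg_bimodule K A B M l r \<and> right_identified K A B M l r \<rho>"
  obtain l r where "?P (l, r)" using bimodule_of_right_module[OF assms] by auto
  then have "?P (SOME s. ?P s)" by (rule someI)
  moreover obtain l' r' where "(SOME s. ?P s) = (l', r')" by (cases "SOME s. ?P s")
  ultimately show ?thesis by (simp add: bimodule_of_right_def)
qed

lemma bimodule_of_left:
  assumes "left_dg_module K (tensor_dg K A (op_dg K B)) M \<mu>"
  shows "\<exists>l r. bimodule_of_left (M, \<mu>) = (M, l, r) \<and> dg_bimodule K A B M l r \<and> left_identified K A B M l r \<mu>"
proof -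
  let ?P = "\<lambda>(l, r). dg_bimodule K A B M l r \<and> left_identified K A B M l r \<mu>"
  obtain l r where "?P (l, r)" using bimodule_of_left_module[OF assms] by auto
  then have "?P (SOME s. ?P s)" by (rule someI)
  moreover obtain l' r' where "(SOME s. ?P s) = (l', r')" by (cases "SOME s. ?P s")
  ultimately show ?thesis by (simp add: bimodule_of_left_def)
qed

lemma left_of_bimodule:
  assumes "dg_bimodule K A B M l r"
  shows "\<exists>\<mu>. left_of_bimodule (M, l, r) = (M, \<mu>) \<and>
    left_dg_module K (tensor_dg K A (op_dg K B)) M \<mu> \<and> left_identified K A B M l r \<mu>"
  using someI_ex[OF left_module_of_bimodule[OF assms]] by (simp add: left_of_bimodule_def)

text \<open>
  Since the identifications preserve the underlying complexes and the homomorphisms, each of the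
  categories of modules is a category with the Hom complexes of bimodules.
\<close>

lemma right_functor: "concrete_functor K bi_objects bi_maps right_objects right_maps bimodule_of_right"
proof (intro concrete_functor.intro concrete_functor_axioms.intro bi_Dg_category, goal_cases)
  case (1 X)
  then show ?case using bimodule_of_right by fastforce
next
  case (2 X)
  then show ?case by (auto simp: bimodule_of_right_def)
next
  case (3 X Y)
  obtain M \<rho> N \<rho>' where XY: "X = (M, \<rho>)" "Y = (N, \<rho>')" by (cases X, cases Y)
  with 3 have \<rho>: "right_dg_module K (tensor_dg K B (op_dg K A)) M \<rho>"
    "right_dg_module K (tensor_dg K B (op_dg K A)) N \<rho>'" by simp_all
  from bimodule_of_right[OF \<rho>(1)] obtain l r where 1: "bimodule_of_right (M, \<rho>) = (M, l, r)"
    "dg_bimodule K A B M l r" "right_identified K A B M l r \<rho>" by blast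
  from bimodule_of_right[OF \<rho>(2)] obtain l' r' where 2: "bimodule_of_right (N, \<rho>') = (N, l', r')"
    "dg_bimodule K A B N l' r'" "right_identified K A B N l' r' \<rho>'" by blast
  show ?case
    unfolding XY 1(1) 2(1) using right_maps_eq[OF 1(2) 2(2) \<rho>(1) 1(3) \<rho>(2) 2(3)] by (intro ext) simp
qed

lemma left_functor: "concrete_functor K bi_objects bi_maps left_objects left_maps bimodule_of_left"
proof (intro concrete_functor.intro concrete_functor_axioms.intro bi_Dg_category, goal_cases)
  case (1 X)
  then show ?case using bimodule_of_left by fastforce
next
  case (2 X)
  then show ?case by (auto simp: bimodule_of_left_def)
next
  case (3 X Y)
  obtain M \<mu> N \<mu>' where XY: "X = (M, \<mu>)" "Y = (N, \<mu>')" by (cases X, cases Y)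
  with 3 have \<mu>: "left_dg_module K (tensor_dg K A (op_dg K B)) M \<mu>"
    "left_dg_module K (tensor_dg K A (op_dg K B)) N \<mu>'" by simp_all
  from bimodule_of_left[OF \<mu>(1)] obtain l r where 1: "bimodule_of_left (M, \<mu>) = (M, l, r)"
    "dg_bimodule K A B M l r" "left_identified K A B M l r \<mu>" by blast
  from bimodule_of_left[OF \<mu>(2)] obtain l' r' where 2: "bimodule_of_left (N, \<mu>') = (N, l', r')"
    "dg_bimodule K A B N l' r'" "left_identified K A B N l' r' \<mu>'" by blast
  show ?case
    unfolding XY 1(1) 2(1) using left_maps_eq[OF 1(2) 2(2) \<mu>(1) 1(3) \<mu>(2) 2(3)] by (intro ext) simp
qed

lemma left_Dg_category: "dg_category K (concrete_dg_cat K left_objects left_maps)"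
  using concrete_functor.source_dg_category[OF left_functor] .

lemma bi_functor: "concrete_functor K left_objects left_maps bi_objects bi_maps left_of_bimodule"
proof (intro concrete_functor.intro concrete_functor_axioms.intro left_Dg_category, goal_cases)
  case (1 X)
  then show ?case using left_of_bimodule by fastforce
next
  case (2 X)
  then show ?case by (auto simp: left_of_bimodule_def)
next
  case (3 X Y)
  obtain M l r N l' r' where XY: "X = (M, l, r)" "Y = (N, l', r')" by (cases X, cases Y)
  with 3 have b: "dg_bimodule K A B M l r" "dg_bimodule K A B N l' r'" by simp_all
  from left_of_bimodule[OF b(1)] obtain \<mu> where 1: "left_of_bimodule (M, l, r) = (M, \<mu>)"
    "left_dg_module K (tensor_dg K A (op_dg K B)) M \<mu>" "left_identified K A B M l r \<mu>" by blast
  from left_of_bimodule[OF b(2)] obtain \<mu>' where 2: "left_of_bimodule (N, l', r') = (N, \<mu>')"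
    "left_dg_module K (tensor_dg K A (op_dg K B)) N \<mu>'" "left_identified K A B N l' r' \<mu>'" by blast
  show ?case
    unfolding XY 1(1) 2(1) using left_maps_eq[OF b 1(2,3) 2(2,3)] by (intro ext) simp
qed

lemma right_equivalence:
  "dg_equivalence K (concrete_dg_cat K right_objects right_maps) (concrete_dg_cat K bi_objects bi_maps)
    bimodule_of_right (\<lambda>X Y f. f)"
proof (rule concrete_functor.equivalence[OF right_functor])
  show "(\<lambda>x\<in>carrier (fst Z). x) \<in> bi_maps Z Z 0" if "Z \<in> bi_objects" for Z :: "('k, 'm) dg \<times> _"
    using that bi_maps_ident by auto
  show "\<exists>X\<in>right_objects. bimodule_of_right X = Z" if "Z \<in> bi_objects" for Z :: "('k, 'm) dg \<times> _"
  proof -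
    obtain M l r where Z: "Z = (M, l, r)" by (cases Z)
    then have lr: "dg_bimodule K A B M l r" using that by simp
    obtain \<rho> where \<rho>: "right_dg_module K (tensor_dg K B (op_dg K A)) M \<rho>" "right_identified K A B M l r \<rho>"
      using right_module_of_bimodule[OF lr] by blast
    obtain l' r' where lr': "bimodule_of_right (M, \<rho>) = (M, l', r')" "dg_bimodule K A B M l' r'"
      "right_identified K A B M l' r' \<rho>" using bimodule_of_right[OF \<rho>(1)] by blast
    have "(l', r') = (l, r)"
      using right_one_to_one[of M] \<rho> lr lr'(2,3) unfolding one_to_one_def by (auto 4 3)
    then show ?thesis using lr'(1) \<rho>(1) Z by auto
  qed
qed

lemma left_equivalence:
  "dg_equivalence K (concrete_dg_cat K bi_objects bi_maps) (concrete_dg_cat K left_objects left_maps)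
    left_of_bimodule (\<lambda>X Y f. f)"
proof (rule concrete_functor.equivalence[OF bi_functor])
  show "(\<lambda>x\<in>carrier (fst Z). x) \<in> left_maps Z Z 0" if Z: "Z \<in> left_objects" for Z :: "('k, 'm) dg \<times> _"
  proof -
    interpret f: concrete_functor K bi_objects bi_maps left_objects left_maps bimodule_of_left
      by (rule left_functor)
    have "(\<lambda>x\<in>carrier (fst (bimodule_of_left Z)). x) \<in> bi_maps (bimodule_of_left Z) (bimodule_of_left Z) 0"
      using f.F0_Obs[OF Z] bi_maps_ident by auto
    then show ?thesis using f.F0_fst[OF Z] f.F0_H[OF Z Z] by simp
  qed
  show "\<exists>X\<in>bi_objects. left_of_bimodule X = Z" if "Z \<in> left_objects" for Z :: "('k, 'm) dg \<times> _"
  proof -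
    obtain M \<mu> where Z: "Z = (M, \<mu>)" by (cases Z)
    then have \<mu>: "left_dg_module K (tensor_dg K A (op_dg K B)) M \<mu>" using that by simp
    obtain l r where lr: "dg_bimodule K A B M l r" "left_identified K A B M l r \<mu>"
      using bimodule_of_left_module[OF \<mu>] by blast
    obtain \<mu>' where \<mu>': "left_of_bimodule (M, l, r) = (M, \<mu>')"
      "left_dg_module K (tensor_dg K A (op_dg K B)) M \<mu>'" "left_identified K A B M l r \<mu>'"
      using left_of_bimodule[OF lr(1)] by blast
    have "\<mu>' = \<mu>"
      using left_one_to_one[of M] \<mu> lr \<mu>'(2,3) unfolding one_to_one_def by (auto 4 3)
    then show ?thesis using \<mu>'(1) lr(1) Z by auto
  qed
qed

end

theorem proposition5p2:
  fixes K :: "'k ring" and A :: "('k, 'a) dg" and B :: "('k, 'b) dg"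
  assumes "cring K" and "dg_algebra_ei K A" and "dg_algebra_ei K B"
  shows "(\<forall>M :: ('k, 'm) dg. dg_module K M \<longrightarrow>
      one_to_one (\<lambda>(l, r). dg_bimodule K A B M l r)
        (\<lambda>\<rho>. right_dg_module K (tensor_dg K B (op_dg K A)) M \<rho>)
        (\<lambda>(l, r) \<rho>. right_identified K A B M l r \<rho>) \<and>
      one_to_one (\<lambda>(l, r). dg_bimodule K A B M l r)
        (\<lambda>\<mu>. left_dg_module K (tensor_dg K A (op_dg K B)) M \<mu>)
        (\<lambda>(l, r) \<mu>. left_identified K A B M l r \<mu>)) \<and>
    (let R = right_Dg K (tensor_dg K B (op_dg K A))
               :: ('k, ('k, 'm) dg \<times> ('m \<Rightarrow> ('b \<times> 'a \<Rightarrow>\<^sub>0 int) set \<Rightarrow> 'm), 'm \<Rightarrow> 'm) dg_cat;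
         C = bi_Dg K A B
               :: ('k, ('k, 'm) dg \<times> ('a \<Rightarrow> 'm \<Rightarrow> 'm) \<times> ('m \<Rightarrow> 'b \<Rightarrow> 'm), 'm \<Rightarrow> 'm) dg_cat;
         L = left_Dg K (tensor_dg K A (op_dg K B))
               :: ('k, ('k, 'm) dg \<times> (('a \<times> 'b \<Rightarrow>\<^sub>0 int) set \<Rightarrow> 'm \<Rightarrow> 'm), 'm \<Rightarrow> 'm) dg_cat
     in
      (\<exists>F0 F1. dg_equivalence K R C F0 F1 \<and>
         (\<forall>M \<rho>. (M, \<rho>) \<in> Obj R \<longrightarrow>
            (\<exists>l r. F0 (M, \<rho>) = (M, l, r) \<and> right_identified K A B M l r \<rho>)) \<and>
         (\<forall>X\<in>Obj R. \<forall>Y\<in>Obj R. \<forall>f\<in>carrier (Hom R X Y). F1 X Y f = f)) \<and>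
      (\<exists>G0 G1. dg_equivalence K C L G0 G1 \<and>
         (\<forall>M l r. (M, l, r) \<in> Obj C \<longrightarrow>
            (\<exists>\<mu>. G0 (M, l, r) = (M, \<mu>) \<and> left_identified K A B M l r \<mu>)) \<and>
         (\<forall>X\<in>Obj C. \<forall>Y\<in>Obj C. \<forall>f\<in>carrier (Hom C X Y). G1 X Y f = f)))"
proof -
  interpret bi_algebras K A B by (rule bi_algebras.intro) fact+
  show ?thesis
    unfolding Let_def right_Dg_eq left_Dg_eq bi_Dg_eq
  proof (intro conjI allI impI right_one_to_one left_one_to_one
      exI[of _ bimodule_of_right] exI[of _ left_of_bimodule] exI[of _ "\<lambda>X Y f. f"]
      right_equivalence left_equivalence)
    fix M :: "('k, 'm) dg" and \<rho>
    assume "(M, \<rho>) \<in> Obj (concrete_dg_cat K right_objects right_maps)"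
    then show "\<exists>l r. bimodule_of_right (M, \<rho>) = (M, l, r) \<and> right_identified K A B M l r \<rho>"
      using bimodule_of_right[of M \<rho>] by auto
  next
    fix M :: "('k, 'm) dg" and l r
    assume "(M, l, r) \<in> Obj (concrete_dg_cat K bi_objects bi_maps)"
    then show "\<exists>\<mu>. left_of_bimodule (M, l, r) = (M, \<mu>) \<and> left_identified K A B M l r \<mu>"
      using left_of_bimodule[of M l r] by auto
  qed simp_all
qed

end
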